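(* Let $1\ge\varepsilon>0$ be given, and assume $\lambda\le\sqrt{\pi p}$ and $|\log\varepsilon|\le\sqrt p$. Let $B:\mathbb{C}^m\to\mathbb{C}^p$ and $B^*:\mathbb{C}^p\to\mathbb{C}^m$ be the transforms $$(B\alpha)_j=\sum_{i=1}^m\alpha_i\psi_i(x_j)h,\qquad (B^*f)_i=\sum_{j=1}^p f_j\overline{\psi_i(x_j)}h,$$ and let $\tilde B^*$ and $\tilde B$ be the operators whose actions consist of applying, respectively, Algorithm I and Algorithm II described in the context (run with accuracy parameter $\varepsilon$). Then, for all images $f\in\mathbb{C}^p$ and all coefficient vectors $\alpha\in\mathbb{C}^m$, $$\|\tilde B^*f-B^*f\|_{\ell^\infty}\le\varepsilon\|f\|_{\ell^1}\qquad\text{and}\qquad\|\tilde B\alpha-B\alpha\|_{\ell^\infty}\le\varepsilon\|\alpha\|_{\ell^1}.$$ Moreover, both algorithms involve $\mathcal{O}(p\log p+p|\log\varepsilon|^2)$ operations.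
   Context: **Images.** Let $L$ be a positive integer, $p=L^2$, $h=1/\lfloor (L+1)/2\rfloor$. The pixel locations are $x_{j_1j_2}=(hj_1-1,hj_2-1)\in[-1,1]^2$ for an $L\times L$ array of indices; $x_1,\dots,x_p$ is an enumeration of them, and $x_j=(r_j\cos\theta_j,r_j\sin\theta_j)$ in polar coordinates. An image is a vector $f=(f_1,\dots,f_p)$ of samples at the pixels of a function supported on the open unit disk. Thus $f_j=0$ whenever $|x_j|\ge1$, and the output image of Algorithm II is set to $0$ at pixels with $|x_j|\ge 1$. **Basis.** For $(n,k)\in\mathbb{Z}\times\mathbb{Z}_{>0}$, $J_n$ is the Bessel function of the first kind of order $n$, $\lambda_{nk}$ is its $k$-th smallest positive root, $c_{nk}=\frac{1}{\pi^{1/2}|J_{n+1}(\lambda_{nk})|}$, and in polar coordinates $\psi_{nk}(r,\theta)=c_{nk}J_n(\lambda_{nk}r)e^{\imath n\theta}\chi_{[0,1)}(r)$, where $\chi_{[0,1)}$ is the indicator function of $[0,1)$. For a bandlimit $\lambda>0$ let $m=\#\{(n,k):\lambda_{nk}\le\lambda\}$, let $\lambda_1\le\dots\le\lambda_m$ enumerate the roots $\lambda_{nk}\le\lambda$, and let $\psi_i,c_i,n_i$ be the corresponding eigenfunction, normalization constant and Bessel order, so $\psi_i=\psi_{n_ik_i}$, $c_i=c_{n_ik_i}$, $\lambda_i=\lambda_{n_ik_i}$. Let $N_m=\max\{n_i:1\le i\le m\}$. It is understood that $\lambda_1<\lambda_m$. **Norms.** $\|v\|_{\ell^1}=\sum_j|v_j|$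 and $\|v\|_{\ell^\infty}=\max_j|v_j|$. **Nodes.** $t_k=\frac{\lambda_m-\lambda_1}{2}\cos\left(\frac{2k+1}{q}\cdot\frac{\pi}{2}\right)+\frac{\lambda_1+\lambda_m}{2}$ for $k=0,\dots,q-1$; $\phi_\ell=2\pi\ell/s$ for $\ell=0,\dots,s-1$; $\xi_{k\ell}=t_k(\cos\phi_\ell,\sin\phi_\ell)$; $u_k(t)=\prod_{\ell\ne k}\frac{t-t_\ell}{t_k-t_\ell}$ are the Lagrange interpolation polynomials. In both algorithms $$\varepsilon^{\rm dis}=\left(2\sqrt2\left(3+\tfrac{\pi}{2}\log(2.4\sqrt p)\right)\right)^{-1}\tfrac{\varepsilon}{2},\quad s=\lceil\max\{7.09\sqrt p,|\log_2\varepsilon^{\rm dis}|\}\rceil,\quad q=\lceil\max\{2.4\sqrt p,|\log_2\varepsilon^{\rm dis}|\}\rceil.$$ **Subroutines.** The NUFFT (non-uniform fast Fourier transform) evaluates sums $\sum_a v_ae^{\pm\imath y_a\cdot\eta_b}$ with $N$ source points $y_a$ and $M$ target points $\eta_b$ in $\mathbb{R}^d$; with relative error $\delta\in(0,1]$ this means each output has error at most $\delta\sum_a|v_a|$, and it costs $\mathcal{O}(N\log N+M(\log\frac1\delta)^d)$ operations. An FFT of size $N$ costs $\mathcal{O}(N\log N)$. Fast Chebyshev interpolation (performed using the one-dimensional NUFFT) evaluates $\sum_{k=0}^{q-1}v_ku_k(w_b)$ at $M$ targets $w_b$, or applies the adjoint map, with relative error $\delta$ in the same $\ell^1$-$\ell^\infty$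 sense (error in each output at most $\delta$ times the $\ell^1$-norm of the input) in $\mathcal{O}(q\log q+M|\log\delta|)$ operations. **Algorithm I (for $B^*$; input $f$, output $\tilde B^*f=\alpha$).** Set $\varepsilon^{\rm nuf}=\left(2\sqrt2(2+\frac{\pi}{2}\log q)\right)^{-1}\frac{\varepsilon}{4}$ and $\varepsilon^{\rm fst}=(4\sqrt2q)^{-1}\frac{\varepsilon}{4}$. 1. By two-dimensional NUFFT with relative error $\varepsilon^{\rm nuf}$ compute $a_{k\ell}=\sum_{j=1}^pf_je^{-\imath x_j\cdot\xi_{k\ell}}$ for $0\le k\le q-1$, $0\le\ell\le s-1$. 2. By FFT compute $\beta_{nk}=\frac{\imath^n}{s}\sum_{\ell=0}^{s-1}a_{k\ell}e^{-\imath n\phi_\ell}$ for $0\le k\le q-1$, $-N_m\le n\le N_m$. 3. By fast Chebyshev interpolation (for each order $n$ separately) with relative error $\varepsilon^{\rm fst}$ compute $\sum_{k=0}^{q-1}\beta_{n_ik}u_k(\lambda_i)$, and multiply by $c_ih$ to obtain $\alpha_i=\sum_{k=0}^{q-1}c_i\beta_{n_ik}u_k(\lambda_i)h$, for $1\le i\le m$. **Algorithm II (for $B$; input $\alpha$, output $\tilde B\alpha=f$).** Set $\varepsilon^{\rm nuf}=\left(2\sqrt2(3+\frac{\pi}{2}\log q)\right)^{-1}\frac{\varepsilon}{4}$ and $\varepsilon^{\rm fst}=(2\sqrt2q)^{-1}\frac{\varepsilon}{4}$. 1. By (adjoint) fast Chebyshev interpolation with relative error $\varepsilon^{\rm fst}$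 compute $\beta^*_{nk}=h\sum_{i:n_i=n}u_k(\lambda_i)c_i\alpha_i$ for $-N_m\le n\le N_m$, $0\le k\le q-1$; here the error in each $\beta^*_{nk}$ is at most $\varepsilon^{\rm fst}\sum_{i:n_i=n}c_ih|\alpha_i|$. 2. By FFT compute $a^*_{k\ell}=\sum_{n=-N_m}^{N_m}\frac{(-\imath)^n}{s}e^{\imath n\phi_\ell}\beta^*_{nk}$ for $0\le k\le q-1$, $0\le\ell\le s-1$. 3. By two-dimensional NUFFT with relative error $\varepsilon^{\rm nuf}$ compute $f_j=\sum_{k=0}^{q-1}\sum_{\ell=0}^{s-1}e^{\imath x_j\cdot\xi_{k\ell}}a^*_{k\ell}$ for $1\le j\le p$. *)

theory Defs
  imports "HOL-Analysis.Analysis"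
begin

text \<open>
  Conventions. The plane is identified with \<open>complex\<close>, so \<open>cmod z\<close> and \<open>Arg z\<close> are the polar
  coordinates of \<open>z\<close> and \<open>z \<bullet> w\<close> is the Euclidean inner product. A vector of length \<open>N\<close> is a
  function on \<open>nat\<close> of which only the values on \<open>{..<N}\<close> matter; thus the pixels, modes and
  roots are numbered from 0, e.g. the smallest root of the band is \<open>mode_root md 0\<close> and the
  largest one is \<open>mode_root md (m - 1)\<close>.
\<close>

subsection \<open>Images\<close>

definition pixel_size :: "nat \<Rightarrow> real" where
  "pixel_size L = 1 / real ((L + 1) div 2)"

definition pixel :: "nat \<Rightarrow> nat \<times> nat \<Rightarrow> complex" where
  "pixel L j = Complex (pixel_size L * real (fst j) - 1) (pixel_size L * real (snd j) - 1)"

text \<open>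
  \<open>x\<close> enumerates the \<open>L\<^sup>2\<close> pixels. The index array is \<open>{a..<a+L} \<times> {a..<a+L}\<close>, where any
  first index \<open>a\<close> is allowed that keeps the pixels in \<open>[-1,1]\<^sup>2\<close> (such as 0 or 1).
\<close>
definition pixel_enumeration :: "nat \<Rightarrow> (nat \<Rightarrow> complex) \<Rightarrow> bool" where
  "pixel_enumeration L x \<longleftrightarrow>
     (\<exists>a. (\<forall>j\<in>{a..<a+L}. pixel_size L * real j - 1 \<in> {-1..1}) \<and>
          bij_betw x {..<L^2} (pixel L ` ({a..<a+L} \<times> {a..<a+L})))"

definition is_image :: "nat \<Rightarrow> (nat \<Rightarrow> complex) \<Rightarrow> (nat \<Rightarrow> complex) \<Rightarrow> bool" where
  "is_image L x f \<longleftrightarrow> (\<forall>j<L^2. cmod (x j) \<ge> 1 \<longrightarrow> f j = 0)"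

definition l1_norm :: "nat \<Rightarrow> (nat \<Rightarrow> complex) \<Rightarrow> real" where
  "l1_norm N v = (\<Sum>j<N. cmod (v j))"

text \<open>Used for \<open>N > 0\<close> only.\<close>
definition linf_norm :: "nat \<Rightarrow> (nat \<Rightarrow> complex) \<Rightarrow> real" where
  "linf_norm N v = Max ((\<lambda>j. cmod (v j)) ` {..<N})"

subsection \<open>The basis\<close>

text \<open>
  Bessel functions of the first kind of integer order, with \<open>J\<^bsub>-n\<^esub> = (-1)\<^sup>n J\<^bsub>n\<^esub>\<close>.
\<close>
definition bessel_J :: "int \<Rightarrow> real \<Rightarrow> real" where
  "bessel_J n x =
     (if n < 0 then (-1) ^ nat \<bar>n\<bar> else 1) *
     (\<Sum>j. (-1) ^ j / (fact j * fact (j + nat \<bar>n\<bar>)) * (x / 2) ^ (2 * j + nat \<bar>n\<bar>))"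

text \<open>The \<open>k\<close>-th smallest positive root of \<open>J\<^bsub>n\<^esub>\<close>, for \<open>k \<ge> 1\<close>.\<close>
definition bessel_root :: "int \<Rightarrow> nat \<Rightarrow> real" where
  "bessel_root n k =
     (THE y. 0 < y \<and> bessel_J n y = 0 \<and> card {z. 0 < z \<and> z \<le> y \<and> bessel_J n z = 0} = k)"

definition norm_const :: "int \<Rightarrow> nat \<Rightarrow> real" where
  "norm_const n k = 1 / (sqrt pi * \<bar>bessel_J (n + 1) (bessel_root n k)\<bar>)"

definition psi :: "int \<Rightarrow> nat \<Rightarrow> real \<Rightarrow> real \<Rightarrow> complex" where
  "psi n k r \<theta> =
     complex_of_real (norm_const n k * bessel_J n (bessel_root n k * r)) *
     exp (\<i> * of_int n * complex_of_real \<theta>) * indicator {0..<1} r"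

definition band :: "real \<Rightarrow> (int \<times> nat) set" where
  "band lam = {(n, k). k \<ge> 1 \<and> bessel_root n k \<le> lam}"

abbreviation mode_root :: "(nat \<Rightarrow> int \<times> nat) \<Rightarrow> nat \<Rightarrow> real" where
  "mode_root md i \<equiv> bessel_root (fst (md i)) (snd (md i))"

abbreviation mode_const :: "(nat \<Rightarrow> int \<times> nat) \<Rightarrow> nat \<Rightarrow> real" where
  "mode_const md i \<equiv> norm_const (fst (md i)) (snd (md i))"

text \<open>\<open>md i = (n\<^sub>i, k\<^sub>i)\<close> enumerates the band in the order of nondecreasing roots.\<close>
definition mode_enumeration :: "real \<Rightarrow> (nat \<Rightarrow> int \<times> nat) \<Rightarrow> bool" where
  "mode_enumeration lam md \<longleftrightarrow>
     bij_betw md {..<card (band lam)} (band lam) \<and>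
     mono_on {..<card (band lam)} (mode_root md)"

definition max_order :: "nat \<Rightarrow> (nat \<Rightarrow> int \<times> nat) \<Rightarrow> int" where
  "max_order m md = Max ((\<lambda>i. fst (md i)) ` {..<m})"

definition psi_at :: "(nat \<Rightarrow> int \<times> nat) \<Rightarrow> nat \<Rightarrow> complex \<Rightarrow> complex" where
  "psi_at md i z = psi (fst (md i)) (snd (md i)) (cmod z) (Arg z)"

definition transform_B ::
  "nat \<Rightarrow> (nat \<Rightarrow> complex) \<Rightarrow> nat \<Rightarrow> (nat \<Rightarrow> int \<times> nat) \<Rightarrow> (nat \<Rightarrow> complex) \<Rightarrow> nat \<Rightarrow> complex" where
  "transform_B L x m md \<alpha> j = (\<Sum>i<m. \<alpha> i * psi_at md i (x j) * of_real (pixel_size L))"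

definition transform_Bstar ::
  "nat \<Rightarrow> (nat \<Rightarrow> complex) \<Rightarrow> (nat \<Rightarrow> int \<times> nat) \<Rightarrow> (nat \<Rightarrow> complex) \<Rightarrow> nat \<Rightarrow> complex" where
  "transform_Bstar L x md f i = (\<Sum>j<L^2. f j * cnj (psi_at md i (x j)) * of_real (pixel_size L))"

subsection \<open>Nodes\<close>

definition eps_dis :: "nat \<Rightarrow> real \<Rightarrow> real" where
  "eps_dis p \<epsilon> = inverse (2 * sqrt 2 * (3 + pi / 2 * ln (2.4 * sqrt (real p)))) * (\<epsilon> / 2)"

definition num_angles :: "nat \<Rightarrow> real \<Rightarrow> nat" where
  "num_angles p \<epsilon> = nat \<lceil>max (7.09 * sqrt (real p)) \<bar>log 2 (eps_dis p \<epsilon>)\<bar>\<rceil>"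

definition num_radii :: "nat \<Rightarrow> real \<Rightarrow> nat" where
  "num_radii p \<epsilon> = nat \<lceil>max (2.4 * sqrt (real p)) \<bar>log 2 (eps_dis p \<epsilon>)\<bar>\<rceil>"

definition cheb_node :: "real \<Rightarrow> real \<Rightarrow> nat \<Rightarrow> nat \<Rightarrow> real" where
  "cheb_node a b q k =
     (b - a) / 2 * cos ((2 * real k + 1) / real q * (pi / 2)) + (a + b) / 2"

definition lagrange_u :: "real \<Rightarrow> real \<Rightarrow> nat \<Rightarrow> nat \<Rightarrow> real \<Rightarrow> real" where
  "lagrange_u a b q k t =
     (\<Prod>l\<in>{..<q} - {k}. (t - cheb_node a b q l) / (cheb_node a b q k - cheb_node a b q l))"

definition angle :: "nat \<Rightarrow> nat \<Rightarrow> real" where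
  "angle s l = 2 * pi * real l / real s"

definition freq_node :: "real \<Rightarrow> real \<Rightarrow> nat \<Rightarrow> nat \<Rightarrow> nat \<times> nat \<Rightarrow> complex" where
  "freq_node a b q s kl =
     of_real (cheb_node a b q (fst kl)) * Complex (cos (angle s (snd kl))) (sin (angle s (snd kl)))"

subsection \<open>Subroutines\<close>

text \<open>
  A subroutine returns its output together with the number of operations it used. The
  predicates below say what is guaranteed about it: the accuracy of the output, and the
  \<open>O\<close>-bound on the number of operations, whose constant is uniform in all arguments. The
  \<open>O\<close>-bounds are only required away from the degenerate arguments (sizes below 2, or relative
  errors near 1) at which the logarithms in them vanish. Points and values are indexed by
  finite index sets.
\<close>

text \<open>
  \<open>F \<delta> A y B \<eta> v\<close> approximates \<open>\<Sum>a\<in>A. v a * exp (\<sigma> \<i> y\<^sub>a \<bullet> \<eta>\<^sub>b)\<close> for all \<open>b \<in> B\<close>, with \<open>\<sigma> = \<plusminus>1\<close>.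
\<close>
type_synonym ('a, 'b, 'v) nufft =
  "real \<Rightarrow> 'a set \<Rightarrow> ('a \<Rightarrow> 'v) \<Rightarrow> 'b set \<Rightarrow> ('b \<Rightarrow> 'v) \<Rightarrow> ('a \<Rightarrow> complex) \<Rightarrow> ('b \<Rightarrow> complex) \<times> nat"

definition is_nufft :: "real \<Rightarrow> ('a, 'b, 'v::euclidean_space) nufft \<Rightarrow> bool" where
  "is_nufft \<sigma> F \<longleftrightarrow>
     (\<forall>\<delta> A y B \<eta> v. finite A \<and> finite B \<and> 0 < \<delta> \<and> \<delta> \<le> 1 \<longrightarrow>
        (\<forall>b\<in>B. cmod (fst (F \<delta> A y B \<eta> v) b
                      - (\<Sum>a\<in>A. v a * exp (\<i> * complex_of_real (\<sigma> * (y a \<bullet> \<eta> b)))))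
               \<le> \<delta> * (\<Sum>a\<in>A. cmod (v a)))) \<and>
     (\<exists>C. \<forall>\<delta> A y B \<eta> v. finite A \<and> finite B \<and> 2 \<le> card A \<and> 0 < \<delta> \<and> \<delta> \<le> 1/2 \<longrightarrow>
        real (snd (F \<delta> A y B \<eta> v))
          \<le> C * (real (card A) * ln (real (card A)) + real (card B) * ln (1 / \<delta>) ^ DIM('v)))"

text \<open>The discrete Fourier transform of size \<open>N\<close>, computed exactly.\<close>
type_synonym fft = "nat \<Rightarrow> (nat \<Rightarrow> complex) \<Rightarrow> (nat \<Rightarrow> complex) \<times> nat"

definition is_fft :: "real \<Rightarrow> fft \<Rightarrow> bool" where
  "is_fft \<sigma> F \<longleftrightarrow>
     (\<forall>N v. \<forall>b<N. fst (F N v) b =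
        (\<Sum>a<N. v a * exp (\<i> * complex_of_real (\<sigma> * (2 * pi * real a * real b / real N))))) \<and>
     (\<exists>C. \<forall>N v. 2 \<le> N \<longrightarrow> real (snd (F N v)) \<le> C * (real N * ln (real N)))"

text \<open>
  \<open>F \<delta> a b q I w v\<close>: interpolation at the \<open>q\<close> Chebyshev nodes of \<open>[a,b]\<close>, with targets
  \<open>w i \<in> [a,b]\<close> for \<open>i \<in> I\<close>. In \<open>is_cheb_interp\<close> the input \<open>v\<close> is indexed by the nodes and the
  output by \<open>I\<close>; for the adjoint map it is the other way round.
\<close>
type_synonym cheb_map =
  "real \<Rightarrow> real \<Rightarrow> real \<Rightarrow> nat \<Rightarrow> nat set \<Rightarrow> (nat \<Rightarrow> real) \<Rightarrow> (nat \<Rightarrow> complex) \<Rightarrow> (nat \<Rightarrow> complex) \<times> nat"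

definition cheb_cost_bound :: "cheb_map \<Rightarrow> bool" where
  "cheb_cost_bound F \<longleftrightarrow>
     (\<exists>C. \<forall>\<delta> a b q I w v. a < b \<and> finite I \<and> w ` I \<subseteq> {a..b} \<and> 2 \<le> q \<and> 0 < \<delta> \<and> \<delta> \<le> 1/2 \<longrightarrow>
        real (snd (F \<delta> a b q I w v)) \<le> C * (real q * ln (real q) + real (card I) * \<bar>ln \<delta>\<bar>))"

definition is_cheb_interp :: "cheb_map \<Rightarrow> bool" where
  "is_cheb_interp F \<longleftrightarrow>
     (\<forall>\<delta> a b q I w v. a < b \<and> finite I \<and> w ` I \<subseteq> {a..b} \<and> 1 \<le> q \<and> 0 < \<delta> \<and> \<delta> \<le> 1 \<longrightarrow>
        (\<forall>i\<in>I. cmod (fst (F \<delta> a b q I w v) i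
                      - (\<Sum>k<q. v k * of_real (lagrange_u a b q k (w i))))
               \<le> \<delta> * (\<Sum>k<q. cmod (v k)))) \<and>
     cheb_cost_bound F"

definition is_cheb_adjoint :: "cheb_map \<Rightarrow> bool" where
  "is_cheb_adjoint F \<longleftrightarrow>
     (\<forall>\<delta> a b q I w v. a < b \<and> finite I \<and> w ` I \<subseteq> {a..b} \<and> 1 \<le> q \<and> 0 < \<delta> \<and> \<delta> \<le> 1 \<longrightarrow>
        (\<forall>k<q. cmod (fst (F \<delta> a b q I w v) k
                      - (\<Sum>i\<in>I. v i * of_real (lagrange_u a b q k (w i))))
               \<le> \<delta> * (\<Sum>i\<in>I. cmod (v i)))) \<and>
     cheb_cost_bound F"

subsection \<open>The algorithms\<close>

text \<open>
  Both algorithms return the output vector and the total number of operations: those of the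
  subroutine calls, plus one for each multiplication by a factor \<open>\<i>\<^sup>n/s\<close>, \<open>(-\<i>)\<^sup>n/s\<close> or \<open>c\<^sub>i h\<close>.
\<close>

definition algorithm_I ::
  "(nat, nat \<times> nat, complex) nufft \<Rightarrow> fft \<Rightarrow> cheb_map \<Rightarrow>
   nat \<Rightarrow> (nat \<Rightarrow> complex) \<Rightarrow> nat \<Rightarrow> (nat \<Rightarrow> int \<times> nat) \<Rightarrow> real \<Rightarrow>
   (nat \<Rightarrow> complex) \<Rightarrow> (nat \<Rightarrow> complex) \<times> nat" where
  "algorithm_I nufft fft cheb L x m md \<epsilon> f =
    (let p = L^2; h = pixel_size L; s = num_angles p \<epsilon>; q = num_radii p \<epsilon>;
         N = max_order m md; t0 = mode_root md 0; t1 = mode_root md (m - 1);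
         eps_nuf = inverse (2 * sqrt 2 * (2 + pi / 2 * ln (real q))) * (\<epsilon> / 4);
         eps_fst = inverse (4 * sqrt 2 * real q) * (\<epsilon> / 4);
         step1 = nufft eps_nuf {..<p} x ({..<q} \<times> {..<s}) (freq_node t0 t1 q s) f;
         a = fst step1;
         step2 = (\<lambda>k. fft s (\<lambda>l. a (k, l)));
         \<beta> = (\<lambda>n k. \<i> powi n / of_nat s * fst (step2 k) (nat (n mod int s)));
         step3 = (\<lambda>n. cheb eps_fst t0 t1 q {i. i < m \<and> fst (md i) = n} (mode_root md) (\<beta> n));
         \<alpha> = (\<lambda>i. of_real (mode_const md i * h) * fst (step3 (fst (md i))) i)
     in (\<alpha>, snd step1
            + (\<Sum>k<q. snd (step2 k)) + q * card {-N..N}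
            + (\<Sum>n\<in>{-N..N}. snd (step3 n)) + m))"

text \<open>
  In step 2 the coefficients of order \<open>n \<in> {-N..N}\<close> are placed at position \<open>n mod s\<close> of the
  input of an FFT of size \<open>s\<close>, since \<open>exp (\<i> n \<phi>\<^sub>l)\<close> depends only on \<open>n mod s\<close>; the sum defining
  \<open>w\<close> has at most one term when \<open>2 N + 1 \<le> s\<close>.
\<close>
definition algorithm_II ::
  "(nat \<times> nat, nat, complex) nufft \<Rightarrow> fft \<Rightarrow> cheb_map \<Rightarrow>
   nat \<Rightarrow> (nat \<Rightarrow> complex) \<Rightarrow> nat \<Rightarrow> (nat \<Rightarrow> int \<times> nat) \<Rightarrow> real \<Rightarrow>
   (nat \<Rightarrow> complex) \<Rightarrow> (nat \<Rightarrow> complex) \<times> nat" where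
  "algorithm_II nufft fft cheb_adj L x m md \<epsilon> \<alpha> =
    (let p = L^2; h = pixel_size L; s = num_angles p \<epsilon>; q = num_radii p \<epsilon>;
         N = max_order m md; t0 = mode_root md 0; t1 = mode_root md (m - 1);
         eps_nuf = inverse (2 * sqrt 2 * (3 + pi / 2 * ln (real q))) * (\<epsilon> / 4);
         eps_fst = inverse (2 * sqrt 2 * real q) * (\<epsilon> / 4);
         step1 = (\<lambda>n. cheb_adj eps_fst t0 t1 q {i. i < m \<and> fst (md i) = n} (mode_root md)
                        (\<lambda>i. of_real (mode_const md i * h) * \<alpha> i));
         \<beta> = (\<lambda>n k. fst (step1 n) k);
         w = (\<lambda>k r. \<Sum>n | n \<in> {-N..N} \<and> nat (n mod int s) = r. (- \<i>) powi n / of_nat s * \<beta> n k);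
         step2 = (\<lambda>k. fft s (w k));
         a = (\<lambda>(k, l). fst (step2 k) l);
         step3 = nufft eps_nuf ({..<q} \<times> {..<s}) (freq_node t0 t1 q s) {..<p} x a;
         f = (\<lambda>j. if cmod (x j) \<ge> 1 then 0 else fst step3 j)
     in (f, m + (\<Sum>n\<in>{-N..N}. snd (step1 n))
            + q * card {-N..N} + (\<Sum>k<q. snd (step2 k))
            + snd step3))"

text \<open>
  The data on which the transforms depend: an image grid and a bandlimit, with enumerations of
  the pixels and of the modes in the band, of which at least two have different roots.
\<close>
definition disk_setup ::
  "nat \<Rightarrow> (nat \<Rightarrow> complex) \<Rightarrow> real \<Rightarrow> nat \<Rightarrow> (nat \<Rightarrow> int \<times> nat) \<Rightarrow> bool" where
  "disk_setup L x lam m md \<longleftrightarrow>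
     L > 0 \<and> pixel_enumeration L x \<and>
     lam > 0 \<and> m = card (band lam) \<and> mode_enumeration lam md \<and>
     mode_root md 0 < mode_root md (m - 1)"

end

theory Submission
  imports Defs
begin

text \<open>
  Both algorithms replace the kernel \<open>J\<^sub>n(\<mu> |x|) e\<^bsup>-in\<theta>\<^esup>\<close> of a mode of order \<open>n\<close> and
  root \<open>\<mu>\<close> (or its conjugate) by a finite combination of plane waves, and evaluate that combination with subroutines
  of known accuracy. So there are two things to bound: the kernel error, and the amplification of the
  subroutine errors.

  The kernel error has two sources. First, \<open>J\<^sub>n(z) e\<^bsup>-in\<theta>\<^esup>\<close> is \<open>i\<^sup>n\<close> times the \<open>n\<close>-th Fourier
  coefficient in \<open>\<phi>\<close> of the plane wave \<open>exp (- i z cos (\<theta> - \<phi>))\<close>, and \<open>s\<close> equispaced angles compute it up to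
  the Fourier modes congruent to \<open>n\<close> modulo \<open>s\<close>. These are exponentially small because \<open>s\<close> is at least
  four times the bandlimit while \<open>|n|\<close> is at most the bandlimit (\<open>angular_quadrature_error\<close>). Second,
  each plane wave is interpolated in the radial frequency \<open>t\<close> at \<open>q\<close> Chebyshev nodes. As its
  derivatives in \<open>t\<close> are bounded by 1, the error is at most \<open>2 ((b - a)/4)\<^sup>q / q!\<close>
  (\<open>cheb_interp_exp_error\<close>). The interpolation error is taken at each angle separately, so that the quadrature
  error enters only at the exact frequency \<open>\<mu>\<close> and the Lebesgue constant stays out of the kernel error. Together both errors are at most \<open>3 \<epsilon> / 40\<close>, since
  \<open>\<epsilon> \<ge> exp (- L)\<close> (\<open>disk_kernel_error\<close>).

  The subroutine errors are multiplied by \<open>c\<^sub>i h\<close> and by the Lebesgue constant of Chebyshev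
  interpolation. The latter is at most \<open>2 \<pi> + 2 (1 + ln q)\<close> (\<open>lebesgue_constant\<close>). For the former,
  \<open>c\<^sub>i h \<le> 2\<close> follows from \<open>\<mu> |J\<^bsub>n+1\<^esub>(\<mu>)| \<ge> 1\<close> at every positive zero \<open>\<mu>\<close> of \<open>J\<^sub>n\<close>
  (\<open>bessel_Suc_at_root\<close>).

  The facts about Bessel functions are elementary consequences of Rolle's theorem and of the
  monotonicity of the energy \<open>(x J\<^sub>n')\<^sup>2 + (x\<^sup>2 - n\<^sup>2) J\<^sub>n\<^sup>2\<close>: every positive zero of \<open>J\<^sub>n\<close>
  exceeds \<open>n\<close> and is at least 2, the energy at a zero is at least 1, and \<open>J\<^sub>n\<close> has at most \<open>2 b + 1\<close>
  zeros in \<open>(0, b]\<close>. The last bound, with \<open>|n|\<close> at most the bandlimit, shows that the band has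
  \<open>O(p)\<close> modes and \<open>O(\<surd>p)\<close> orders. Since also \<open>q, s = O(\<surd>p)\<close>, the cost estimate is a summation of
  the costs of the subroutines.
\<close>

section \<open>Counting zeros by interlacing\<close>

text \<open>
  The combinatorial content of Rolle's theorem: if a zero of \<open>Q\<close> lies between any two zeros of \<open>P\<close>,
  then \<open>k + 1\<close> zeros of \<open>P\<close> force \<open>k\<close> zeros of \<open>Q\<close>. It is used with consecutive Bessel functions to
  count zeros, and with a function and its derivative to iterate Rolle's theorem.
\<close>
lemma interlacing_finite_set:
  fixes Z :: "'a::linorder set"
  assumes "\<And>x y. P x \<Longrightarrow> P y \<Longrightarrow> x < y \<Longrightarrow> \<exists>z. x < z \<and> z < y \<and> Q z"
    and "finite Z" "card Z = Suc k" "\<forall>z\<in>Z. P z"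
  shows "\<exists>Z'. finite Z' \<and> card Z' = k \<and> (\<forall>z\<in>Z'. Q z \<and> Min Z < z \<and> z < Max Z)"
  using assms(2-)
proof (induction k arbitrary: Z)
  case 0
  then show ?case by (intro exI[of _ "{}"]) auto
next
  case (Suc k)
  have ne: "Z \<noteq> {}" using Suc.prems by auto
  define M where "M = Max Z"
  define Y where "Y = Z - {M}"
  have M: "M \<in> Z" using Suc.prems ne by (simp add: M_def)
  have Y: "finite Y" "card Y = Suc k" "\<forall>z\<in>Y. P z"
    using Suc.prems M by (auto simp: Y_def)
  then have Yne: "Y \<noteq> {}" by auto
  from Suc.IH[OF Y] obtain W where W: "finite W" "card W = k" "\<forall>z\<in>W. Q z \<and> Min Y < z \<and> z < Max Y" by blast
  have MY: "Max Y \<in> Y" using Y Yne by simp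
  then have "Max Y < M" using Suc.prems unfolding M_def Y_def by (metis DiffE M_def Max_ge insertI1 order_neq_le_trans)
  moreover have "P M" "P (Max Y)" using Suc.prems M MY Y by auto
  ultimately obtain c where c: "Max Y < c" "c < M" "Q c" using assms(1) by blast
  have "Min Z \<le> Min Y" using Suc.prems Yne by (intro Min_antimono) (auto simp: Y_def)
  moreover have "Min Y \<le> Max Y" using Y MY by simp
  ultimately have "\<forall>z\<in>insert c W. Q z \<and> Min Z < z \<and> z < Max Z"
    using W c by (auto simp flip: M_def)
  moreover have "card (insert c W) = Suc k" using W c by (subst card_insert_disjoint) auto
  ultimately show ?case using W(1) by blast
qed

section \<open>Bessel functions and their energy\<close>

abbreviation bessel_coeff :: "nat \<Rightarrow> nat \<Rightarrow> real" where
  "bessel_coeff n j \<equiv> (-1) ^ j / (fact j * fact (j + n))"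

text \<open>
  The factorisation \<open>J\<^sub>n(x) = (x/2)\<^sup>n g\<^sub>n(x\<^sup>2/4)\<close> separates the entire functions \<open>g\<^sub>n\<close> from the power. For them,
  differentiation is a shift of the index and the three-term recurrence has polynomial coefficients.
\<close>
definition bessel_series :: "nat \<Rightarrow> real \<Rightarrow> real" where
  "bessel_series n y = (\<Sum>j. bessel_coeff n j * y ^ j)"

text \<open>
  \<open>J\<^sub>n\<close> for \<open>n \<ge> 0\<close>. Negative orders differ only by a sign, see \<open>bessel_J_eq\<close>.
\<close>
definition bessel :: "nat \<Rightarrow> real \<Rightarrow> real" where
  "bessel n x = (x / 2) ^ n * bessel_series n (x\<^sup>2 / 4)"

lemma summable_bessel_series: "summable (\<lambda>j. bessel_coeff n j * (y::real) ^ j)"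
proof (rule summable_comparison_test')
  show "summable (\<lambda>j. inverse (fact j) * \<bar>y\<bar> ^ j)" by (rule summable_exp)
next
  fix j :: nat
  have "1 \<le> (fact (j + n) :: real)" by (rule fact_ge_1)
  then have "fact j * 1 \<le> (fact j * fact (j + n) :: real)" by (intro mult_left_mono) auto
  then have "inverse (fact j * fact (j + n)) \<le> (inverse (fact j) :: real)" by (intro le_imp_inverse_le) auto
  then show "norm (bessel_coeff n j * y ^ j) \<le> inverse (fact j) * \<bar>y\<bar> ^ j"
    by (simp add: abs_mult power_abs divide_inverse mult_right_mono)
qed

lemma bessel_series_sums: "(\<lambda>j. bessel_coeff n j * y ^ j) sums bessel_series n y"
  unfolding bessel_series_def by (rule summable_sums[OF summable_bessel_series])

lemma bessel_J_eq: "bessel_J n x = (if n < 0 then (-1) ^ nat \<bar>n\<bar> else 1) * bessel (nat \<bar>n\<bar>) x"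
proof -
  have "(\<Sum>j. bessel_coeff k j * (x / 2) ^ (2 * j + k)) = bessel k x" for k
  proof -
    have "(\<lambda>j. (x/2)^k * (bessel_coeff k j * (x\<^sup>2/4) ^ j)) sums bessel k x"
      unfolding bessel_def by (intro sums_mult bessel_series_sums)
    moreover have "(x/2)^k * (bessel_coeff k j * (x\<^sup>2/4) ^ j) =
        bessel_coeff k j * (x / 2) ^ (2 * j + k)" for j
    proof -
      have "x\<^sup>2/4 = (x/2)^2" by (simp add: power_divide)
      then show ?thesis by (simp add: power_add power_mult)
    qed
    ultimately show ?thesis by (simp only: sums_iff)
  qed
  then show ?thesis unfolding bessel_J_def by simp
qed

lemma DERIV_bessel_series: "(bessel_series n has_real_derivative - bessel_series (Suc n) y) (at y)"
proof -
  let ?c = "\<lambda>j. bessel_coeff n j :: real"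
  have "((\<lambda>y. \<Sum>j. ?c j * y ^ j) has_real_derivative (\<Sum>j. diffs ?c j * y ^ j)) (at y)"
    by (rule termdiffs_strong_converges_everywhere) (rule summable_bessel_series)
  moreover have "(\<Sum>j. diffs ?c j * y ^ j) = (\<Sum>j. - (bessel_coeff (Suc n) j * y ^ j))"
    by (rule suminf_cong) (simp add: diffs_def divide_simps del: of_nat_Suc)
  also have "\<dots> = - bessel_series (Suc n) y"
    unfolding bessel_series_def by (rule suminf_minus[OF summable_bessel_series])
  ultimately show ?thesis unfolding bessel_series_def[abs_def] by simp
qed

lemma bessel_series_rec:
  "bessel_series n y = real (Suc n) * bessel_series (Suc n) y - y * bessel_series (Suc (Suc n)) y"
proof -
  let ?e = "\<lambda>j. - real j * bessel_coeff (Suc n) j * y ^ j"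
  have "(\<lambda>j. y * (bessel_coeff (Suc (Suc n)) j * y ^ j)) sums (y * bessel_series (Suc (Suc n)) y)"
    by (intro sums_mult bessel_series_sums)
  moreover have "y * (bessel_coeff (Suc (Suc n)) j * y ^ j) = ?e (Suc j)" for j
    by (simp add: divide_simps del: of_nat_Suc)
  ultimately have "(\<lambda>j. ?e (Suc j)) sums (y * bessel_series (Suc (Suc n)) y)" by simp
  then have e: "?e sums (y * bessel_series (Suc (Suc n)) y)"
    by (subst (asm) sums_Suc_iff) simp
  have "(\<lambda>j. real (Suc n) * (bessel_coeff (Suc n) j * y ^ j) - ?e j) sums
      (real (Suc n) * bessel_series (Suc n) y - y * bessel_series (Suc (Suc n)) y)"
    by (intro sums_diff sums_mult bessel_series_sums e)
  moreover have "real (Suc n) * (bessel_coeff (Suc n) j * y ^ j) - ?e j =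
      bessel_coeff n j * y ^ j" for j
  proof -
    have "fact (j + Suc n) = (real j + real n + 1) * (fact (j + n) :: real)"
      by (simp add: algebra_simps)
    moreover have "real j + real n + 1 \<noteq> 0" by linarith
    ultimately show ?thesis by (simp add: divide_simps) (simp add: algebra_simps)
  qed
  ultimately show ?thesis using sums_unique2[OF bessel_series_sums] by simp
qed

lemma isCont_bessel_series [continuous_intros]: "isCont (bessel_series n) y"
  by (rule DERIV_isCont[OF DERIV_bessel_series])

lemma continuous_on_bessel [continuous_intros]: "continuous_on A (bessel n)"
proof -
  have "continuous_on UNIV (bessel_series n)" by (simp add: continuous_at_imp_continuous_on isCont_bessel_series)
  then have "continuous_on A (\<lambda>x. bessel_series n (x\<^sup>2/4))"
    by (rule continuous_on_compose2) (auto intro!: continuous_intros)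
  then show ?thesis unfolding bessel_def[abs_def] by (intro continuous_intros) auto
qed

lemma DERIV_bessel:
  assumes "x \<noteq> 0"
  shows "(bessel n has_real_derivative real n / x * bessel n x - bessel (Suc n) x) (at x)"
proof -
  have "((\<lambda>x. bessel_series n (x\<^sup>2/4)) has_real_derivative - bessel_series (Suc n) (x\<^sup>2/4) * (2 * x / 4)) (at x)"
    by (rule DERIV_chain2[OF DERIV_bessel_series]) (auto intro!: derivative_eq_intros)
  then have "((\<lambda>x. (x/2)^n * bessel_series n (x\<^sup>2/4)) has_real_derivative
     (real n * (x/2)^(n - 1) * (1/2)) * bessel_series n (x\<^sup>2/4) + - bessel_series (Suc n) (x\<^sup>2/4) * (2 * x / 4) * (x/2)^n) (at x)"
    by (intro DERIV_mult) (auto intro!: derivative_eq_intros)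
  moreover have "real n * (x/2)^(n - 1) * (1/2) = real n / x * (x/2)^n"
    using assms by (cases n) auto
  ultimately have "((\<lambda>x. (x/2)^n * bessel_series n (x\<^sup>2/4)) has_real_derivative
     (real n / x * (x/2)^n) * bessel_series n (x\<^sup>2/4) + - bessel_series (Suc n) (x\<^sup>2/4) * (2 * x / 4) * (x/2)^n) (at x)"
    by (simp only:)
  then show ?thesis unfolding bessel_def[abs_def] by (rule DERIV_cong) (simp add: mult_ac)
qed

lemma bessel_rec:
  assumes "x \<noteq> 0"
  shows "bessel (Suc (Suc n)) x = 2 * real (Suc n) / x * bessel (Suc n) x - bessel n x"
  using assms unfolding bessel_def bessel_series_rec[of n]
  by (simp add: field_simps power2_eq_square)

lemma DERIV_bessel_Suc:
  assumes "x \<noteq> 0"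
  shows "(bessel (Suc n) has_real_derivative bessel n x - real (Suc n) / x * bessel (Suc n) x) (at x)"
  by (rule DERIV_cong[OF DERIV_bessel[OF assms]]) (use assms in \<open>simp add: bessel_rec field_simps\<close>)

lemma DERIV_power_bessel_Suc:
  assumes "x \<noteq> 0"
  shows "((\<lambda>x. x ^ Suc n * bessel (Suc n) x) has_real_derivative x ^ Suc n * bessel n x) (at x)"
proof -
  have "((\<lambda>x. x ^ Suc n * bessel (Suc n) x) has_real_derivative
     (real (Suc n) * x ^ n) * bessel (Suc n) x + (bessel n x - real (Suc n) / x * bessel (Suc n) x) * x ^ Suc n) (at x)"
    by (intro DERIV_mult DERIV_bessel_Suc assms) (rule DERIV_cong[OF DERIV_pow], simp)
  then show ?thesis by (rule DERIV_cong) (use assms in \<open>simp add: field_simps\<close>)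
qed

text \<open>
  Rolle's theorem for \<open>x\<^bsup>n+1\<^esup> J\<^bsub>n+1\<^esub>\<close>, whose derivative is \<open>x\<^bsup>n+1\<^esup> J\<^sub>n\<close>. Because of the power in front, the
  origin counts as a zero of every order, so already the first positive zero of \<open>J\<^bsub>n+1\<^esub>\<close> has a zero of
  \<open>J\<^sub>n\<close> below it.
\<close>
lemma bessel_interlace:
  assumes "0 \<le> a" "a < b" "a = 0 \<or> bessel (Suc n) a = 0" "bessel (Suc n) b = 0"
  obtains c where "a < c" "c < b" "bessel n c = 0"
proof -
  let ?f = "\<lambda>x. x ^ Suc n * bessel (Suc n) x"
  have "\<exists>z. a < z \<and> z < b \<and> z ^ Suc n * bessel n z = 0"
  proof -
    have "\<exists>z>a. z < b \<and> (\<lambda>v. v * (z ^ Suc n * bessel n z)) = (\<lambda>v. 0)"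
    proof (rule Rolle_deriv[where f="?f"])
      show "continuous_on {a..b} ?f" by (intro continuous_intros)
      fix x assume "a < x" "x < b"
      then have "x \<noteq> 0" using assms by auto
      from DERIV_power_bessel_Suc[OF this, of n] 
      show "(?f has_derivative (\<lambda>v. v * (x ^ Suc n * bessel n x))) (at x)" 
        by (simp add: has_field_derivative_def mult.commute[of _ "x ^ Suc n * bessel n x"] del: power_Suc)
    qed (use assms in auto)
    then obtain z where z: "a < z" "z < b" "(\<lambda>v. v * (z ^ Suc n * bessel n z)) = (\<lambda>v. 0)" by auto
    from fun_cong[OF z(3), of 1] have "z ^ Suc n * bessel n z = 0" by simp
    with z show ?thesis by blast
  qed
  then obtain z where z: "a < z" "z < b" "z ^ Suc n * bessel n z = 0" by blast
  with assms have "bessel n z = 0" by auto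
  with z that show thesis by blast
qed

text \<open>
  This is \<open>(x J\<^sub>n')\<^sup>2 + (x\<^sup>2 - n\<^sup>2) J\<^sub>n\<^sup>2\<close> (see \<open>bessel_energy_alt\<close>), with the derivative eliminated so that the
  energies of two consecutive orders can be compared.
\<close>
definition bessel_energy :: "nat \<Rightarrow> real \<Rightarrow> real" where
  "bessel_energy n x = x\<^sup>2 * ((bessel n x)\<^sup>2 + (bessel (Suc n) x)\<^sup>2) - 2 * real n * x * bessel n x * bessel (Suc n) x"

lemma DERIV_bessel_energy:
  assumes "x \<noteq> 0"
  shows "(bessel_energy n has_real_derivative 2 * x * (bessel n x)\<^sup>2) (at x)"
proof -
  let ?J = "bessel n x" and ?K = "bessel (Suc n) x"
  define J' where "J' = real n / x * ?J - ?K"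
  define K' where "K' = ?J - real (Suc n) / x * ?K"
  have J: "(bessel n has_real_derivative J') (at x)" and K: "(bessel (Suc n) has_real_derivative K') (at x)"
    unfolding J'_def K'_def by (rule DERIV_bessel[OF assms] DERIV_bessel_Suc[OF assms])+
  have "(bessel_energy n has_real_derivative
     2 * x * (?J\<^sup>2 + ?K\<^sup>2) + (2 * ?J * J' + 2 * ?K * K') * x\<^sup>2
     - (2 * real n * ?J * ?K + 2 * real n * x * J' * ?K + 2 * real n * x * ?J * K')) (at x)"
    unfolding bessel_energy_def[abs_def]
    by (auto intro!: derivative_eq_intros J K simp: algebra_simps)
  moreover have "x * J' = real n * ?J - x * ?K" "x * K' = x * ?J - real (Suc n) * ?K"
    using assms by (simp_all add: J'_def K'_def field_simps)
  then have "2 * x * (?J\<^sup>2 + ?K\<^sup>2) + (2 * ?J * J' + 2 * ?K * K') * x\<^sup>2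
     - (2 * real n * ?J * ?K + 2 * real n * x * J' * ?K + 2 * real n * x * ?J * K') = 2 * x * ?J\<^sup>2"
    unfolding of_nat_Suc by algebra
  ultimately show ?thesis by simp
qed

lemma bessel_energy_alt:
  assumes "x \<noteq> 0"
  shows "bessel_energy n x = x\<^sup>2 * (real n / x * bessel n x - bessel (Suc n) x)\<^sup>2 + (x\<^sup>2 - real n ^ 2) * (bessel n x)\<^sup>2"
  unfolding bessel_energy_def using assms by (simp add: field_simps power2_eq_square)

lemma bessel_energy_mono:
  assumes "0 \<le> a" "a \<le> b"
  shows "bessel_energy n a \<le> bessel_energy n b"
proof (rule DERIV_nonneg_imp_increasing_open[OF assms(2)])
  fix x assume "a < x" "x < b"
  then show "\<exists>y. (bessel_energy n has_real_derivative y) (at x) \<and> 0 \<le> y"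
    using assms by (intro exI[of _ "2 * x * (bessel n x)\<^sup>2"] conjI DERIV_bessel_energy) auto
qed (unfold bessel_energy_def[abs_def], intro continuous_intros)

text \<open>
  At a zero of \<open>J\<^sub>n\<close> the energies of the orders \<open>n\<close> and \<open>n + 1\<close> coincide. This carries lower bounds for
  the energy from one order to the next.
\<close>
lemma bessel_energy_root:
  assumes "x \<noteq> 0" "bessel n x = 0"
  shows "bessel_energy n x = x\<^sup>2 * (bessel (Suc n) x)\<^sup>2" "bessel_energy (Suc n) x = x\<^sup>2 * (bessel (Suc n) x)\<^sup>2"
  using assms unfolding bessel_energy_def bessel_rec[OF assms(1)] by (simp_all add: field_simps power2_eq_square)

text \<open>
  The energy vanishes at 0, and near 0 it increases strictly because \<open>J\<^sub>n\<close> has no zeros there.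
\<close>
lemma bessel_energy_pos:
  assumes "x > 0"
  shows "bessel_energy n x > 0"
proof -
  have "bessel_series n 0 = 1 / fact n"
    using powser_zero[of "\<lambda>j. bessel_coeff n j :: real"] unfolding bessel_series_def by simp
  then have "bessel_series n 0 > 0" by simp
  moreover have "isCont (\<lambda>x. bessel_series n (x\<^sup>2/4)) 0"
    by (rule isCont_o2[where f="\<lambda>x. x\<^sup>2/4" and a=0]) (auto intro!: continuous_intros)
  ultimately have "\<forall>\<^sub>F x in at 0. bessel_series n (x\<^sup>2/4) > 0"
    unfolding isCont_def by (intro order_tendstoD) auto
  then obtain d where d: "d > (0::real)" "\<And>x. x \<noteq> 0 \<Longrightarrow> \<bar>x\<bar> < d \<Longrightarrow> bessel_series n (x\<^sup>2/4) > 0"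
    unfolding eventually_at by (auto simp: dist_real_def)
  \<comment> \<open>a point below \<open>x\<close> up to which \<open>J\<^sub>n\<close> has no zeros\<close>
  define b where "b = min (x/2) (d/2)"
  have b: "0 < b" "b < d" "b < x" using assms d by (auto simp: b_def)
  have "bessel_energy n 0 < bessel_energy n b"
  proof (rule DERIV_pos_imp_increasing_open[OF b(1)])
    fix y assume y: "0 < y" "y < b"
    then have "bessel n y > 0" unfolding bessel_def using d(2)[of y] b by simp
    then have "2 * y * (bessel n y)\<^sup>2 > 0" using y by simp
    then show "\<exists>z. (bessel_energy n has_real_derivative z) (at y) \<and> 0 < z"
      using y DERIV_bessel_energy[of y n] by (intro exI[of _ "2 * y * (bessel n y)\<^sup>2"] conjI) auto
  qed (unfold bessel_energy_def[abs_def], intro continuous_intros)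
  moreover have "bessel_energy n 0 = 0" by (simp add: bessel_energy_def)
  ultimately show ?thesis using bessel_energy_mono[of b x n] b by simp
qed

text \<open>
  If \<open>J\<^sub>n\<close> had a zero in \<open>(0, n]\<close>, then Rolle's theorem would give a critical point \<open>z < n\<close>, where the energy
  is \<open>(z\<^sup>2 - n\<^sup>2) J\<^sub>n(z)\<^sup>2 \<le> 0\<close>.
\<close>
lemma bessel_root_gt_order:
  assumes "0 < \<mu>" "bessel n \<mu> = 0"
  shows "real n < \<mu>"
proof (cases n)
  case (Suc k)
  show ?thesis
  proof (rule ccontr)
    assume *: "\<not> real n < \<mu>"
    have "\<exists>z>0. z < \<mu> \<and> (\<lambda>v. (real n / z * bessel n z - bessel (Suc n) z) * v) = (\<lambda>v. 0)"
    proof (rule Rolle_deriv[where f="bessel n"])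
      have "bessel n 0 = 0" using Suc by (simp add: bessel_def)
      then show "bessel n 0 = bessel n \<mu>" using assms by simp
      fix x :: real assume "0 < x"
      then show "(bessel n has_derivative (\<lambda>v. (real n / x * bessel n x - bessel (Suc n) x) * v)) (at x)"
        using DERIV_bessel[of x n] by (simp add: has_field_derivative_def)
    qed (use assms continuous_on_bessel in auto)
    then obtain z where z: "0 < z" "z < \<mu>" "(\<lambda>v. (real n / z * bessel n z - bessel (Suc n) z) * v) = (\<lambda>v. 0)" by auto
    from fun_cong[OF z(3), of 1] have "real n / z * bessel n z - bessel (Suc n) z = 0" by simp
    then have "bessel_energy n z = (z\<^sup>2 - real n ^ 2) * (bessel n z)\<^sup>2"
      using z bessel_energy_alt[of z n] by simp
    also have "\<dots> \<le> 0" using * z by (intro mult_nonpos_nonneg) (auto intro!: power_mono)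
    finally show False using bessel_energy_pos[OF z(1), of n] by simp
  qed
qed (use assms in simp)

text \<open>
  For \<open>0 \<le> y \<le> 1\<close> the series alternates with decreasing terms, so it lies above its even partial sums.
\<close>
lemma bessel_series_lower:
  assumes "0 \<le> y" "y \<le> 1"
  shows "bessel_series n y \<ge> (\<Sum>j<2*k. (-1) ^ j * (y ^ j / (fact j * fact (j + n))))"
proof -
  let ?a = "\<lambda>j. y ^ j / (fact j * fact (j + n))"
  have dec: "?a (Suc j) \<le> ?a j" for j
  proof (rule frac_le)
    show "y ^ Suc j \<le> y ^ j" using assms by (intro power_decreasing) auto
    show "fact j * fact (j + n) \<le> (fact (Suc j) * fact (Suc j + n) :: real)"
      by (intro mult_mono fact_mono) auto
  qed (use assms in auto)
  have "bessel_coeff n j * (- y) ^ j = ?a j" for j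
    unfolding power_minus[of y] by (simp flip: mult.assoc power_mult_distrib)
  then have "?a \<longlonglongrightarrow> 0"
    using summable_LIMSEQ_zero[OF summable_bessel_series[of n "- y"]] by simp
  then have "(\<Sum>j<2*k. (-1) ^ j * ?a j) \<le> (\<Sum>j. (-1) ^ j * ?a j)"
    by (rule summable_Leibniz'(2)) (use dec assms in auto)
  also have "\<dots> = bessel_series n y" unfolding bessel_series_def by (intro suminf_cong) simp
  finally show ?thesis .
qed

text \<open>
  For order 0 the first two terms of the series give \<open>J\<^sub>0(x) \<ge> 1 - x\<^sup>2/4 > 0\<close> on \<open>(0, 2)\<close>; interlacing
  does the rest.
\<close>
lemma bessel_root_ge_2:
  assumes "0 < \<mu>" "bessel n \<mu> = 0"
  shows "2 \<le> \<mu>"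
  using assms
proof (induction n arbitrary: \<mu>)
  case 0
  show ?case
  proof (rule ccontr)
    assume "\<not> 2 \<le> \<mu>"
    then have "\<mu>\<^sup>2 < 2\<^sup>2" using 0 by (intro power_strict_mono) auto
    then have *: "\<mu>\<^sup>2/4 < 1" by simp
    then have "bessel_series 0 (\<mu>\<^sup>2/4) \<ge> 1 - \<mu>\<^sup>2/4"
      using bessel_series_lower[of "\<mu>\<^sup>2/4" 0 1] by (simp add: eval_nat_numeral)
    then show False using * 0 by (simp add: bessel_def)
  qed
next
  case (Suc n)
  then obtain c where "0 < c" "c < \<mu>" "bessel n c = 0" using bessel_interlace[of 0 \<mu> n] by auto
  with Suc.IH[of c] show ?case by simp
qed

text \<open>
  A zero \<open>\<mu>\<close> of \<open>J\<^bsub>n+1\<^esub>\<close> has a zero \<open>c\<close> of \<open>J\<^sub>n\<close> below it. The energy of order \<open>n + 1\<close> grows from \<open>c\<close> to \<open>\<mu>\<close>, and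
  at \<open>c\<close> it equals the energy of order \<open>n\<close>, so the claim follows by induction. For order 0 it starts from
  the energy \<open>4 (J\<^sub>0(2)\<^sup>2 + J\<^sub>1(2)\<^sup>2)\<close> at 2, where \<open>J\<^sub>1(2) \<ge> 1/2\<close>.
\<close>
lemma bessel_energy_root_ge_1:
  assumes "0 < \<mu>" "bessel n \<mu> = 0"
  shows "1 \<le> bessel_energy n \<mu>"
  using assms
proof (induction n arbitrary: \<mu>)
  case 0
  have "(\<Sum>j<2*1. (-1) ^ j * (1 ^ j / (fact j * fact (j + 1)))) = (1/2 :: real)"
    unfolding mult_1_right numeral_2_eq_2 lessThan_Suc by (simp add: fact_numeral)
  then have "bessel_series 1 1 \<ge> 1/2"
    using bessel_series_lower[of 1 1 1] by (simp only: zero_le_one order_refl simp_thms)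
  then have "bessel 1 2 \<ge> 1/2" by (simp add: bessel_def)
  then have "(bessel 1 2)\<^sup>2 \<ge> (1/2)\<^sup>2" by (intro power_mono) auto
  then have "1 \<le> 4 * (bessel 1 2)\<^sup>2" by (simp add: power2_eq_square)
  also have "\<dots> \<le> bessel_energy 0 2" by (simp add: bessel_energy_def)
  finally have "1 \<le> bessel_energy 0 2" .
  also have "\<dots> \<le> bessel_energy 0 \<mu>" using bessel_root_ge_2[OF 0] by (intro bessel_energy_mono) auto
  finally show ?case .
next
  case (Suc n)
  then obtain c where c: "0 < c" "c < \<mu>" "bessel n c = 0" using bessel_interlace[of 0 \<mu> n] by auto
  have "1 \<le> bessel_energy n c" using Suc.IH c by simp
  also have "\<dots> = bessel_energy (Suc n) c" using c bessel_energy_root[of c n] by simp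
  also have "\<dots> \<le> bessel_energy (Suc n) \<mu>" using c by (intro bessel_energy_mono) auto
  finally show ?case .
qed

lemma bessel_Suc_at_root:
  assumes "0 < \<mu>" "bessel n \<mu> = 0"
  shows "1 / \<mu> \<le> \<bar>bessel (Suc n) \<mu>\<bar>"
proof -
  have "1\<^sup>2 \<le> (\<mu> * \<bar>bessel (Suc n) \<mu>\<bar>)\<^sup>2"
    using bessel_energy_root_ge_1[OF assms] bessel_energy_root(1)[of \<mu> n] assms
    by (simp add: power_mult_distrib)
  then have "1 \<le> \<mu> * \<bar>bessel (Suc n) \<mu>\<bar>" by (rule power2_le_imp_le) (use assms in simp)
  then show ?thesis using assms by (simp add: field_simps)
qed

section \<open>Zeros of Bessel functions\<close>

text \<open>
  Let \<open>c\<close> be a zero of \<open>J\<^sub>0' = - J\<^sub>1\<close> between the zeros \<open>a < b\<close> of \<open>J\<^sub>0\<close>, and let \<open>r\<^sup>2 = J\<^sub>0\<^sup>2 + J\<^sub>1\<^sup>2\<close>. Here \<open>r\<close>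
  decreases, while \<open>x r\<close> increases because its square is the energy of order 0. So on the way from \<open>a\<close> to \<open>c\<close>
  the function \<open>J\<^sub>0\<close>, whose slope is at most \<open>r(a)\<close>, must rise from 0 to \<open>r(c) \<ge> (a/c) r(a)\<close>. Hence
  \<open>c - a \<ge> a/c\<close>, which is impossible for \<open>c - a < 1/2\<close> as \<open>a \<ge> 2\<close>.
\<close>
lemma bessel_0_root_gap:
  assumes "0 < a" "a < b" "bessel 0 a = 0" "bessel 0 b = 0"
  shows "1/2 \<le> b - a"
proof -
  have D: "(bessel 0 has_real_derivative - bessel 1 x) (at x)" if "x > 0" for x
    using DERIV_bessel[of x 0] that by simp
  have "\<exists>c>a. c < b \<and> (*) (- bessel 1 c) = (\<lambda>v. 0)"
  proof (rule Rolle_deriv[where f="bessel 0"])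
    fix x assume "a < x"
    then show "(bessel 0 has_derivative (*) (- bessel 1 x)) (at x)"
      using D[of x] assms unfolding has_field_derivative_def by auto
  qed (use assms continuous_on_bessel in auto)
  then obtain c where c: "a < c" "c < b" "(*) (- bessel 1 c) = (\<lambda>v. 0)" by blast
  from fun_cong[OF c(3), of 1] have c1: "bessel 1 c = 0" by simp
  obtain \<xi> where \<xi>: "a < \<xi>" "\<xi> < c" "bessel 0 c - bessel 0 a = (c - a) * (- bessel 1 \<xi>)"
    using MVT2[of a c "bessel 0" "\<lambda>x. - bessel 1 x"] c assms D by force
  let ?r = "\<lambda>x. (bessel 0 x)\<^sup>2 + (bessel 1 x)\<^sup>2"
  have "?r \<xi> \<le> ?r a"
  proof (rule DERIV_nonpos_imp_nonincreasing[OF less_imp_le[OF \<xi>(1)]])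
    fix x assume "a \<le> x" "x \<le> \<xi>"
    then have x: "x > 0" using assms by simp
    have "(bessel 1 has_real_derivative bessel 0 x - bessel 1 x / x) (at x)"
      using DERIV_bessel_Suc[of x 0] x by simp
    with D[OF x] have "(?r has_real_derivative - 2 * (bessel 1 x)\<^sup>2 / x) (at x)"
      by (auto intro!: derivative_eq_intros simp: field_simps power2_eq_square)
    then show "\<exists>y. (?r has_real_derivative y) (at x) \<and> y \<le> 0"
      using x by (intro exI conjI) auto
  qed
  then have "?r \<xi> \<le> (bessel 1 a)\<^sup>2" using assms(3) by simp
  then have "(bessel 1 \<xi>)\<^sup>2 \<le> (bessel 1 a)\<^sup>2" using zero_le_power2[of "bessel 0 \<xi>"] by linarith
  then have \<xi>a: "\<bar>bessel 1 \<xi>\<bar> \<le> \<bar>bessel 1 a\<bar>" by (simp add: abs_le_square_iff)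
  have "bessel_energy 0 a \<le> bessel_energy 0 c" using c assms by (intro bessel_energy_mono) auto
  then have "(a * bessel 1 a)\<^sup>2 \<le> (c * bessel 0 c)\<^sup>2"
    using c1 assms by (simp add: bessel_energy_def power_mult_distrib)
  then have "\<bar>a * bessel 1 a\<bar> \<le> \<bar>c * bessel 0 c\<bar>" by (simp add: abs_le_square_iff)
  also have "\<dots> = c * ((c - a) * \<bar>bessel 1 \<xi>\<bar>)" using \<xi> c assms by (simp add: abs_mult)
  also have "\<dots> \<le> c * ((c - a) * \<bar>bessel 1 a\<bar>)" using \<xi>a c assms by (intro mult_left_mono) auto
  finally have "a * \<bar>bessel 1 a\<bar> \<le> (c * (c - a)) * \<bar>bessel 1 a\<bar>" using assms by (simp add: abs_mult mult_ac)
  moreover have "\<bar>bessel 1 a\<bar> > 0" 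
    by (rule less_le_trans[of 0 "1 / a"]) (use bessel_Suc_at_root[of a 0] assms in auto)
  ultimately have *: "a \<le> c * (c - a)" by simp
  have a: "2 \<le> a" by (rule bessel_root_ge_2) (use assms in auto)
  show ?thesis
  proof (rule ccontr)
    assume "\<not> ?thesis"
    then have "c - a \<le> 1/2" using c by simp
    then have "c * (c - a) \<le> (a + 1/2) * (1/2)" using a c by (intro mult_mono) auto
    with * a show False by simp
  qed
qed

text \<open>
  By interlacing, \<open>J\<^bsub>n+1\<^esub>\<close> has at most as many zeros in \<open>(0, b]\<close> as \<open>J\<^sub>n\<close>, which reduces the count to order 0.
  There the zeros are at least \<open>1/2\<close> apart, so that \<open>z \<mapsto> \<lfloor>2 z\<rfloor>\<close> is injective on them.
\<close>
lemma card_bessel_roots: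
  assumes "finite Z" "\<forall>z\<in>Z. 0 < z \<and> z \<le> b \<and> bessel n z = 0" "0 \<le> b"
  shows "real (card Z) \<le> 2 * b + 1"
  using assms(1,2)
proof (induction n arbitrary: Z)
  case 0
  have inj: "inj_on (\<lambda>z. nat \<lfloor>2 * z\<rfloor>) Z"
  proof (rule inj_onI, rule ccontr)
    fix y z assume yz: "y \<in> Z" "z \<in> Z" "nat \<lfloor>2 * y\<rfloor> = nat \<lfloor>2 * z\<rfloor>" "y \<noteq> z"
    then have pos: "y > 0" "z > 0" "bessel 0 y = 0" "bessel 0 z = 0" using 0 by auto
    then have "\<lfloor>2 * y\<rfloor> = \<lfloor>2 * z\<rfloor>" using yz by (simp add: eq_nat_nat_iff)
    then have "\<bar>2 * y - 2 * z\<bar> < 1" by linarith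
    moreover have "1/2 \<le> \<bar>y - z\<bar>"
      using bessel_0_root_gap[of y z] bessel_0_root_gap[of z y] pos yz(4) by (cases "y < z") auto
    ultimately show False by linarith
  qed
  have "(\<lambda>z. nat \<lfloor>2 * z\<rfloor>) ` Z \<subseteq> {..nat \<lfloor>2 * b\<rfloor>}"
  proof
    fix k assume "k \<in> (\<lambda>z. nat \<lfloor>2 * z\<rfloor>) ` Z"
    then obtain z where "z \<in> Z" "k = nat \<lfloor>2 * z\<rfloor>" by auto
    moreover have "\<lfloor>2 * z\<rfloor> \<le> \<lfloor>2 * b\<rfloor>" using 0 \<open>z \<in> Z\<close> by (intro floor_mono) auto
    ultimately show "k \<in> {..nat \<lfloor>2 * b\<rfloor>}" by (auto intro: nat_mono)
  qed
  then have "card Z \<le> card {..nat \<lfloor>2 * b\<rfloor>}" using card_inj_on_le[OF inj] by blast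
  then have "card Z \<le> nat \<lfloor>2 * b\<rfloor> + 1" by simp
  then have "real (card Z) \<le> real (nat \<lfloor>2 * b\<rfloor>) + 1" by linarith
  also have "real (nat \<lfloor>2 * b\<rfloor>) \<le> 2 * b" using assms by simp
  finally show ?case by simp
next
  case (Suc n)
  let ?P = "\<lambda>x. x = 0 \<or> (0 < x \<and> bessel (Suc n) x = 0)"
  have "0 \<notin> Z" using Suc.prems by auto
  then have "card (insert 0 Z) = Suc (card Z)" using Suc.prems by simp
  moreover have "\<exists>z. x < z \<and> z < y \<and> bessel n z = 0" if "?P x" "?P y" "x < y" for x y :: real
    using bessel_interlace[of x y n] that by fastforce
  moreover have "finite (insert 0 Z)" "\<forall>z\<in>insert 0 Z. ?P z" using Suc.prems by auto
  ultimately obtain W where W: "finite W" "card W = card Z"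
    "\<forall>z\<in>W. bessel n z = 0 \<and> Min (insert 0 Z) < z \<and> z < Max (insert 0 Z)"
    using interlacing_finite_set[of ?P "\<lambda>z. bessel n z = 0" "insert 0 Z" "card Z"] by blast
  have "Min (insert 0 Z) = 0" using Suc.prems by (intro Min_eqI) (auto intro: less_imp_le)
  moreover have "Max (insert 0 Z) \<le> b" using Suc.prems assms by (subst Max_le_iff) auto
  ultimately have "\<forall>z\<in>W. 0 < z \<and> z \<le> b \<and> bessel n z = 0" using W(3) by fastforce
  from Suc.IH[OF W(1) this] show ?case using W(2) by simp
qed

lemma bessel_J_zero_iff: "bessel_J n z = 0 \<longleftrightarrow> bessel (nat \<bar>n\<bar>) z = 0"
  by (simp add: bessel_J_eq)

definition is_kth_root :: "int \<Rightarrow> nat \<Rightarrow> real \<Rightarrow> bool" where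
  "is_kth_root n k y \<longleftrightarrow>
     0 < y \<and> bessel_J n y = 0 \<and> card {z. 0 < z \<and> z \<le> y \<and> bessel_J n z = 0} = k"

lemma finite_bessel_roots: "finite {z. 0 < z \<and> z \<le> y \<and> bessel_J n z = 0}"
proof (cases "0 \<le> y")
  case True
  show ?thesis
  proof (rule finite_if_finite_subsets_card_bdd[where C="nat \<lfloor>2 * y + 1\<rfloor>", THEN conjunct1])
    fix G assume "G \<subseteq> {z. 0 < z \<and> z \<le> y \<and> bessel_J n z = 0}" "finite G"
    then have "real (card G) \<le> 2 * y + 1"
      using True by (intro card_bessel_roots[where n="nat \<bar>n\<bar>"]) (auto simp: bessel_J_zero_iff)
    then show "card G \<le> nat \<lfloor>2 * y + 1\<rfloor>" by (rule le_nat_floor)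
  qed
next
  case False
  then have "{z. 0 < z \<and> z \<le> y \<and> bessel_J n z = 0} = {}" by auto
  then show ?thesis by (simp only: finite.emptyI)
qed

lemma is_kth_root_unique:
  assumes "is_kth_root n k y" "is_kth_root n k z"
  shows "y = z"
proof -
  have "False" if "is_kth_root n k y" "is_kth_root n k z" "y < z" for y z
  proof -
    let ?S = "\<lambda>y. {w. 0 < w \<and> w \<le> y \<and> bessel_J n w = 0}"
    have "?S y \<subseteq> ?S z"
      by (rule Collect_mono) (use that(3) in simp)
    moreover have "z \<in> ?S z" "z \<notin> ?S y"
      using that(2,3) by (simp_all add: is_kth_root_def)
    ultimately have "?S y \<subset> ?S z" by blast
    from psubset_card_mono[OF finite_bessel_roots this] show False
      using that by (simp add: is_kth_root_def)
  qed
  from this[of y z] this[of z y] assms show ?thesis by (cases y z rule: linorder_cases) auto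
qed

lemma is_kth_root_down:
  assumes "is_kth_root n k' y" "1 \<le> k" "k \<le> k'"
  shows "\<exists>z. is_kth_root n k z"
  using assms(3,1)
proof (induction k' arbitrary: y rule: dec_induct)
  case base
  then show ?case by blast
next
  case (step j)
  let ?S = "\<lambda>y. {w. 0 < w \<and> w \<le> y \<and> bessel_J n w = 0}"
  define T where "T = ?S y - {y}"
  have T: "finite T" "card T = j"
    using step.prems finite_bessel_roots[of y n] by (auto simp: T_def is_kth_root_def)
  then have ne: "T \<noteq> {}" using step.hyps assms(2) by auto
  have M: "Max T \<in> T" using T ne by simp
  have "?S (Max T) = T"
    using M T by (auto simp: T_def is_kth_root_def)
  then have "is_kth_root n j (Max T)" using M T by (auto simp: is_kth_root_def T_def)
  then show ?case by (rule step.IH)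
qed

text \<open>
  If \<open>J\<^sub>n\<close> had fewer than \<open>k\<close> positive zeros, the description that defines \<open>bessel_root n k'\<close> would have no
  solution for any \<open>k' \<ge> k\<close>. All these values would then coincide, and with \<open>(n, k)\<close> the band would contain
  the infinitely many pairs \<open>(n, k')\<close>.
\<close>
lemma bessel_root_band:
  assumes fin: "finite (band lam)" and nk: "(n, k) \<in> band lam"
  shows "is_kth_root n k (bessel_root n k)"
proof -
  have root: "bessel_root n k = (THE y. is_kth_root n k y)" for k
    by (simp add: bessel_root_def is_kth_root_def)
  have k: "1 \<le> k" "bessel_root n k \<le> lam" using nk by (auto simp: band_def)
  have "\<exists>y. is_kth_root n k y"
  proof (rule ccontr)
    assume none: "\<nexists>y. is_kth_root n k y"
    have "(n, k') \<in> band lam" if "k \<le> k'" for k'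
    proof -
      have "\<not> is_kth_root n k' y" for y using none is_kth_root_down[of n k' y k] k that by blast
      with none have "is_kth_root n k' = is_kth_root n k" by (auto simp: fun_eq_iff)
      then have "bessel_root n k' = bessel_root n k" unfolding root by simp
      then show ?thesis using k that by (auto simp: band_def)
    qed
    then have "Pair n ` {k..} \<subseteq> band lam" by auto
    moreover have "infinite (Pair n ` {k..})" by (simp add: finite_image_iff inj_on_def infinite_Ici)
    ultimately show False using fin finite_subset by blast
  qed
  then show ?thesis unfolding root by (metis is_kth_root_unique theI)
qed

lemma bessel_root_bounds:
  assumes "is_kth_root n k \<mu>"
  shows "2 \<le> \<mu>" "real_of_int \<bar>n\<bar> \<le> \<mu>" "real k \<le> 2 * \<mu> + 1" "\<mu> \<noteq> 0 \<and> 1 / \<mu> \<le> \<bar>bessel_J (n + 1) \<mu>\<bar>"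
proof -
  define \<nu> where "\<nu> = nat \<bar>n\<bar>"
  have \<mu>: "0 < \<mu>" "bessel \<nu> \<mu> = 0" and k: "card {z. 0 < z \<and> z \<le> \<mu> \<and> bessel_J n z = 0} = k"
    using assms by (auto simp: is_kth_root_def bessel_J_zero_iff \<nu>_def)
  show "2 \<le> \<mu>" by (rule bessel_root_ge_2[OF \<mu>])
  have "real \<nu> < \<mu>" by (rule bessel_root_gt_order[OF \<mu>])
  moreover have "real \<nu> = real_of_int \<bar>n\<bar>" unfolding \<nu>_def by simp
  ultimately show "real_of_int \<bar>n\<bar> \<le> \<mu>" by simp
  have "real (card {z. 0 < z \<and> z \<le> \<mu> \<and> bessel_J n z = 0}) \<le> 2 * \<mu> + 1"
    by (rule card_bessel_roots[OF finite_bessel_roots, where n=\<nu>])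
      (use \<mu> in \<open>auto simp: bessel_J_zero_iff \<nu>_def\<close>)
  then show "real k \<le> 2 * \<mu> + 1" by (simp add: k)
  have "\<bar>bessel_J (n + 1) \<mu>\<bar> = \<bar>bessel (Suc \<nu>) \<mu>\<bar>"
  proof (cases "n \<ge> 0")
    case True
    then have "nat \<bar>n + 1\<bar> = Suc \<nu>" "\<not> n + 1 < 0" by (auto simp: \<nu>_def)
    then show ?thesis by (simp add: bessel_J_eq)
  next
    case False
    define j where "j = nat (- n - 1)"
    have j: "nat \<bar>n + 1\<bar> = j" "\<nu> = Suc j" using False by (auto simp: \<nu>_def j_def)
    have "\<bar>bessel_J (n + 1) \<mu>\<bar> = \<bar>bessel j \<mu>\<bar>" by (simp add: bessel_J_eq j abs_mult)
    also have "\<dots> = \<bar>bessel (Suc \<nu>) \<mu>\<bar>" using bessel_rec[of \<mu> j] \<mu> j by simp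
    finally show ?thesis .
  qed
  then show "\<mu> \<noteq> 0 \<and> 1 / \<mu> \<le> \<bar>bessel_J (n + 1) \<mu>\<bar>" using bessel_Suc_at_root[OF \<mu>] \<mu> by auto
qed

lemma band_neg: "(n, k) \<in> band lam \<Longrightarrow> (- n, k) \<in> band lam"
  by (simp add: band_def bessel_root_def bessel_J_zero_iff)

lemma card_band_le:
  assumes fin: "finite (band lam)" and "0 \<le> lam"
  shows "real (card (band lam)) \<le> (2 * lam + 1)\<^sup>2"
proof -
  have "band lam \<subseteq> {- \<lfloor>lam\<rfloor>..\<lfloor>lam\<rfloor>} \<times> {1..nat \<lfloor>2 * lam + 1\<rfloor>}"
  proof (clarify)
    fix n k assume nk: "(n, k) \<in> band lam"
    note r = bessel_root_bounds[OF bessel_root_band[OF fin nk]]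
    have k: "1 \<le> k" "bessel_root n k \<le> lam" using nk by (auto simp: band_def)
    have "real_of_int \<bar>n\<bar> \<le> lam" using r k by linarith
    then have "\<bar>n\<bar> \<le> \<lfloor>lam\<rfloor>" by (simp add: le_floor_iff)
    moreover have "real k \<le> 2 * lam + 1" using r k by linarith
    then have "k \<le> nat \<lfloor>2 * lam + 1\<rfloor>" by (rule le_nat_floor)
    ultimately show "n \<in> {- \<lfloor>lam\<rfloor>..\<lfloor>lam\<rfloor>} \<and> k \<in> {1..nat \<lfloor>2 * lam + 1\<rfloor>}" using k by auto
  qed
  then have "card (band lam) \<le> card ({- \<lfloor>lam\<rfloor>..\<lfloor>lam\<rfloor>} \<times> {1..nat \<lfloor>2 * lam + 1\<rfloor>})"
    by (intro card_mono) auto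
  also have "\<dots> = nat (2 * \<lfloor>lam\<rfloor> + 1) * nat \<lfloor>2 * lam + 1\<rfloor>"
    by (simp add: card_cartesian_product)
  finally have "real (card (band lam)) \<le> real (nat (2 * \<lfloor>lam\<rfloor> + 1)) * real (nat \<lfloor>2 * lam + 1\<rfloor>)"
    by (metis of_nat_le_iff of_nat_mult)
  also have "\<dots> \<le> (2 * lam + 1) * (2 * lam + 1)"
  proof (intro mult_mono)
    have "0 \<le> \<lfloor>lam\<rfloor>" using assms by simp
    then have "real (nat (2 * \<lfloor>lam\<rfloor> + 1)) = 2 * real_of_int \<lfloor>lam\<rfloor> + 1" by simp
    also have "\<dots> \<le> 2 * lam + 1" by simp
    finally show "real (nat (2 * \<lfloor>lam\<rfloor> + 1)) \<le> 2 * lam + 1" .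
    have "0 \<le> \<lfloor>2 * lam + 1\<rfloor>" using assms by simp
    then show "real (nat \<lfloor>2 * lam + 1\<rfloor>) \<le> 2 * lam + 1" by simp
  qed (use assms in auto)
  finally show ?thesis by (simp add: power2_eq_square)
qed

text \<open>
  The strict inequality between the first and the last root forces \<open>m > 0\<close>, since for \<open>m = 0\<close> the truncated
  difference \<open>m - 1\<close> is 0 as well. As \<open>m\<close> is the cardinality of the
  band, the band is finite, and \<open>bessel_root_band\<close> applies to all of its modes. The orders in the band are
  symmetric about 0, so their maximum also bounds their absolute values.
\<close>
lemma disk_setup_facts:
  assumes "disk_setup L x lam m md"
  shows disk_setup_pos: "L > 0" "m > 0" "lam > 0"
    and disk_setup_interval: "mode_root md 0 < mode_root md (m - 1)"
    and disk_setup_root: "\<And>i. i < m \<Longrightarrow> is_kth_root (fst (md i)) (snd (md i)) (mode_root md i)"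
    and disk_setup_root_mem: "\<And>i. i < m \<Longrightarrow> mode_root md i \<in> {mode_root md 0..mode_root md (m - 1)}"
    and disk_setup_root_le: "\<And>i. i < m \<Longrightarrow> mode_root md i \<le> lam"
    and disk_setup_order: "\<And>i. i < m \<Longrightarrow> \<bar>fst (md i)\<bar> \<le> max_order m md"
    and disk_setup_max_order: "0 \<le> max_order m md" "real_of_int (max_order m md) \<le> lam"
    and disk_setup_num_modes: "real m \<le> (2 * lam + 1)\<^sup>2"
proof -
  have m: "m = card (band lam)" and enum: "mode_enumeration lam md"
    and int: "mode_root md 0 < mode_root md (m - 1)"
    using assms by (auto simp: disk_setup_def)
  show L: "L > 0" and lam: "lam > 0" using assms by (auto simp: disk_setup_def)
  show "mode_root md 0 < mode_root md (m - 1)" by (rule int)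
  show m0: "m > 0" using int by (cases m) auto
  then have fin: "finite (band lam)" using m card_ge_0_finite by blast
  have bij: "bij_betw md {..<m} (band lam)" and mono: "mono_on {..<m} (mode_root md)"
    using enum m by (auto simp: mode_enumeration_def)
  have mem: "(fst (md i), snd (md i)) \<in> band lam" if "i < m" for i
    using bij that by (auto simp: bij_betw_def)
  show root: "is_kth_root (fst (md i)) (snd (md i)) (mode_root md i)" if "i < m" for i
    by (rule bessel_root_band[OF fin mem[OF that]])
  show le: "mode_root md i \<le> lam" if "i < m" for i using mem[OF that] by (auto simp: band_def)
  show "mode_root md i \<in> {mode_root md 0..mode_root md (m - 1)}" if "i < m" for i
    using mono_onD[OF mono, of 0 i] mono_onD[OF mono, of i "m - 1"] that by auto
  have up: "fst (md i) \<le> max_order m md" if "i < m" for i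
    unfolding max_order_def using that by (intro Max_ge) auto
  show order: "\<bar>fst (md i)\<bar> \<le> max_order m md" if "i < m" for i
  proof -
    have "(- fst (md i), snd (md i)) \<in> band lam" using band_neg mem[OF that] by blast
    then obtain j where "j < m" "md j = (- fst (md i), snd (md i))"
      using bij unfolding bij_betw_def by (metis imageE lessThan_iff)
    with up[of i] up[of j] that show ?thesis by simp
  qed
  show "0 \<le> max_order m md" using order[OF m0] by linarith
  have "max_order m md \<in> (\<lambda>i. fst (md i)) ` {..<m}"
    unfolding max_order_def using m0 by (intro Max_in) auto
  then obtain i where i: "i < m" "max_order m md = fst (md i)" by auto
  have "real_of_int (fst (md i)) \<le> real_of_int \<bar>fst (md i)\<bar>" by simp
  also have "\<dots> \<le> lam" using bessel_root_bounds(2)[OF root[OF i(1)]] le[OF i(1)] by simp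
  finally show "real_of_int (max_order m md) \<le> lam" using i by simp
  show "real m \<le> (2 * lam + 1)\<^sup>2" unfolding m using card_band_le[OF fin] lam by simp
qed

lemma mode_const_bounds:
  assumes "is_kth_root n k (bessel_root n k)"
  shows "0 \<le> norm_const n k" "norm_const n k \<le> bessel_root n k / sqrt pi"
proof -
  let ?\<mu> = "bessel_root n k"
  have b: "2 \<le> ?\<mu>" "1 / ?\<mu> \<le> \<bar>bessel_J (n + 1) ?\<mu>\<bar>" using bessel_root_bounds[OF assms] by auto
  then have "1 / (sqrt pi * \<bar>bessel_J (n + 1) ?\<mu>\<bar>) \<le> 1 / (sqrt pi * (1 / ?\<mu>))"
  proof (intro divide_left_mono mult_left_mono mult_pos_pos)
    show "0 < \<bar>bessel_J (n + 1) ?\<mu>\<bar>" by (rule less_le_trans[OF _ b(2)]) (use b in simp)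
  qed (use b in auto)
  then show "norm_const n k \<le> ?\<mu> / sqrt pi" by (simp add: norm_const_def)
  show "0 \<le> norm_const n k" by (simp add: norm_const_def)
qed

section \<open>Angular quadrature\<close>

abbreviation wave :: "real \<Rightarrow> complex" where
  "wave t \<equiv> exp (- \<i> * of_real t)"

lemma has_sum_exp: "((\<lambda>n. x ^ n / fact n) has_sum exp x) UNIV"
  for x :: "'a::{real_normed_field,banach}"
proof -
  have "((\<lambda>n. x ^ n /\<^sub>R fact n) has_sum exp x) UNIV"
    by (rule norm_summable_imp_has_sum[OF summable_norm_exp exp_converges])
  moreover have "x ^ n /\<^sub>R fact n = x ^ n / fact n" for n
    by (simp add: scaleR_conv_of_real divide_inverse mult.commute)
  ultimately show ?thesis by simp
qed

text \<open>
  The product of two exponential series as an unordered double series, so that its terms may be grouped by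
  the difference of the two exponents.
\<close>
lemma has_sum_exp_mult_exp:
  fixes x y :: "'a::{real_normed_field,banach}"
  shows "((\<lambda>(a, b). x ^ a / fact a * (y ^ b / fact b)) has_sum exp x * exp y) UNIV"
proof -
  let ?f = "\<lambda>(a, b). x ^ a / fact a * (y ^ b / fact b)"
  have "(\<lambda>p. norm (?f p)) summable_on (UNIV \<times> UNIV)"
  proof (rule summable_on_SigmaI)
    fix a :: nat
    have "((\<lambda>b. norm x ^ a / fact a * (norm y ^ b / fact b)) has_sum norm x ^ a / fact a * exp (norm y)) UNIV"
      by (intro has_sum_cmult_right has_sum_exp)
    then show "((\<lambda>b. norm (?f (a, b))) has_sum norm x ^ a / fact a * exp (norm y)) UNIV"
      by (simp add: norm_mult norm_divide norm_power)
  next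
    show "(\<lambda>a. norm x ^ a / fact a * exp (norm y)) summable_on UNIV"
      by (rule has_sum_imp_summable[OF has_sum_cmult_left[OF has_sum_exp]])
  qed auto
  then have "?f summable_on (UNIV \<times> UNIV)" by (rule abs_summable_summable)
  then have "(?f has_sum exp x * exp y) (UNIV \<times> UNIV)"
  proof (rule has_sum_SigmaI[rotated 2])
    show "((\<lambda>b. ?f (a, b)) has_sum x ^ a / fact a * exp y) UNIV" for a
      unfolding prod.case by (intro has_sum_cmult_right has_sum_exp)
    show "((\<lambda>a. x ^ a / fact a * exp y) has_sum exp x * exp y) UNIV"
      by (intro has_sum_cmult_left has_sum_exp)
  qed
  then show ?thesis by simp
qed

lemma has_sum_sum:
  fixes f :: "'i \<Rightarrow> 'a \<Rightarrow> 'b::topological_comm_monoid_add"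
  assumes "\<And>i. i \<in> I \<Longrightarrow> (f i has_sum S i) A"
  shows "((\<lambda>x. \<Sum>i\<in>I. f i x) has_sum (\<Sum>i\<in>I. S i)) A"
  using assms by (induction I rule: infinite_finite_induct) (auto intro: has_sum_add)

lemma sum_exp_angle:
  assumes "s > 0"
  shows "(\<Sum>l<s. exp (\<i> * of_real (of_int k * angle s l))) = (if int s dvd k then of_nat s else 0)"
proof -
  define w where "w = exp (\<i> * of_real (2 * pi * of_int k / of_nat s))"
  have pow: "exp (\<i> * of_real (of_int k * angle s l)) = w ^ l" for l
    unfolding w_def exp_of_nat_mult[symmetric] by (simp add: angle_def field_simps)
  have ws: "w ^ s = 1"
  proof -
    have "w ^ s = exp (2 * of_int k * of_real pi * \<i>)"
      unfolding w_def exp_of_nat_mult[symmetric] using assms by (simp add: field_simps)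
    then show ?thesis by (simp add: exp_integer_2pi mult_ac)
  qed
  have iff: "w = 1 \<longleftrightarrow> int s dvd k"
  proof -
    have "w = 1 \<longleftrightarrow> (\<exists>n::int. 2 * pi * of_int k / of_nat s = of_int (2 * n) * pi)"
      unfolding w_def exp_eq_1 by simp
    also have "\<dots> \<longleftrightarrow> (\<exists>n::int. real_of_int k = of_int (int s * n))"
      using assms by (simp add: field_simps)
    also have "\<dots> \<longleftrightarrow> int s dvd k" unfolding of_int_eq_iff dvd_def ..
    finally show ?thesis .
  qed
  show ?thesis
  proof (cases "w = 1")
    case True
    then show ?thesis using iff unfolding pow by simp
  next
    case False
    have "(w - 1) * (\<Sum>l<s. w ^ l) = w ^ s - 1" by (rule power_diff_1_eq[symmetric])
    then have "(\<Sum>l<s. w ^ l) = 0" using ws False by simp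
    then show ?thesis using iff False unfolding pow by simp
  qed
qed

text \<open>
  In the expansion \<open>exp (- i z cos \<psi>) = \<Sum> (- i z/2)\<^bsup>a+b\<^esup> / (a! b!) e\<^bsup>i(a-b)\<psi>\<^esup>\<close> the terms with \<open>a - b = - n\<close> make
  up the power series of \<open>J\<^sub>n\<close>, up to the factor \<open>i\<^sup>n\<close>. The pairs \<open>(j + max 0 (- n), j + max 0 n)\<close>
  enumerate them for both signs of \<open>n\<close>.
\<close>
lemma bessel_J_diagonal_has_sum:
  fixes z :: real and n :: int
  defines "D \<equiv> {p::nat \<times> nat. int (fst p) - int (snd p) = - n}"
  assumes summable: "(\<lambda>(a, b). \<i> powi n * (- \<i> * of_real z / 2) ^ (a + b) / (fact a * fact b)) summable_on D"
  shows "((\<lambda>(a, b). \<i> powi n * (- \<i> * of_real z / 2) ^ (a + b) / (fact a * fact b))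
           has_sum complex_of_real (bessel_J n z)) D"
proof -
  let ?v = "\<lambda>(a, b). \<i> powi n * (- \<i> * complex_of_real z / 2) ^ (a + b) / (fact a * fact b)"
  let ?h = "\<lambda>j. (j + nat (- n), j + nat n)"
  define \<sigma> :: real where "\<sigma> = (if n < 0 then (-1) ^ nat \<bar>n\<bar> else 1)"
  let ?t = "\<lambda>j. (-1) ^ j / (fact j * fact (j + nat \<bar>n\<bar>)) * (z / 2) ^ (2 * j + nat \<bar>n\<bar>)"
  have bij: "bij_betw ?h UNIV D"
  proof (rule bij_betw_byWitness[where f'="\<lambda>p. min (fst p) (snd p)"])
    show "\<forall>p\<in>D. ?h (min (fst p) (snd p)) = p" by (auto simp: D_def)
    show "?h ` UNIV \<subseteq> D" by (auto simp: D_def)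
    show "\<forall>j\<in>UNIV. min (fst (?h j)) (snd (?h j)) = j" by auto
  qed simp
  have v_h: "?v (?h j) = of_real (\<sigma> * ?t j)" for j
  proof -
    have c_pow: "(- \<i> * complex_of_real z / 2) ^ k = (- \<i>) ^ k * of_real ((z / 2) ^ k)" for k
      unfolding of_real_power power_mult_distrib[symmetric] by simp
    have i_pow: "(- \<i>) ^ (2 * j + k) = (- 1) ^ j * (- \<i>) ^ k" for k
      by (simp add: power_add power_mult)
    have sign: "(\<i> powi n) * (- \<i>) ^ nat \<bar>n\<bar> = of_real \<sigma>"
    proof (cases "n < 0")
      case True
      then have "\<i> powi n = (- \<i>) ^ nat \<bar>n\<bar>" by (simp add: power_int_def)
      then show ?thesis using True by (simp add: \<sigma>_def flip: power_mult_distrib)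
    next
      case False
      then have "\<i> powi n = \<i> ^ nat \<bar>n\<bar>" by (simp add: power_int_def)
      then show ?thesis using False by (simp add: \<sigma>_def flip: power_mult_distrib)
    qed
    have sum_eq: "j + nat (- n) + (j + nat n) = 2 * j + nat \<bar>n\<bar>" by (cases "n < 0") auto
    have fact_eq: "fact (j + nat (- n)) * fact (j + nat n) = (fact j * fact (j + nat \<bar>n\<bar>) :: complex)"
      by (cases "n < 0") auto
    have "?v (?h j) = (\<i> powi n * (- \<i>) ^ nat \<bar>n\<bar>) * (- 1) ^ j * of_real ((z / 2) ^ (2 * j + nat \<bar>n\<bar>)) / (fact j * fact (j + nat \<bar>n\<bar>))"
      unfolding prod.case sum_eq fact_eq c_pow i_pow by (simp only: mult_ac)
    also have "\<dots> = of_real \<sigma> * (- 1) ^ j * of_real ((z / 2) ^ (2 * j + nat \<bar>n\<bar>)) / (fact j * fact (j + nat \<bar>n\<bar>))"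
      unfolding sign ..
    finally show ?thesis by simp
  qed
  obtain X where X: "(?v has_sum X) D" using summable by (auto simp: summable_on_def)
  then have "((\<lambda>j. ?v (?h j)) has_sum X) UNIV" using has_sum_reindex_bij_betw[OF bij, of ?v X] by simp
  then have "(\<lambda>j. ?v (?h j)) sums X" by (rule has_sum_imp_sums)
  then have *: "(\<lambda>j. complex_of_real (\<sigma> * ?t j)) sums X" unfolding v_h .
  then have "(\<lambda>j. \<sigma> * ?t j) sums Re X" by (rule sums_Re[of "\<lambda>j. complex_of_real (\<sigma> * ?t j)" X, unfolded Re_complex_of_real])
  moreover have "Im X = 0" using sums_Im[OF *, unfolded Im_complex_of_real] by (simp only: sums_unique2[OF _ sums_zero])
  moreover have "\<sigma> * bessel_J n z = (\<Sum>j. ?t j)" unfolding bessel_J_def \<sigma>_def by (simp flip: mult.assoc power_mult_distrib)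
  moreover have "\<sigma> * \<sigma> = 1" by (simp add: \<sigma>_def flip: power_mult_distrib)
  ultimately have "bessel_J n z = Re X"
  proof -
    assume a: "(\<lambda>j. \<sigma> * ?t j) sums Re X" and b: "\<sigma> * bessel_J n z = (\<Sum>j. ?t j)" and c: "\<sigma> * \<sigma> = 1"
    have "(\<lambda>j. \<sigma> * (\<sigma> * ?t j)) sums (\<sigma> * Re X)" by (rule sums_mult[OF a])
    then have "?t sums (\<sigma> * Re X)" using c by (simp flip: mult.assoc)
    then have "\<sigma> * bessel_J n z = \<sigma> * Re X" using b by (simp add: sums_iff)
    then have "\<sigma> * \<sigma> * bessel_J n z = \<sigma> * \<sigma> * Re X" by (simp add: mult.assoc)
    then show ?thesis using c by simp
  qed
  then have "X = of_real (bessel_J n z)" using \<open>Im X = 0\<close> by (simp add: complex_eq_iff)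
  then show ?thesis using X by simp
qed

text \<open>
  Averaging the double series of \<open>exp (- i z cos (\<theta> - \<phi>)) e\<^bsup>-in\<phi>\<^esup>\<close> over the \<open>s\<close> angles keeps exactly the terms with
  \<open>a - b \<equiv> - n\<close> modulo \<open>s\<close>. Those with \<open>a - b = - n\<close> sum to \<open>J\<^sub>n(z) e\<^bsup>-in\<theta>\<^esup>\<close>. All others satisfy
  \<open>|a - b| \<ge> \<nu> = s - |n|\<close>, so that their size \<open>(z/2)\<^bsup>a+b\<^esup> / (a! b!)\<close> may be multiplied by
  \<open>4\<^sup>-\<^sup>\<nu> (4\<^bsup>a-b\<^esup> + 4\<^bsup>b-a\<^esup>) \<ge> 1\<close>; the resulting series sums to \<open>2 \<cdot> 4\<^sup>-\<^sup>\<nu> e\<^bsup>2z+z/8\<^esup>\<close>. The base 4 may be any number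
  above 1; it is chosen so that the bound is small when \<open>\<nu>\<close> is about \<open>3 z\<close>.
\<close>
lemma angular_quadrature_error:
  fixes z \<theta> :: real and n :: int and s :: nat
  assumes z: "0 \<le> z" and n: "\<bar>n\<bar> < int s"
  shows "cmod (\<i> powi n / of_nat s *
            (\<Sum>l<s. wave (z * cos (\<theta> - angle s l)) * wave (of_int n * angle s l))
          - of_real (bessel_J n z) * wave (of_int n * \<theta>))
         \<le> 2 * exp (17 * z / 8) / 4 ^ nat (int s - \<bar>n\<bar>)"
proof -
  define c where "c = - \<i> * complex_of_real z / 2"
  let ?E = "\<lambda>l. wave (of_int n * angle s l)"
  let ?quad = "\<i> powi n / of_nat s * (\<Sum>l<s. wave (z * cos (\<theta> - angle s l)) * ?E l)"
  let ?lim = "of_real (bessel_J n z) * wave (of_int n * \<theta>)"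
  let ?A = "\<lambda>a b. exp (\<i> * of_real (of_int (int a - int b) * \<theta>))"
  let ?S = "\<lambda>a b l. exp (\<i> * of_real (of_int (- (int a - int b + n)) * angle s l))"
  let ?v = "\<lambda>(a, b). \<i> powi n * c ^ (a + b) / (fact a * fact b)"
  let ?r = "wave (of_int n * \<theta>)"
  define w where "w = (\<lambda>l. exp (\<i> * of_real (\<theta> - angle s l)))"
  define U where "U = (\<lambda>(a, b). \<i> powi n / of_nat s * (\<Sum>l<s. (c * w l) ^ a / fact a * ((c / w l) ^ b / fact b) * ?E l))"
  define D where "D = {p::nat \<times> nat. int (fst p) - int (snd p) = - n}"
  define \<nu> where "\<nu> = nat (int s - \<bar>n\<bar>)"
  have s: "s > 0" using n by (cases s) auto
  have exp_split: "wave (z * cos (\<theta> - angle s l)) = exp (c * w l) * exp (c / w l)" for l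
  proof -
    have "1 / w l = wave (\<theta> - angle s l)" by (simp add: w_def exp_minus divide_inverse)
    then have "c * w l + c / w l = c * (exp (\<i> * of_real (\<theta> - angle s l)) + wave (\<theta> - angle s l))"
      by (simp add: w_def divide_inverse algebra_simps)
    also have "\<dots> = c * (2 * of_real (cos (\<theta> - angle s l)))"
      unfolding cos_of_real[symmetric] cos_exp_eq by simp
    also have "\<dots> = - \<i> * of_real (z * cos (\<theta> - angle s l))" by (simp add: c_def)
    finally show ?thesis by (simp only: exp_add[symmetric])
  qed
  have U_sum: "(U has_sum ?quad) UNIV"
    unfolding exp_split U_def case_prod_unfold
    by (intro has_sum_cmult_right has_sum_sum has_sum_cmult_left has_sum_exp_mult_exp[unfolded case_prod_unfold])
  have U_eq: "U (a, b) = (if int s dvd int a - int b + n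
       then \<i> powi n * c ^ (a + b) / (fact a * fact b) * ?A a b else 0)" for a b
  proof -
    have "(c * w l) ^ a / fact a * ((c / w l) ^ b / fact b) * ?E l =
       c ^ (a + b) / (fact a * fact b) * ?A a b *
       ?S a b l" for l
    proof -
      have "w l ^ a / w l ^ b = exp (of_nat a * (\<i> * of_real (\<theta> - angle s l)) - of_nat b * (\<i> * of_real (\<theta> - angle s l)))"
        by (simp add: w_def exp_diff exp_of_nat_mult)
      then have "w l ^ a / w l ^ b * ?E l =
        exp (of_nat a * (\<i> * of_real (\<theta> - angle s l)) - of_nat b * (\<i> * of_real (\<theta> - angle s l)) + (- \<i> * of_real (of_int n * angle s l)))"
        unfolding exp_add by simp
      also have "\<dots> = exp (\<i> * of_real (of_int (int a - int b) * \<theta>) + \<i> * of_real (of_int (- (int a - int b + n)) * angle s l))"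
        by (rule arg_cong[where f=exp]) (simp add: algebra_simps)
      finally have "w l ^ a / w l ^ b * ?E l =
         ?A a b * ?S a b l"
        unfolding exp_add .
      moreover have "(c * v) ^ a / fact a * ((c / v) ^ b / fact b) * e = c ^ (a + b) / (fact a * fact b) * (v ^ a / v ^ b * e)"
        for v e :: complex
        by (simp add: power_mult_distrib power_divide power_add mult_ac)
      ultimately show ?thesis by (simp only: mult.assoc)
    qed
    then have "U (a, b) = \<i> powi n / of_nat s * (c ^ (a + b) / (fact a * fact b) * ?A a b *
        (\<Sum>l<s. ?S a b l))"
      by (simp add: U_def sum_distrib_left)
    also have "\<dots> = \<i> powi n / of_nat s * (c ^ (a + b) / (fact a * fact b) * ?A a b *
        (if int s dvd int a - int b + n then of_nat s else 0))"
      unfolding sum_exp_angle[OF s] by (simp only: dvd_minus_iff)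
    finally show ?thesis using s by simp
  qed
  have U_D: "U p = ?v p * ?r"
    if "p \<in> D" for p
  proof -
    obtain a b where p: "p = (a, b)" by (cases p)
    have "int a - int b = - n" using that p by (simp add: D_def)
    then show ?thesis unfolding p U_eq by simp
  qed
  have "(\<lambda>p. ?v p * ?r) summable_on D"
    using summable_on_cong[of D U] U_D summable_on_subset_banach[OF has_sum_imp_summable[OF U_sum], of D] by simp
  then have "?v summable_on D"
    by (subst (asm) summable_on_cmult_left') auto
  then have "(?v has_sum complex_of_real (bessel_J n z)) D"
    unfolding c_def D_def by (rule bessel_J_diagonal_has_sum)
  then have "((\<lambda>p. ?v p * ?r)
      has_sum ?lim) D"
    by (rule has_sum_cmult_left)
  then have "(U has_sum ?lim) D"
    using has_sum_cong[of D U] U_D by simp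
  from has_sum_Diff[OF U_sum this] have err: "(U has_sum (?quad - ?lim)) (UNIV - D)" by simp
  \<comment> \<open>a summable majorant of all terms with \<open>|a - b| \<ge> \<nu>\<close>\<close>
  define M where "M = (\<lambda>(a, b). 1 / 4 ^ \<nu> * ((2 * z) ^ a / fact a * ((z / 8) ^ b / fact b) + (z / 8) ^ a / fact a * ((2 * z) ^ b / fact b)))"
  have "(M has_sum 1 / 4 ^ \<nu> * (exp (2 * z) * exp (z / 8) + exp (z / 8) * exp (2 * z))) UNIV"
    unfolding M_def case_prod_unfold
    by (intro has_sum_cmult_right has_sum_add has_sum_exp_mult_exp[unfolded case_prod_unfold])
  also have "1 / 4 ^ \<nu> * (exp (2 * z) * exp (z / 8) + exp (z / 8) * exp (2 * z)) = 2 * exp (17 * z / 8) / 4 ^ \<nu>"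
    by (simp flip: exp_add)
  finally have M: "(M has_sum 2 * exp (17 * z / 8) / 4 ^ \<nu>) UNIV" .
  have M_nonneg: "0 \<le> M p" for p using z by (auto simp: M_def split: prod.split)
  have bound: "norm (U p) \<le> M p" if "p \<in> UNIV - D" for p
  proof -
    obtain a b where p: "p = (a, b)" by (cases p)
    show ?thesis
    proof (cases "int s dvd int a - int b + n")
      case False
      then show ?thesis using M_nonneg[of p] p U_eq[of a b] by simp
    next
      case True
      have "int a - int b + n \<noteq> 0" using that p by (auto simp: D_def)
      with True have "int s \<le> \<bar>int a - int b + n\<bar>" by (metis abs_of_nat dvd_imp_le_int)
      then have far: "int \<nu> \<le> \<bar>int a - int b\<bar>" unfolding \<nu>_def using n by linarith
      have split: "(z / 2) ^ (a + b) / (fact a * fact b) * (4 ^ i / 4 ^ j) = (2 * z) ^ i / fact i * ((z / 8) ^ j / fact j)"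
        if "(i, j) = (a, b) \<or> (i, j) = (b, a)" for i j
      proof -
        have "2 * z = (z / 2) * 4" "z / 8 = (z / 2) / 4" by simp_all
        then have "(2 * z) ^ i = (z / 2) ^ i * 4 ^ i" "(z / 8) ^ j = (z / 2) ^ j / 4 ^ j"
          by (simp_all only: power_mult_distrib power_divide)
        moreover have "(z / 2) ^ (a + b) = (z / 2) ^ i * (z / 2) ^ j" "fact a * fact b = (fact i * fact j :: real)"
          using that by (auto simp: power_add simp del: power_divide)
        ultimately show ?thesis by (simp add: mult_ac)
      qed
      have "norm (U p) = (z / 2) ^ (a + b) / (fact a * fact b)"
      proof -
        have "cmod (\<i> powi n) = 1" by (simp add: norm_power_int)
        then show ?thesis using True z unfolding p U_eq by (simp add: norm_mult norm_divide norm_power c_def)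
      qed
      also have "\<dots> \<le> M p"
      proof (cases "int \<nu> \<le> int a - int b")
        case True
        then have "a = (a - b - \<nu>) + b + \<nu>" by linarith
        then have "(4::real) ^ a = 4 ^ (a - b - \<nu>) * 4 ^ b * 4 ^ \<nu>" by (metis power_add)
        moreover have "(1::real) \<le> 4 ^ (a - b - \<nu>)" by (rule one_le_power) simp
        ultimately have "1 \<le> 1 / 4 ^ \<nu> * (4 ^ a / 4 ^ b :: real)" by simp
        then have "(z / 2) ^ (a + b) / (fact a * fact b) * 1 \<le> (z / 2) ^ (a + b) / (fact a * fact b) * (1 / 4 ^ \<nu> * (4 ^ a / 4 ^ b))"
          using z by (intro mult_left_mono) auto
        also have "\<dots> = 1 / 4 ^ \<nu> * ((2 * z) ^ a / fact a * ((z / 8) ^ b / fact b))"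
          unfolding split[of a b, OF disjI1[OF refl], symmetric] by (rule mult.left_commute)
        also have "\<dots> \<le> M p" unfolding p M_def prod.case by (rule mult_left_mono) (use z in simp_all)
        finally show ?thesis by simp
      next
        case False
        then have "b = (b - a - \<nu>) + a + \<nu>" using far by linarith
        then have "(4::real) ^ b = 4 ^ (b - a - \<nu>) * 4 ^ a * 4 ^ \<nu>" by (metis power_add)
        moreover have "(1::real) \<le> 4 ^ (b - a - \<nu>)" by (rule one_le_power) simp
        ultimately have "1 \<le> 1 / 4 ^ \<nu> * (4 ^ b / 4 ^ a :: real)" by simp
        then have "(z / 2) ^ (a + b) / (fact a * fact b) * 1 \<le> (z / 2) ^ (a + b) / (fact a * fact b) * (1 / 4 ^ \<nu> * (4 ^ b / 4 ^ a))"
          using z by (intro mult_left_mono) auto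
        also have "\<dots> = 1 / 4 ^ \<nu> * ((2 * z) ^ b / fact b * ((z / 8) ^ a / fact a))"
          unfolding split[of b a, OF disjI2[OF refl], symmetric] by (rule mult.left_commute)
        also have "\<dots> \<le> M p" unfolding p M_def prod.case mult.commute[of "(z / 8) ^ a / fact a"]
          by (rule mult_left_mono) (use z in simp_all)
        finally show ?thesis by simp
      qed
      finally show ?thesis .
    qed
  qed
  have sM: "M summable_on (UNIV - D)" using summable_on_subset_banach[OF has_sum_imp_summable[OF M]] by blast
  have "norm (?quad - ?lim) \<le> infsum M (UNIV - D)"
    by (rule norm_infsum_le[OF err has_sum_infsum[OF sM] bound])
  also have "\<dots> \<le> 2 * exp (17 * z / 8) / 4 ^ \<nu>"
    by (rule has_sum_mono_neutral[OF has_sum_infsum[OF sM] M]) (use M_nonneg in auto)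
  finally show ?thesis unfolding \<nu>_def .
qed

section \<open>Chebyshev interpolation\<close>

lemma iterated_Rolle:
  fixes d :: "nat \<Rightarrow> real \<Rightarrow> real"
  assumes "\<And>k x. (d k has_real_derivative d (Suc k) x) (at x)"
    and "finite Z" "card Z = Suc n" "\<forall>z\<in>Z. d 0 z = 0"
  shows "\<exists>z. d n z = 0"
  using assms
proof (induction n arbitrary: d Z)
  case 0
  then have "Z \<noteq> {}" by auto
  with 0 show ?case by blast
next
  case (Suc n)
  have "\<exists>z. x < z \<and> z < y \<and> d 1 z = 0" if zero: "d 0 x = 0" "d 0 y = 0" "x < y" for x y
  proof -
    have "continuous_on {x..y} (d 0)"
      by (intro continuous_at_imp_continuous_on ballI DERIV_isCont[OF Suc.prems(1)])
    moreover have "d 0 differentiable (at z)" for z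
      using Suc.prems(1)[of 0 z] real_differentiable_def by blast
    ultimately obtain z where z: "x < z" "z < y" "DERIV (d 0) z :> 0"
      using Rolle[OF zero(3), of "d 0"] zero by auto
    then have "d 1 z = 0" using DERIV_unique[OF z(3) Suc.prems(1)] by simp
    with z show ?thesis by blast
  qed
  then have "\<exists>Z'. finite Z' \<and> card Z' = Suc n \<and> (\<forall>z\<in>Z'. d 1 z = 0 \<and> Min Z < z \<and> z < Max Z)"
    using Suc.prems(2-4) by (intro interlacing_finite_set[where P="\<lambda>x. d 0 x = 0"])
  then obtain Z' where Z': "finite Z'" "card Z' = Suc n" "\<forall>z\<in>Z'. d (Suc 0) z = 0" by auto
  show ?case by (rule Suc.IH[where d="\<lambda>k. d (Suc k)", OF _ Z']) (rule Suc.prems(1))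
qed

definition lagrange_basis :: "nat set \<Rightarrow> (nat \<Rightarrow> real) \<Rightarrow> nat \<Rightarrow> real \<Rightarrow> real" where
  "lagrange_basis A t k x = (\<Prod>l\<in>A - {k}. (x - t l) / (t k - t l))"

lemma degree_prod_linear:
  fixes t :: "'i \<Rightarrow> real"
  assumes "finite A"
  shows "degree (\<Prod>l\<in>A. [:- t l, 1:]) = card A" "coeff (\<Prod>l\<in>A. [:- t l, 1:]) (card A) = 1"
proof -
  have "degree (\<Prod>l\<in>A. [:- t l, 1:]) = card A \<and> lead_coeff (\<Prod>l\<in>A. [:- t l, 1:]) = 1"
    using assms
  proof (induction A rule: finite_induct)
    case (insert x A)
    let ?P = "\<Prod>l\<in>A. [:- t l, 1:]"
    have "?P \<noteq> 0" using insert by auto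
    then have "degree ([:- t x, 1:] * ?P) = Suc (card A)" using insert by (subst degree_mult_eq) auto
    moreover have "lead_coeff ([:- t x, 1:] * ?P) = 1"
      unfolding lead_coeff_mult conjunct2[OF insert.IH] by simp
    ultimately show ?case using insert by (simp only: prod.insert card_insert_disjoint simp_thms)
  qed simp
  then show "degree (\<Prod>l\<in>A. [:- t l, 1:]) = card A" "coeff (\<Prod>l\<in>A. [:- t l, 1:]) (card A) = 1" by metis+
qed

lemma lagrange_basis_node:
  assumes "finite A" "inj_on t A" "j \<in> A" "k \<in> A"
  shows "lagrange_basis A t k (t j) = (if k = j then 1 else 0)"
proof (cases "k = j")
  case True
  have "t j \<noteq> t l" if "l \<in> A - {j}" for l using that assms by (auto dest: inj_onD)
  then have "(\<Prod>l\<in>A - {j}. (t j - t l) / (t j - t l)) = 1" by (intro prod.neutral) simp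
  then show ?thesis unfolding lagrange_basis_def True by simp
next
  case False
  then show ?thesis unfolding lagrange_basis_def using assms by (auto intro!: prod_zero bexI[of _ j])
qed

text \<open>
  The classical remainder formula. Subtracting from \<open>d 0\<close> the interpolation polynomial and a multiple of
  \<open>W = \<Prod> (X - t\<^sub>k)\<close> chosen to create a further zero at \<open>x\<close> gives \<open>q + 1\<close> zeros, hence a zero of the \<open>q\<close>-th
  derivative, in which only \<open>d q\<close> and the leading coefficient of the polynomial part survive.
  The derivatives are passed as a family \<open>d\<close>, as in Taylor's theorem.
\<close>
lemma lagrange_error:
  fixes d :: "nat \<Rightarrow> real \<Rightarrow> real" and t :: "nat \<Rightarrow> real"
  assumes deriv: "\<And>k x. (d k has_real_derivative d (Suc k) x) (at x)"
    and inj: "inj_on t {..<q}" and q: "q \<ge> 1"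
  shows "\<exists>\<xi>. d 0 x - (\<Sum>k<q. d 0 (t k) * lagrange_basis {..<q} t k x) = d q \<xi> / fact q * (\<Prod>k<q. x - t k)"
proof -
  have node: "(\<Sum>k<q. d 0 (t k) * lagrange_basis {..<q} t k (t j)) = d 0 (t j)" if "j < q" for j
  proof -
    have "(\<Sum>k<q. d 0 (t k) * lagrange_basis {..<q} t k (t j)) = (\<Sum>k<q. if k = j then d 0 (t k) else 0)"
      using inj that by (intro sum.cong) (auto simp: lagrange_basis_node)
    then show ?thesis using that by simp
  qed
  show ?thesis
  proof (cases "x \<in> t ` {..<q}")
    case True
    then obtain j where j: "j < q" "x = t j" by auto
    then have "(\<Prod>k<q. x - t k) = 0" by (intro prod_zero) auto
    then show ?thesis using node[OF j(1)] j(2) by simp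
  next
    case False
    define Lp where "Lp = (\<lambda>k. smult (\<Prod>l\<in>{..<q}-{k}. 1 / (t k - t l)) (\<Prod>l\<in>{..<q}-{k}. [:- t l, 1:]))"
    have Lp: "poly (Lp k) y = lagrange_basis {..<q} t k y" for k y
      by (simp add: Lp_def lagrange_basis_def poly_prod prod_dividef)
    have degL: "degree (Lp k) < q" if "k < q" for k
    proof -
      have "degree (Lp k) \<le> card ({..<q} - {k})"
        unfolding Lp_def using degree_prod_linear[of "{..<q}-{k}" t] degree_smult_le[of _ "\<Prod>l\<in>{..<q}-{k}. [:- t l, 1:]"] by simp
      also have "\<dots> < q" using that by simp
      finally show ?thesis .
    qed
    define P where "P = (\<Sum>k<q. smult (d 0 (t k)) (Lp k))"
    define W where "W = (\<Prod>k<q. [:- t k, 1:])"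
    have W: "degree W = q" "coeff W q = 1" using degree_prod_linear[of "{..<q}" t] by (simp_all add: W_def)
    have P0: "coeff P i = 0" if "i \<ge> q" for i
      unfolding P_def coeff_sum coeff_smult using degL that
      by (intro sum.neutral) (auto intro: coeff_eq_0 less_le_trans)
    have Px: "poly P y = (\<Sum>k<q. d 0 (t k) * lagrange_basis {..<q} t k y)" for y
      by (simp add: P_def poly_sum Lp)
    have Pt: "poly P (t j) = d 0 (t j)" if "j < q" for j
      unfolding Px by (rule node[OF that])
    have Wx: "poly W y = (\<Prod>k<q. y - t k)" for y by (simp add: W_def poly_prod)
    have "poly W x \<noteq> 0" using False unfolding Wx by auto
    \<comment> \<open>the multiple of \<open>W\<close> that makes \<open>x\<close> a further zero of the difference\<close>
    define K where "K = (d 0 x - poly P x) / poly W x"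
    define R where "R = P + smult K W"
    let ?e = "\<lambda>k y. d k y - poly ((pderiv ^^ k) R) y"
    have "\<exists>z. ?e q z = 0"
    proof (rule iterated_Rolle[where Z="insert x (t ` {..<q})"])
      show "(?e k has_real_derivative ?e (Suc k) y) (at y)" for k y
        by (auto intro!: derivative_intros deriv poly_DERIV)
      show "card (insert x (t ` {..<q})) = Suc q"
        using False inj by (simp add: card_image)
      have "poly R (t j) = d 0 (t j)" if "j < q" for j
        using that Pt by (auto simp: R_def Wx intro!: prod_zero)
      moreover have "poly R x = d 0 x" using \<open>poly W x \<noteq> 0\<close> by (simp add: R_def K_def)
      ultimately show "\<forall>z\<in>insert x (t ` {..<q}). ?e 0 z = 0" by auto
    qed simp
    then obtain \<xi> where \<xi>: "d q \<xi> = poly ((pderiv ^^ q) R) \<xi>" by auto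
    have "(pderiv ^^ q) R = [:fact q * K:]"
    proof (rule poly_eqI)
      fix i
      have "coeff W (i + q) = (if i = 0 then 1 else 0)" using W by (auto intro: coeff_eq_0)
      then have "coeff R (i + q) = (if i = 0 then K else 0)" using P0 by (simp add: R_def)
      then show "coeff ((pderiv ^^ q) R) i = coeff [:fact q * K:] i"
        by (cases i) (simp_all add: coeff_higher_pderiv pochhammer_fact)
    qed
    with \<xi> have "d q \<xi> = fact q * K" by simp
    then have "d q \<xi> / fact q * poly W x = d 0 x - poly P x"
      using \<open>poly W x \<noteq> 0\<close> by (simp add: K_def)
    then show ?thesis unfolding Px Wx by metis
  qed
qed

fun chebyshev_poly :: "nat \<Rightarrow> real poly" where
  "chebyshev_poly 0 = 1"
| "chebyshev_poly (Suc 0) = [:0, 1:]"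
| "chebyshev_poly (Suc (Suc n)) = smult 2 (pCons 0 (chebyshev_poly (Suc n))) - chebyshev_poly n"

lemma poly_chebyshev_cos: "poly (chebyshev_poly n) (cos x) = cos (real n * x)"
proof (induction n rule: chebyshev_poly.induct)
  case (3 n)
  have "cos (real (Suc (Suc n)) * x) + cos (real n * x) = 2 * cos x * cos (real (Suc n) * x)"
    using cos_plus_cos[of "real (Suc (Suc n)) * x" "real n * x"] 
    by (simp add: algebra_simps add_divide_distrib)
  then show ?case using 3 by (simp add: mult_ac)
qed auto

lemma chebyshev_poly_coeffs:
  "(\<forall>i>n. coeff (chebyshev_poly n) i = 0) \<and> coeff (chebyshev_poly n) n = 2 ^ (n - 1)"
proof (induction n rule: chebyshev_poly.induct)
  case 2
  then show ?case by (auto simp: coeff_pCons split: nat.split)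
next
  case (3 n)
  then show ?case by (auto simp: coeff_pCons split: nat.split)
qed auto

definition cheb_angle :: "nat \<Rightarrow> nat \<Rightarrow> real" where
  "cheb_angle q k = (2 * real k + 1) / real q * (pi / 2)"

lemma cheb_angle_bounds: "k < q \<Longrightarrow> 0 < cheb_angle q k \<and> cheb_angle q k < pi"
proof -
  assume k: "k < q"
  then have "(2 * real k + 1) / real q < 2" by (simp add: divide_less_eq)
  then have "(2 * real k + 1) / real q * (pi / 2) < 2 * (pi / 2)" by (intro mult_strict_right_mono) auto
  then show ?thesis using k unfolding cheb_angle_def by simp
qed

lemma inj_cos_cheb_angle: "inj_on (\<lambda>k. cos (cheb_angle q k)) {..<q}"
proof (rule inj_onI)
  fix k l assume "k \<in> {..<q}" "l \<in> {..<q}" "cos (cheb_angle q k) = cos (cheb_angle q l)"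
  then have "cheb_angle q k = cheb_angle q l" "q > 0"
    using cos_inj_pi[of "cheb_angle q k" "cheb_angle q l"] cheb_angle_bounds[of k q] cheb_angle_bounds[of l q] by auto
  then show "k = l" by (simp add: cheb_angle_def)
qed

lemma cos_cheb_angle: "k < q \<Longrightarrow> cos (real q * cheb_angle q k) = 0"
proof -
  assume "k < q"
  then have "real q * cheb_angle q k = (2 * real k + 1) * (pi / 2)" by (simp add: cheb_angle_def)
  then show ?thesis unfolding cos_zero_iff_int by (intro exI[of _ "2 * int k + 1"]) auto
qed

text \<open>
  Both sides, multiplied by \<open>2\<^bsup>q-1\<^esup>\<close>, are the Chebyshev polynomial of degree \<open>q\<close> at \<open>cos x\<close>: it has the nodes as
  zeros and the leading coefficient \<open>2\<^bsup>q-1\<^esup>\<close>.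
\<close>
lemma prod_cos_cheb_angle:
  assumes "q \<ge> 1"
  shows "(\<Prod>k<q. cos x - cos (cheb_angle q k)) = cos (real q * x) / 2 ^ (q - 1)"
proof -
  let ?W = "\<Prod>k<q. [:- cos (cheb_angle q k), 1:]"
  have W: "degree ?W = q" "coeff ?W q = 1" using degree_prod_linear[of "{..<q}" "\<lambda>k. cos (cheb_angle q k)"] by auto
  have "chebyshev_poly q = smult (2 ^ (q - 1)) ?W"
  proof (rule poly_eqI_degree_lead_coeff[where n=q and A="(\<lambda>k. cos (cheb_angle q k)) ` {..<q}"])
    show "coeff (chebyshev_poly q) q = coeff (smult (2 ^ (q - 1)) ?W) q"
      using W chebyshev_poly_coeffs[of q] by simp
    show "q \<le> card ((\<lambda>k. cos (cheb_angle q k)) ` {..<q})"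
      by (simp add: card_image[OF inj_cos_cheb_angle])
    show "degree (chebyshev_poly q) \<le> q" using chebyshev_poly_coeffs[of q] by (intro degree_le) auto
    show "degree (smult (2 ^ (q - 1)) ?W) \<le> q" using W by simp
    fix z assume "z \<in> (\<lambda>k. cos (cheb_angle q k)) ` {..<q}"
    then obtain j where j: "j < q" "z = cos (cheb_angle q j)" by auto
    then have "poly (smult (2 ^ (q - 1)) ?W) z = 0" by (auto simp: poly_prod intro!: prod_zero)
    then show "poly (chebyshev_poly q) z = poly (smult (2 ^ (q - 1)) ?W) z"
      using j by (simp add: poly_chebyshev_cos cos_cheb_angle)
  qed
  from arg_cong[OF this, of "\<lambda>p. poly p (cos x)"] show ?thesis
    by (simp add: poly_chebyshev_cos poly_prod field_simps)
qed

text \<open>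
  Jordan's inequality: the sine is concave on \<open>[0, \<pi>]\<close>, so it lies above its chord over \<open>[0, \<pi>/2]\<close>.
\<close>
lemma jordan_sin:
  assumes "0 \<le> x" "x \<le> pi / 2"
  shows "2 * x / pi \<le> sin x"
proof -
  have "concave_on {0..pi} sin"
    by (rule f''_le0_imp_concave[where f'=cos and f''="\<lambda>x. - sin x"])
      (auto intro!: derivative_eq_intros sin_ge_zero)
  then have "(1 - 2 * x / pi) * sin 0 + (2 * x / pi) * sin (pi / 2) \<le> sin ((1 - 2 * x / pi) *\<^sub>R 0 + (2 * x / pi) *\<^sub>R (pi / 2))"
    by (rule concave_onD) (use assms in \<open>auto simp: field_simps\<close>)
  then show ?thesis by simp
qed

text \<open>
  With \<open>A = (y - x)/2\<close> and \<open>B = (y + x)/2\<close> one has \<open>cos x - cos y = 2 sin A sin B\<close>. The factor \<open>sin B\<close> is paid for by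
  \<open>sin y = sin (A + B) \<le> |sin A| + sin B \<le> 2 sin B\<close>, and Jordan's inequality bounds \<open>sin A\<close> from below.
\<close>
lemma cos_node_difference:
  assumes x: "0 \<le> x" "x \<le> pi" and y: "0 < y" "y < pi"
  shows "sin y * \<bar>x - y\<bar> \<le> pi * \<bar>cos x - cos y\<bar>"
proof -
  define A B where "A = (y - x) / 2" and "B = (y + x) / 2"
  have B: "0 < B" "B < pi" using x y by (auto simp: B_def)
  then have sB: "0 < sin B" by (rule sin_gt_zero)
  have "\<bar>sin A\<bar> \<le> sin B"
  proof -
    have "sin y * sin x = (sin B)\<^sup>2 - (sin A)\<^sup>2"
    proof -
      have "sin y * sin x = (cos (y - x) - cos (y + x)) / 2" by (rule sin_times_sin)
      also have "y - x = 2 * A" by (simp add: A_def)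
      also have "y + x = 2 * B" by (simp add: B_def)
      also have "(cos (2 * A) - cos (2 * B)) / 2 = (sin B)\<^sup>2 - (sin A)\<^sup>2" unfolding cos_double_sin by simp
      finally show ?thesis .
    qed
    moreover have "0 \<le> sin y * sin x" using x y by (intro mult_nonneg_nonneg sin_ge_zero) auto
    ultimately have "\<bar>sin A\<bar>\<^sup>2 \<le> (sin B)\<^sup>2" by simp
    then show ?thesis by (rule power2_le_imp_le) (use sB in simp)
  qed
  have "y = A + B" by (simp add: A_def B_def field_simps)
  then have "sin y = sin A * cos B + cos A * sin B" by (simp only: sin_add)
  also have "\<dots> \<le> \<bar>sin A\<bar> * 1 + 1 * sin B"
  proof (rule add_mono)
    have "\<bar>sin A * cos B\<bar> \<le> \<bar>sin A\<bar> * 1" unfolding abs_mult by (rule mult_left_mono) auto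
    then show "sin A * cos B \<le> \<bar>sin A\<bar> * 1" by linarith
    show "cos A * sin B \<le> 1 * sin B" by (rule mult_right_mono) (use sB in auto)
  qed
  also have "\<dots> \<le> 2 * sin B" using \<open>\<bar>sin A\<bar> \<le> sin B\<close> by simp
  finally have "sin y \<le> 2 * sin B" .
  moreover have "\<bar>x - y\<bar> \<le> pi * \<bar>sin A\<bar>"
  proof -
    have "2 * \<bar>A\<bar> / pi \<le> sin \<bar>A\<bar>" by (rule jordan_sin) (use x y in \<open>auto simp: A_def\<close>)
    also have "\<dots> \<le> \<bar>sin A\<bar>" by (cases "A \<ge> 0") auto
    finally have "2 * \<bar>A\<bar> \<le> pi * \<bar>sin A\<bar>" by (simp add: field_simps)
    then show ?thesis by (simp add: A_def abs_minus_commute)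
  qed
  ultimately have "sin y * \<bar>x - y\<bar> \<le> (2 * sin B) * (pi * \<bar>sin A\<bar>)"
    using sB by (intro mult_mono) auto
  also have "\<dots> = pi * \<bar>2 * sin B * sin A\<bar>" using sB by (simp add: abs_mult)
  also have "2 * sin B * sin A = cos x - cos y"
    unfolding cos_diff_cos[of x y] by (simp add: A_def B_def add.commute)
  finally show ?thesis .
qed

lemma affine_diff: "(r * c + m) - (r * d + m) = r * (c - d)" for r :: real
  by (simp add: algebra_simps)

lemma lagrange_u_cos:
  assumes "a < b"
  shows "lagrange_u a b q k ((b - a) / 2 * cos x + (a + b) / 2) =
    (\<Prod>l\<in>{..<q} - {k}. (cos x - cos (cheb_angle q l)) / (cos (cheb_angle q k) - cos (cheb_angle q l)))"
proof -
  have "(b - a) / 2 \<noteq> 0" using assms by simp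
  then show ?thesis
    unfolding lagrange_u_def cheb_node_def cheb_angle_def affine_diff
    by (intro prod.cong refl) (rule mult_divide_mult_cancel_left)
qed

text \<open>
  \<open>|u\<^sub>k(cos x)| = |cos (q x)| sin y / (q |cos x - cos y|)\<close> for the node angle \<open>y\<close>. The denominator of \<open>u\<^sub>k\<close> is found by
  differentiating the factorisation of \<open>cos (q z)\<close> at \<open>z = y\<close>. The inequality is stated in a form that is
  meaningful also at \<open>x = y\<close>.
\<close>
lemma abs_lagrange_u_times:
  assumes "a < b" "k < q" and x: "0 \<le> x" "x \<le> pi"
  shows "\<bar>lagrange_u a b q k ((b - a) / 2 * cos x + (a + b) / 2)\<bar> * (real q * \<bar>x - cheb_angle q k\<bar>)
           \<le> pi * \<bar>cos (real q * x)\<bar>"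
proof -
  define y where "y = cheb_angle q k"
  define Q where "Q = (\<Prod>l\<in>{..<q} - {k}. [:- cos (cheb_angle q l), 1:])"
  have y: "0 < y" "y < pi" using cheb_angle_bounds[OF assms(2)] by (auto simp: y_def)
  have Q: "poly Q c = (\<Prod>l\<in>{..<q} - {k}. c - cos (cheb_angle q l))" for c by (simp add: Q_def poly_prod)
  have fact: "(cos z - cos y) * poly Q (cos z) = cos (real q * z) / 2 ^ (q - 1)" for z
  proof -
    have "(\<Prod>l<q. cos z - cos (cheb_angle q l)) = (cos z - cos y) * poly Q (cos z)"
      unfolding Q y_def using assms(2) by (intro prod.remove) auto
    then show ?thesis using prod_cos_cheb_angle[of q z] assms(2) by simp
  qed
  have "((\<lambda>z. (cos z - cos y) * poly Q (cos z)) has_real_derivative - sin y * poly Q (cos y)) (at y)"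
    by (auto intro!: derivative_eq_intros DERIV_chain2[OF poly_DERIV])
  moreover have "((\<lambda>z. cos (real q * z) / 2 ^ (q - 1)) has_real_derivative - (real q * sin (real q * y)) / 2 ^ (q - 1)) (at y)"
    by (auto intro!: derivative_eq_intros)
  ultimately have d: "sin y * poly Q (cos y) = real q * sin (real q * y) / 2 ^ (q - 1)"
    unfolding fact using DERIV_unique by fastforce
  have "\<bar>sin (real q * y)\<bar> = 1"
  proof -
    have "(sin (real q * y))\<^sup>2 = 1" using sin_cos_squared_add[of "real q * y"] cos_cheb_angle[OF assms(2)] by (simp add: y_def)
    then show ?thesis by (auto simp: power2_eq_1_iff)
  qed
  then have d': "sin y * \<bar>poly Q (cos y)\<bar> = real q / 2 ^ (q - 1)"
    using arg_cong[OF d, of abs] sin_gt_zero[OF y] by (simp add: abs_mult)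
  have Qy: "poly Q (cos y) \<noteq> 0" using d' assms(2) by auto
  have u: "lagrange_u a b q k ((b - a) / 2 * cos x + (a + b) / 2) = poly Q (cos x) / poly Q (cos y)"
    unfolding lagrange_u_cos[OF assms(1)] Q prod_dividef y_def ..
  have "\<bar>poly Q (cos x)\<bar> * (sin y * \<bar>x - y\<bar>) \<le> \<bar>poly Q (cos x)\<bar> * (pi * \<bar>cos x - cos y\<bar>)"
    using cos_node_difference[OF x y] by (intro mult_left_mono) auto
  also have "\<dots> = pi * \<bar>(cos x - cos y) * poly Q (cos x)\<bar>" by (simp add: abs_mult)
  also have "\<dots> = pi * \<bar>cos (real q * x)\<bar> / 2 ^ (q - 1)" unfolding fact by simp
  finally have "\<bar>poly Q (cos x)\<bar> * (sin y * \<bar>x - y\<bar>) * 2 ^ (q - 1) \<le> pi * \<bar>cos (real q * x)\<bar>"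
    by (simp add: field_simps)
  moreover have "\<bar>poly Q (cos x)\<bar> * (sin y * \<bar>x - y\<bar>) * 2 ^ (q - 1) = \<bar>poly Q (cos x) / poly Q (cos y)\<bar> * (real q * \<bar>x - y\<bar>)"
  proof -
    have "real q = sin y * \<bar>poly Q (cos y)\<bar> * 2 ^ (q - 1)" using d' by simp
    then show ?thesis using Qy by (simp add: abs_mult)
  qed
  ultimately show ?thesis unfolding u y_def by simp
qed

text \<open>
  The first bound, for nodes near \<open>x\<close>, uses that \<open>cos (q x)\<close> vanishes at the node angle and is \<open>q\<close>-Lipschitz; the
  second one, for the other nodes, only uses \<open>|cos (q x)| \<le> 1\<close>.
\<close>
lemma lagrange_u_bounds:
  assumes "a < b" "k < q" and x: "0 \<le> x" "x \<le> pi"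
  defines "u \<equiv> \<bar>lagrange_u a b q k ((b - a) / 2 * cos x + (a + b) / 2)\<bar>"
  shows "u \<le> pi" "u * (real q * \<bar>x - cheb_angle q k\<bar>) \<le> pi"
proof -
  let ?y = "cheb_angle q k"
  note b = abs_lagrange_u_times[OF assms(1-4), folded u_def]
  also have "pi * \<bar>cos (real q * x)\<bar> \<le> pi" using mult_left_mono[OF abs_cos_le_one, of pi] by simp
  finally show "u * (real q * \<bar>x - ?y\<bar>) \<le> pi" .
  show "u \<le> pi"
  proof (cases "x = ?y")
    case True
    have "lagrange_u a b q k ((b - a) / 2 * cos x + (a + b) / 2) = lagrange_basis {..<q} (\<lambda>l. cos (cheb_angle q l)) k (cos (cheb_angle q k))"
      unfolding lagrange_u_cos[OF assms(1)] lagrange_basis_def True ..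
    also have "\<dots> = 1" using lagrange_basis_node[OF _ inj_cos_cheb_angle, of q k k] assms(2) by simp
    finally show ?thesis using pi_gt3 by (simp add: u_def)
  next
    case False
    then have pos: "0 < real q * \<bar>x - ?y\<bar>" using assms(2) by simp
    have "\<bar>cos (real q * x)\<bar> = \<bar>cos (real q * x) - cos (real q * ?y)\<bar>" using cos_cheb_angle[OF assms(2)] by simp
    also have "\<dots> \<le> \<bar>real q * x - real q * ?y\<bar>"
    proof -
      have "cos (real q * x) - cos (real q * ?y) = 2 * sin ((real q * x + real q * ?y) / 2) * sin ((real q * ?y - real q * x) / 2)"
        by (rule cos_diff_cos)
      then have "\<bar>cos (real q * x) - cos (real q * ?y)\<bar> = 2 * (\<bar>sin ((real q * x + real q * ?y) / 2)\<bar> * \<bar>sin ((real q * ?y - real q * x) / 2)\<bar>)"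
        by (simp add: abs_mult)
      also have "\<dots> \<le> 2 * (1 * \<bar>(real q * ?y - real q * x) / 2\<bar>)"
        by (intro mult_left_mono mult_mono abs_sin_le_one abs_sin_x_le_abs_x) auto
      finally show ?thesis by simp
    qed
    also have "\<dots> = real q * \<bar>x - ?y\<bar>" by (simp add: abs_mult flip: right_diff_distrib)
    finally have "pi * \<bar>cos (real q * x)\<bar> \<le> pi * (real q * \<bar>x - ?y\<bar>)" by (intro mult_left_mono) auto
    with abs_lagrange_u_times[OF assms(1-4), folded u_def]
    have "u * (real q * \<bar>x - ?y\<bar>) \<le> pi * (real q * \<bar>x - ?y\<bar>)" by linarith
    then show ?thesis using pos by (rule mult_right_le_imp_le)
  qed
qed

lemma sum_inverse_distance_le:
  assumes "finite A" "inj_on g A" "g ` A \<subseteq> {1..q}" "\<And>k. k \<in> A \<Longrightarrow> f k \<le> 1 / real (g k)"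
  shows "sum f A \<le> harm q"
proof -
  have "sum f A \<le> (\<Sum>k\<in>A. 1 / real (g k))" by (rule sum_mono) (rule assms(4))
  also have "\<dots> = (\<Sum>d\<in>g ` A. 1 / real d)" by (simp add: sum.reindex[OF assms(2)])
  also have "\<dots> \<le> (\<Sum>d\<in>{1..q}. 1 / real d)" by (rule sum_mono2) (use assms(3) in auto)
  finally show ?thesis by (simp add: harm_def inverse_eq_divide)
qed

lemma harm_le_ln: "q \<ge> 1 \<Longrightarrow> harm q \<le> 1 + ln (real q)"
  using euler_mascheroni_sequence_decreasing[of 1 q] by (simp add: harm_def)

lemma cheb_param:
  assumes "a < b" "t \<in> {a..b}"
  obtains x where "0 \<le> x" "x \<le> pi" "t = (b - a) / 2 * cos x + (a + b) / 2"
proof -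
  define c where "c = (t - (a + b) / 2) / ((b - a) / 2)"
  have c: "-1 \<le> c" "c \<le> 1" using assms by (auto simp: c_def field_simps)
  have "(b - a) / 2 * c = t - (a + b) / 2" 
  proof -
    have "(b - a) / 2 \<noteq> 0" using assms(1) by simp
    then show ?thesis unfolding c_def by (rule nonzero_mult_div_cancel_left[of _ "t - (a + b) / 2", unfolded times_divide_eq_right[symmetric]])
  qed
  then have "t = (b - a) / 2 * c + (a + b) / 2" by linarith
  then show thesis using that[of "arccos c"] arccos_bounded[of c] c by (simp add: cos_arccos)
qed

text \<open>
  In the variable \<open>y = q x/\<pi> - 1/2\<close> the node angles correspond to the integers \<open>0, \<dots>, q - 1\<close>, and \<open>|u\<^sub>k| \<le> min \<pi> (1/|y - k|)\<close>.
  The two integers next to \<open>y\<close> contribute at most \<open>2 \<pi>\<close>, and the integers on either side of them at most a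
  harmonic sum.
\<close>
lemma lebesgue_constant:
  assumes "a < b" "t \<in> {a..b}" "q \<ge> 1"
  shows "(\<Sum>k<q. \<bar>lagrange_u a b q k t\<bar>) \<le> 2 * pi + 2 * (1 + ln (real q))"
proof -
  obtain x where x: "0 \<le> x" "x \<le> pi" and t: "t = (b - a) / 2 * cos x + (a + b) / 2"
    using cheb_param[OF assms(1,2)] .
  define y where "y = real q * x / pi - 1/2"
  define J where "J = \<lfloor>y\<rfloor>"
  let ?u = "\<lambda>k. \<bar>lagrange_u a b q k t\<bar>"
  have u1: "?u k \<le> pi" if "k < q" for k
    unfolding t by (rule lagrange_u_bounds(1)[OF assms(1) that x])
  have u2: "?u k * \<bar>y - real k\<bar> \<le> 1" if "k < q" for k
  proof -
    have "real q * (x - cheb_angle q k) = pi * (y - real k)"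
      using assms(3) by (simp add: cheb_angle_def y_def field_simps)
    then have "real q * \<bar>x - cheb_angle q k\<bar> = pi * \<bar>y - real k\<bar>"
      by (metis abs_mult abs_of_nat abs_of_pos pi_gt_zero)
    with lagrange_u_bounds(2)[OF assms(1) that x] have "pi * (?u k * \<bar>y - real k\<bar>) \<le> pi * 1"
      unfolding t by (simp add: mult_ac)
    then show ?thesis by (rule mult_left_le_imp_le) simp
  qed
  have y: "y \<le> real q - 1/2" "-1/2 \<le> y"
    using x assms(3) by (auto simp: y_def divide_le_eq mult_left_mono)
  have J: "of_int J \<le> y" "y < of_int J + 1" by (auto simp: J_def)
  have Jq: "J < int q" "-1 \<le> J" using y J by linarith+
  define A B C where "A = {k\<in>{..<q}. int k < J}" and "B = {k\<in>{..<q}. int k = J \<or> int k = J + 1}"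
    and "C = {k\<in>{..<q}. J + 1 < int k}"
  have small: "?u k \<le> 1 / real d" if "k < q" "0 < d" "real d \<le> \<bar>y - real k\<bar>" for k d
  proof -
    have "?u k * real d \<le> ?u k * \<bar>y - real k\<bar>" using that by (intro mult_left_mono) auto
    also have "\<dots> \<le> 1" by (rule u2[OF that(1)])
    finally show ?thesis using that(2) by (simp add: field_simps)
  qed
  have sA: "sum ?u A \<le> harm q"
  proof (rule sum_inverse_distance_le[where g="\<lambda>k. nat (J - int k)"])
    show "inj_on (\<lambda>k. nat (J - int k)) A" by (auto simp: inj_on_def A_def)
    show "(\<lambda>k. nat (J - int k)) ` A \<subseteq> {1..q}" using Jq by (auto simp: A_def)
    fix k assume k: "k \<in> A"
    then have "real (nat (J - int k)) = of_int J - real k" by (simp add: A_def)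
    also have "\<dots> \<le> \<bar>y - real k\<bar>" using J by linarith
    finally show "?u k \<le> 1 / real (nat (J - int k))" using k by (intro small) (auto simp: A_def)
  qed (simp add: A_def)
  have sC: "sum ?u C \<le> harm q"
  proof (rule sum_inverse_distance_le[where g="\<lambda>k. nat (int k - J - 1)"])
    show "inj_on (\<lambda>k. nat (int k - J - 1)) C" by (auto simp: inj_on_def C_def)
    show "(\<lambda>k. nat (int k - J - 1)) ` C \<subseteq> {1..q}" using Jq by (auto simp: C_def)
    fix k assume k: "k \<in> C"
    then have "real (nat (int k - J - 1)) = real k - of_int J - 1" by (simp add: C_def)
    also have "\<dots> \<le> \<bar>y - real k\<bar>" using J by linarith
    finally show "?u k \<le> 1 / real (nat (int k - J - 1))" using k by (intro small) (auto simp: C_def)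
  qed (simp add: C_def)
  have sB: "sum ?u B \<le> 2 * pi"
  proof -
    have "B \<subseteq> {nat J, nat (J + 1)}" by (auto simp: B_def)
    then have "card B \<le> card {nat J, nat (J + 1)}" by (intro card_mono) auto
    also have "\<dots> \<le> 2" by (simp add: card_insert_if)
    finally have "card B \<le> 2" .
    have "sum ?u B \<le> real (card B) * pi" by (rule sum_bounded_above) (use u1 in \<open>auto simp: B_def\<close>)
    also have "\<dots> \<le> 2 * pi" using \<open>card B \<le> 2\<close> by (intro mult_right_mono) auto
    finally show ?thesis .
  qed
  have "{..<q} = A \<union> (B \<union> C)" by (auto simp: A_def B_def C_def)
  then have "(\<Sum>k<q. ?u k) = sum ?u (A \<union> (B \<union> C))" by simp
  also have "\<dots> = sum ?u A + sum ?u (B \<union> C)" by (rule sum.union_disjoint) (auto simp: A_def B_def C_def)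
  also have "sum ?u (B \<union> C) = sum ?u B + sum ?u C" by (rule sum.union_disjoint) (auto simp: B_def C_def)
  finally have "(\<Sum>k<q. ?u k) = sum ?u A + (sum ?u B + sum ?u C)" .
  then show ?thesis using sA sB sC harm_le_ln[OF assms(3)] by simp
qed

text \<open>
  The \<open>k\<close>-th derivative of \<open>cos (c t + e)\<close> is \<open>c\<^sup>k cos (c t + e + k \<pi>/2)\<close>, of modulus at most 1, and the node polynomial
  is at most \<open>2 ((b - a)/4)\<^sup>q\<close> on \<open>[a, b]\<close> by \<open>prod_cos_cheb_angle\<close>.
\<close>
lemma cheb_interp_cos_error:
  assumes "a < b" "t \<in> {a..b}" "q \<ge> 1" "\<bar>c\<bar> \<le> 1"
  shows "\<bar>cos (c * t + e) - (\<Sum>k<q. cos (c * cheb_node a b q k + e) * lagrange_u a b q k t)\<bar>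
     \<le> 2 * ((b - a) / 4) ^ q / fact q"
proof -
  obtain x where x: "0 \<le> x" "x \<le> pi" and t: "t = (b - a) / 2 * cos x + (a + b) / 2"
    using cheb_param[OF assms(1,2)] .
  have node: "cheb_node a b q k = (b - a) / 2 * cos (cheb_angle q k) + (a + b) / 2" for k
    by (simp add: cheb_node_def cheb_angle_def)
  define d where "d = (\<lambda>k y. c ^ k * cos (c * y + e + real k * (pi / 2)))"
  have "(d k has_real_derivative d (Suc k) y) (at y)" for k y
  proof -
    have "cos (c * y + e + real (Suc k) * (pi / 2)) = cos (c * y + e + real k * (pi / 2) + pi / 2)"
      by (simp add: field_simps)
    also have "\<dots> = - sin (c * y + e + real k * (pi / 2))" by (simp add: cos_add)
    finally show ?thesis unfolding d_def by (auto intro!: derivative_eq_intros)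
  qed
  moreover have "inj_on (cheb_node a b q) {..<q}"
    using inj_cos_cheb_angle[of q] assms(1) by (auto simp: inj_on_def node)
  ultimately obtain \<xi> where \<xi>: "d 0 t - (\<Sum>k<q. d 0 (cheb_node a b q k) * lagrange_basis {..<q} (cheb_node a b q) k t)
      = d q \<xi> / fact q * (\<Prod>k<q. t - cheb_node a b q k)"
    using lagrange_error[of d "cheb_node a b q" q t] assms(3) by blast
  have "(\<Prod>k<q. t - cheb_node a b q k) = (\<Prod>k<q. (b - a) / 2 * (cos x - cos (cheb_angle q k)))"
    unfolding t node affine_diff ..
  also have "\<dots> = ((b - a) / 2) ^ q * (cos (real q * x) / 2 ^ (q - 1))"
    unfolding prod.distrib prod_cos_cheb_angle[OF assms(3)] by simp
  finally have W: "(\<Prod>k<q. t - cheb_node a b q k) = ((b - a) / 2) ^ q * (cos (real q * x) / 2 ^ (q - 1))" .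
  have "\<bar>d q \<xi>\<bar> \<le> 1"
  proof -
    have "\<bar>c\<bar> ^ q * \<bar>cos (c * \<xi> + e + real q * (pi / 2))\<bar> \<le> 1 * 1"
      using assms(4) by (intro mult_mono power_le_one) auto
    then show ?thesis by (simp add: d_def abs_mult power_abs)
  qed
  moreover have "\<bar>((b - a) / 2) ^ q * (cos (real q * x) / 2 ^ (q - 1))\<bar> \<le> 2 * ((b - a) / 4) ^ q"
  proof -
    have "((b - a) / 2) ^ q * (\<bar>cos (real q * x)\<bar> / 2 ^ (q - 1)) \<le> ((b - a) / 2) ^ q * (1 / 2 ^ (q - 1))"
      using assms(1) by (intro mult_left_mono divide_right_mono) auto
    also have "\<dots> = 2 * ((b - a) / 4) ^ q"
    proof -
      have "(2::real) ^ q = 2 * 2 ^ (q - 1)" using assms(3) by (cases q) auto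
      moreover have "((b - a) / 4) ^ q = ((b - a) / 2) ^ q / 2 ^ q"
        unfolding power_divide[symmetric] by simp
      ultimately show ?thesis by simp
    qed
    finally show ?thesis using assms(1) by (simp add: abs_mult power_abs)
  qed
  ultimately have "\<bar>d q \<xi>\<bar> * \<bar>((b - a) / 2) ^ q * (cos (real q * x) / 2 ^ (q - 1))\<bar> / fact q \<le> 1 * (2 * ((b - a) / 4) ^ q) / fact q"
    by (intro divide_right_mono mult_mono) auto
  then have "\<bar>d 0 t - (\<Sum>k<q. d 0 (cheb_node a b q k) * lagrange_basis {..<q} (cheb_node a b q) k t)\<bar> \<le> 2 * ((b - a) / 4) ^ q / fact q"
    unfolding \<xi> W by (simp add: abs_mult mult_ac)
  then show ?thesis by (simp add: d_def lagrange_basis_def lagrange_u_def)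
qed

text \<open>
  Rotating the error to a nonnegative real number turns it into the interpolation error of a single
  cosine, so passing to the complex exponential costs no factor.
\<close>
lemma cheb_interp_exp_error:
  assumes "a < b" "t \<in> {a..b}" "q \<ge> 1" "\<bar>c\<bar> \<le> 1"
  shows "cmod (wave (c * t) - (\<Sum>k<q. of_real (lagrange_u a b q k t) * wave (c * cheb_node a b q k)))
     \<le> 2 * ((b - a) / 4) ^ q / fact q"
proof -
  define w where "w = wave (c * t) - (\<Sum>k<q. of_real (lagrange_u a b q k t) * wave (c * cheb_node a b q k))"
  define e where "e = Arg w"
  have Re_rot: "Re (exp (\<i> * of_real r * - 1) * cis (- e)) = cos (r + e)" for r
  proof -
    have "exp (\<i> * of_real r * - 1) * cis (- e) = cis (- (r + e))"
      unfolding cis_conv_exp exp_add[symmetric] by (simp add: algebra_simps)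
    also have "Re \<dots> = cos (r + e)" unfolding cis.simps by (rule cos_minus)
    finally show ?thesis .
  qed
  have "cmod w = Re (of_real (cmod w))" by simp
  also have "of_real (cmod w) = w * cis (- e)"
  proof -
    have "w = of_real (cmod w) * cis e" using rcis_cmod_Arg[of w] by (simp add: rcis_def e_def)
    then have "w * cis (- e) = of_real (cmod w) * (cis e * cis (- e))" by (metis mult.assoc)
    then show ?thesis by (simp add: cis_mult)
  qed
  also have "w * cis (- e) = exp (\<i> * of_real (c * t) * - 1) * cis (- e) -
      (\<Sum>k<q. of_real (lagrange_u a b q k t) * (exp (\<i> * of_real (c * cheb_node a b q k) * - 1) * cis (- e)))"
    unfolding w_def by (simp add: left_diff_distrib sum_distrib_right mult.assoc)
  also have "Re \<dots> = cos (c * t + e) - (\<Sum>k<q. lagrange_u a b q k t * cos (c * cheb_node a b q k + e))"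
    unfolding minus_complex.simps Re_sum Re_rot times_complex.simps(1)[of "of_real _"] by (simp add: Re_rot del: times_complex.simps)
  finally have "cmod w = \<dots>" .
  also have "\<dots> \<le> \<bar>cos (c * t + e) - (\<Sum>k<q. cos (c * cheb_node a b q k + e) * lagrange_u a b q k t)\<bar>"
    by (simp add: mult.commute)
  also have "\<dots> \<le> 2 * ((b - a) / 4) ^ q / fact q" by (rule cheb_interp_cos_error[OF assms])
  finally show ?thesis unfolding w_def .
qed

section \<open>The discretised kernel\<close>

lemma exp_1_bounds: "1359 / 500 \<le> exp (1::real)" "exp (1::real) \<le> 27183 / 10000"
proof -
  have "exp 1 - 5837465777 / 2147483648 \<le> inverse (2 ^ 32 :: real)"
    "- (exp 1 - 5837465777 / 2147483648) \<le> inverse (2 ^ 32 :: real)"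
    using e_approx_32 unfolding abs_le_iff by blast+
  moreover have "inverse (2 ^ 32 :: real) \<le> 1 / 1000000" by simp
  ultimately show "1359 / 500 \<le> exp (1::real)" "exp (1::real) \<le> 27183 / 10000" by linarith+
qed

lemma exp_4_bounds: "160 / 3 \<le> exp (4::real)" "exp (4::real) \<le> 64"
proof -
  note e = exp_1_bounds
  have eq: "exp (4::real) = exp 1 ^ 4" by (simp flip: exp_of_nat_mult)
  have "(1359 / 500::real) ^ 4 \<le> exp 1 ^ 4" using e by (intro power_mono) auto
  then show "160 / 3 \<le> exp (4::real)" unfolding eq by (rule order_trans[rotated]) (simp add: power_numeral_reduce)
  have "exp (1::real) ^ 4 \<le> (27183 / 10000) ^ 4" using e by (intro power_mono) auto
  then show "exp (4::real) \<le> 64" unfolding eq by (rule order_trans) (simp add: power_numeral_reduce)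
qed

lemma exp_minus_11_16: "0.502 \<le> exp (- 11 / 16 :: real)"
proof -
  have "exp (1::real) ^ 11 \<le> (27183 / 10000) ^ 11" by (intro power_mono exp_1_bounds) auto
  also have "\<dots> \<le> (1 / 0.502) ^ 16" by (simp add: power_numeral_reduce)
  also have "exp (1::real) ^ 11 = exp (11 / 16) ^ 16" by (simp flip: exp_of_nat_mult)
  finally have "exp (11 / 16 :: real) \<le> 1 / 0.502"
    by (rule power_mono_iff[THEN iffD1, rotated -1]) (simp_all only: exp_ge_zero zero_less_numeral, simp)
  then have "1 / (1 / 0.502) \<le> 1 / exp (11 / 16 :: real)" by (intro divide_left_mono) auto
  moreover have "exp (- 11 / 16 :: real) = 1 / exp (11 / 16)"
    unfolding minus_divide_left[symmetric] exp_minus inverse_eq_divide ..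
  moreover have "1 / (1 / 0.502) = (0.502 :: real)" by simp
  ultimately show ?thesis by (simp only:)
qed

text \<open>
  It rests on \<open>q\<^sup>q / q! \<le> e\<^sup>q\<close>, where the left-hand side is one term of the exponential series at \<open>q\<close>.
\<close>
lemma power_div_fact_le:
  fixes y :: real
  assumes "0 \<le> y" "q \<ge> 1"
  shows "y ^ q / fact q \<le> (exp 1 * y / real q) ^ q"
proof -
  have "real q ^ q / fact q \<le> exp (real q)"
  proof -
    have "(\<Sum>n\<in>{q}. real q ^ n /\<^sub>R fact n) \<le> (\<Sum>n. real q ^ n /\<^sub>R fact n)"
      by (rule sum_le_suminf) (use summable_exp_generic[of "real q"] in auto)
    then show ?thesis unfolding exp_def by (simp add: divide_inverse mult.commute)
  qed
  then have "real q ^ q / fact q * (y / real q) ^ q \<le> exp (real q) * (y / real q) ^ q"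
    using assms by (intro mult_right_mono) auto
  also have "exp (real q) = exp 1 ^ q" by (simp flip: exp_of_nat_mult)
  also have "exp 1 ^ q * (y / real q) ^ q = (exp 1 * y / real q) ^ q" by (simp flip: power_mult_distrib)
  also have "real q ^ q / fact q * (y / real q) ^ q = y ^ q / fact q"
    using assms by (simp add: power_divide)
  finally show ?thesis .
qed

text \<open>
  With \<open>q \<ge> 2.4 l\<close>, \<open>2 \<le> a\<close> and \<open>b \<le> 1.7725 l\<close>, where \<open>1.7725\<close> exceeds the square root of \<open>\<pi>\<close>, the base of the power in
  \<open>power_div_fact_le\<close> is at most \<open>0.502 (1 - 9/(8 l))\<close>. Its power \<open>q\<close> is then at most \<open>e\<^bsup>-1.65l-2.7\<^esup>\<close>, and the
  surplus \<open>0.65 l \<ge> 1.3\<close> yields the factor \<open>e\<^sup>-\<^sup>4\<close>. The summand \<open>2.7\<close> comes from \<open>a \<ge> 2\<close>, that is, from the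
  absence of small roots.
\<close>
lemma interpolation_error_small:
  fixes l a b :: real
  assumes l: "2 \<le> l" and ab: "2 \<le> a" "a < b" "b \<le> 1.7725 * l" and q: "2.4 * l \<le> real q"
  shows "2 * ((b - a) / 4) ^ q / fact q \<le> 2 * exp (- 4) * exp (- l)"
proof -
  have q1: "q \<ge> 1" using q l by (cases q) auto
  let ?y = "(b - a) / 4"
  have "exp 1 * ?y / real q \<le> (27183 / 10000) * ((1.7725 * l - 2) / 4) / (2.4 * l)"
    using ab l q exp_1_bounds by (intro frac_le mult_mono) auto
  also have "\<dots> \<le> 0.502 * (1 - 9 / (8 * l))" using l by (simp add: field_simps)
  also have "\<dots> \<le> exp (- 11 / 16) * exp (- (9 / (8 * l)))"
    using exp_ge_add_one_self[of "- (9 / (8 * l))"] exp_minus_11_16 l by (intro mult_mono) auto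
  also have "\<dots> = exp (- (11 / 16 + 9 / (8 * l)))" by (simp flip: exp_add)
  finally have "(exp 1 * ?y / real q) ^ q \<le> exp (- (11 / 16 + 9 / (8 * l))) ^ q"
    using ab by (intro power_mono) auto
  also have "\<dots> = exp (- (real q * (11 / 16 + 9 / (8 * l))))"
    unfolding exp_of_nat_mult[symmetric] mult_minus_right ..
  also have "\<dots> \<le> exp (- 4 - l)"
  proof -
    have "4 + l \<le> (2.4 * l) * (11 / 16 + 9 / (8 * l))" using l by (simp add: field_simps)
    also have "\<dots> \<le> real q * (11 / 16 + 9 / (8 * l))" using q l by (intro mult_right_mono) auto
    finally show ?thesis by simp
  qed
  also have "exp (- 4 - l) = exp (- 4) * exp (- l)" unfolding exp_add[symmetric] by simp
  finally have "(exp 1 * ?y / real q) ^ q \<le> exp (- 4) * exp (- l)" .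
  moreover have "?y ^ q / fact q \<le> (exp 1 * ?y / real q) ^ q" by (rule power_div_fact_le) (use ab q1 in simp_all)
  ultimately show ?thesis by simp
qed

text \<open>
  Here \<open>\<nu> = s - |n| \<ge> 5.3175 l\<close> and \<open>4 \<ge> e\<^bsup>4/3\<^esup>\<close>, so \<open>4\<^sup>-\<^sup>\<nu>\<close> is at most \<open>e\<^bsup>-7.09l\<^esup>\<close>, which outweighs
  \<open>e\<^bsup>17z/8\<^esup>\<close> with \<open>z \<le> 1.7725 l\<close>.
\<close>
lemma quadrature_error_small:
  fixes l z :: real
  assumes l: "2 \<le> l" and z: "z \<le> 1.7725 * l" and n: "real_of_int \<bar>n\<bar> \<le> 1.7725 * l"
    and s: "7.09 * l \<le> real s"
  shows "2 * exp (17 * z / 8) / 4 ^ nat (int s - \<bar>n\<bar>) \<le> 2 * exp (- 4) * exp (- l)" "\<bar>n\<bar> < int s"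
proof -
  have "real_of_int \<bar>n\<bar> < real_of_int (int s)" using n s l by simp
  then show lt: "\<bar>n\<bar> < int s" by (simp only: of_int_less_iff)
  define \<nu> where "\<nu> = nat (int s - \<bar>n\<bar>)"
  have "real \<nu> = real s - real_of_int \<bar>n\<bar>" using lt by (simp add: \<nu>_def)
  then have \<nu>: "5.3175 * l \<le> real \<nu>" using n s by simp
  have "exp (4 / 3 :: real) ^ 3 \<le> 4 ^ 3" using exp_4_bounds(2) by (simp flip: exp_of_nat_mult)
  then have "exp (4 / 3 :: real) \<le> 4" by (rule power_mono_iff[THEN iffD1, rotated -1]) (simp_all only: exp_ge_zero zero_less_numeral zero_le_numeral)
  then have "exp (4 / 3 :: real) ^ \<nu> \<le> 4 ^ \<nu>" by (intro power_mono) auto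
  then have "exp (real \<nu> * (4 / 3)) \<le> 4 ^ \<nu>" by (simp only: exp_of_nat_mult)
  then have "exp (17 * z / 8) / 4 ^ \<nu> \<le> exp (17 * z / 8) / exp (real \<nu> * (4 / 3))"
    by (intro divide_left_mono) auto
  also have "\<dots> = exp (17 * z / 8 - real \<nu> * (4 / 3))" by (simp add: exp_diff)
  also have "\<dots> \<le> exp (- 4 - l)" using \<nu> z l by simp
  also have "\<dots> = exp (- 4) * exp (- l)" unfolding exp_add[symmetric] by simp
  finally show "2 * exp (17 * z / 8) / 4 ^ nat (int s - \<bar>n\<bar>) \<le> 2 * exp (- 4) * exp (- l)"
    unfolding \<nu>_def by simp
qed

text \<open>
  The result of applying the angular quadrature and the radial interpolation to the mode
  \<open>J\<^sub>n(\<mu> |x|) e\<^bsup>-in\<theta>\<^esup>\<close>. With exact subroutines Algorithm I would compute \<open>c\<^sub>i h \<Sum>\<^sub>j f\<^sub>j K\<^sub>i(x\<^sub>j)\<close> with these kernels, and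
  Algorithm II the adjoint sum \<open>\<Sum>\<^sub>i c\<^sub>i h \<alpha>\<^sub>i cnj (K\<^sub>i(x\<^sub>j))\<close>.
\<close>
definition disk_kernel :: "real \<Rightarrow> real \<Rightarrow> nat \<Rightarrow> nat \<Rightarrow> int \<Rightarrow> real \<Rightarrow> complex \<Rightarrow> complex" where
  "disk_kernel a b q s n \<mu> x = (\<Sum>k<q. of_real (lagrange_u a b q k \<mu>) *
     (\<i> powi n / of_nat s * (\<Sum>l<s. wave (x \<bullet> freq_node a b q s (k, l)) * wave (of_int n * angle s l))))"

lemma inner_freq_node:
  "x \<bullet> freq_node a b q s (k, l) = (cmod x * cos (Arg x - angle s l)) * cheb_node a b q k"
proof -
  have "x = rcis (cmod x) (Arg x)" by (simp add: rcis_cmod_Arg)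
  then have "Re x = cmod x * cos (Arg x)" "Im x = cmod x * sin (Arg x)" by (metis Re_rcis) (metis Im_rcis \<open>x = _\<close>)
  then show ?thesis by (simp add: inner_complex_def freq_node_def cos_diff algebra_simps)
qed

lemma norm_i_powi [simp]: "cmod (\<i> powi n) = 1"
  by (simp add: norm_power_int)

lemma norm_exp_i_real: "cmod (exp (- \<i> * of_real v)) = 1"
  by simp

text \<open>
  The radial interpolation is removed first, for each angle separately and at unit weight; what remains is the
  angular quadrature at the exact frequency \<open>\<mu>\<close>.
\<close>
lemma disk_kernel_error:
  assumes l: "2 \<le> l" and ab: "2 \<le> a" "a < b" "b \<le> 1.7725 * l" and q: "2.4 * l \<le> real q"
    and n: "real_of_int \<bar>n\<bar> \<le> 1.7725 * l" and s: "7.09 * l \<le> real s"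
    and \<mu>: "\<mu> \<in> {a..b}" and x: "cmod x \<le> 1" and eps: "exp (- l) \<le> \<epsilon>"
  shows "cmod (disk_kernel a b q s n \<mu> x - of_real (bessel_J n (\<mu> * cmod x)) * wave (of_int n * Arg x))
     \<le> 3 / 40 * \<epsilon>"
proof -
  define c where "c = (\<lambda>l. cmod x * cos (Arg x - angle s l))"
  define I where "I = \<i> powi n / of_nat s * (\<Sum>l<s. wave (\<mu> * cmod x * cos (Arg x - angle s l)) * wave (of_int n * angle s l))"
  define e1 where "e1 = (2 * exp (- 4) * exp (- l) :: real)"
  have q1: "q \<ge> 1" using q l by (cases q) auto
  have s1: "s \<ge> 1" using s l by (cases s) auto
  have c1: "\<bar>c l\<bar> \<le> 1" for l
  proof -
    have "\<bar>c l\<bar> \<le> 1 * 1" unfolding c_def abs_mult using x by (intro mult_mono) auto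
    then show ?thesis by simp
  qed
  let ?E = "\<lambda>l. wave (of_int n * angle s l)"
  let ?w = "\<lambda>k l. of_real (lagrange_u a b q k \<mu>) * wave (c l * cheb_node a b q k)"
  let ?D = "\<lambda>l. wave (c l * \<mu>) - (\<Sum>k<q. ?w k l)"
  have K: "disk_kernel a b q s n \<mu> x = \<i> powi n / of_nat s * (\<Sum>l<s. (\<Sum>k<q. ?w k l) * ?E l)"
  proof -
    have "disk_kernel a b q s n \<mu> x = (\<Sum>k<q. \<Sum>l<s. \<i> powi n / of_nat s * (?w k l * ?E l))"
      unfolding disk_kernel_def inner_freq_node c_def sum_distrib_left by (simp only: mult_ac)
    also have "\<dots> = (\<Sum>l<s. \<Sum>k<q. \<i> powi n / of_nat s * (?w k l * ?E l))"
      by (rule sum.swap)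
    also have "\<dots> = \<i> powi n / of_nat s * (\<Sum>l<s. (\<Sum>k<q. ?w k l) * ?E l)"
      by (simp only: sum_distrib_left sum_distrib_right)
    finally show ?thesis .
  qed
  have I: "I = \<i> powi n / of_nat s * (\<Sum>l<s. wave (c l * \<mu>) * ?E l)"
    unfolding I_def c_def by (simp only: mult_ac)
  have "cmod (I - disk_kernel a b q s n \<mu> x) = 1 / real s * cmod (\<Sum>l<s. ?D l * ?E l)"
    unfolding I K right_diff_distrib[symmetric] sum_subtractf[symmetric] left_diff_distrib[symmetric]
    by (simp add: norm_mult norm_divide)
  also have "\<dots> \<le> 1 / real s * (\<Sum>l<s. e1)"
  proof (intro mult_left_mono sum_norm_le)
    fix l
    have "cmod (?D l) \<le> 2 * ((b - a) / 4) ^ q / fact q" by (rule cheb_interp_exp_error[OF ab(2) \<mu> q1 c1])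
    also have "\<dots> \<le> e1" unfolding e1_def by (rule interpolation_error_small[OF assms(1-5)])
    finally show "cmod (?D l * ?E l) \<le> e1" unfolding norm_mult norm_exp_i_real by simp
  qed simp
  also have "\<dots> = e1" using s1 by simp
  finally have A: "cmod (disk_kernel a b q s n \<mu> x - I) \<le> e1" by (simp add: norm_minus_commute)
  have "\<mu> * cmod x \<le> \<mu> * 1" using \<mu> ab x by (intro mult_left_mono) auto
  also have "\<dots> \<le> b" using \<mu> by simp
  finally have z: "0 \<le> \<mu> * cmod x" "\<mu> * cmod x \<le> 1.7725 * l" using \<mu> ab by simp_all
  note small = quadrature_error_small[OF l z(2) n s]
  have B: "cmod (I - of_real (bessel_J n (\<mu> * cmod x)) * wave (of_int n * Arg x)) \<le> e1"
    unfolding I_def e1_def by (rule order_trans[OF angular_quadrature_error[OF z(1) small(2)] small(1)])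
  have "cmod (disk_kernel a b q s n \<mu> x - of_real (bessel_J n (\<mu> * cmod x)) * wave (of_int n * Arg x)) \<le> e1 + e1"
    by (rule norm_diff_triangle_le[OF A B])
  also have "\<dots> = 4 / exp 4 * exp (- l)" unfolding e1_def exp_minus divide_inverse by simp
  also have "\<dots> \<le> 3 / 40 * \<epsilon>"
  proof (rule mult_mono)
    show "4 / exp 4 \<le> (3 / 40 :: real)" using exp_4_bounds(1) by (simp add: divide_le_eq)
  qed (use eps in auto)
  finally show ?thesis .
qed

section \<open>Accuracy of the two algorithms\<close>

lemma linf_norm_le:
  assumes "N > 0" "\<And>j. j < N \<Longrightarrow> cmod (v j) \<le> C"
  shows "linf_norm N v \<le> C"
  unfolding linf_norm_def using assms by (intro Max.boundedI) auto

text \<open>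
  The FFT index \<open>n mod s\<close> may be replaced by \<open>n\<close>, because the exponents differ by a multiple of \<open>2 \<pi> i\<close>.
\<close>
lemma exp_angle_mod:
  fixes r n :: int
  assumes "s > 0"
  shows "exp (\<i> * of_real (of_int r * (2 * pi * real l * real (nat (n mod int s)) / real s)))
       = exp (\<i> * of_real (of_int r * (of_int n * angle s l)))"
proof -
  have "of_int n = real s * of_int (n div int s) + of_int (n mod int s)"
    by (metis mult_div_mod_eq of_int_add of_int_mult of_int_of_nat_eq)
  then have *: "of_int r * (2 * pi * real l * real (nat (n mod int s)) / real s)
     = of_int r * (of_int n * angle s l) + 2 * of_int (- (r * int l * (n div int s))) * pi"
    using assms by (simp add: angle_def field_simps)
  have "\<i> * complex_of_real (of_int r * (2 * pi * real l * real (nat (n mod int s)) / real s))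
     = \<i> * of_real (of_int r * (of_int n * angle s l)) + 2 * of_int (- (r * int l * (n div int s))) * of_real pi * \<i>"
    unfolding * of_real_add distrib_left by simp
  moreover have "exp (2 * complex_of_int k * of_real pi * \<i>) = 1" for k
    using exp_integer_2pi[of "real_of_int k"] by (simp add: mult_ac)
  ultimately show ?thesis by (simp only: exp_add mult_1_right)
qed

lemma fft_minus_apply:
  assumes "is_fft (- 1) F" "s > 0"
  shows "fst (F s v) (nat (n mod int s)) = (\<Sum>l<s. v l * wave (of_int n * angle s l))"
proof -
  have "nat (n mod int s) < s" using assms(2) by (simp add: nat_less_iff)
  then have "fst (F s v) (nat (n mod int s)) = (\<Sum>l<s. v l * exp (\<i> * of_real (- 1 * (2 * pi * real l * real (nat (n mod int s)) / real s))))"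
    using assms(1) unfolding is_fft_def by blast
  also have "\<dots> = (\<Sum>l<s. v l * wave (of_int n * angle s l))"
    using exp_angle_mod[OF assms(2), of "-1" _ n]
    by (simp only: of_int_minus of_int_1 mult_minus_left mult_1_left of_real_minus mult_minus_right)
  finally show ?thesis .
qed

lemma fft_plus_apply:
  assumes "is_fft 1 F" "l < s" "finite A"
  shows "fst (F s (\<lambda>r. \<Sum>n | n \<in> A \<and> nat (n mod int s) = r. X n)) l = (\<Sum>n\<in>A. X n * exp (\<i> * of_real (of_int n * angle s l)))"
proof -
  let ?e = "\<lambda>r. exp (\<i> * of_real (1 * (2 * pi * real r * real l / real s)))"
  have e: "?e (nat (n mod int s)) = exp (\<i> * of_real (of_int n * angle s l))" for n
    using exp_angle_mod[of s 1 l n] assms(2) by (simp add: mult_ac)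
  have "fst (F s (\<lambda>r. \<Sum>n | n \<in> A \<and> nat (n mod int s) = r. X n)) l = (\<Sum>r<s. (\<Sum>n | n \<in> A \<and> nat (n mod int s) = r. X n) * ?e r)"
    using assms(1,2) unfolding is_fft_def by blast
  also have "\<dots> = (\<Sum>r<s. \<Sum>n | n \<in> A \<and> nat (n mod int s) = r. X n * ?e (nat (n mod int s)))"
    unfolding sum_distrib_right by (intro sum.cong) auto
  also have "\<dots> = (\<Sum>n\<in>A. X n * ?e (nat (n mod int s)))"
  proof -
    have "(\<lambda>n. nat (n mod int s)) ` A \<subseteq> {..<s}" using assms(2) by (auto simp: nat_less_iff)
    from sum.group[OF assms(3) finite_lessThan this] show ?thesis .
  qed
  finally show ?thesis unfolding e .
qed

lemma nufft_bound:
  assumes "is_nufft \<sigma> F" "finite A" "finite B" "0 < \<delta>" "\<delta> \<le> 1" "b \<in> B"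
  shows "cmod (fst (F \<delta> A y B \<eta> v) b - (\<Sum>a\<in>A. v a * exp (\<i> * complex_of_real (\<sigma> * (y a \<bullet> \<eta> b))))) \<le> \<delta> * (\<Sum>a\<in>A. cmod (v a))"
  by (rule assms(1)[unfolded is_nufft_def, THEN conjunct1, rule_format]) (use assms in auto)

lemma cheb_interp_bound:
  assumes "is_cheb_interp F" "a < b" "finite I" "w ` I \<subseteq> {a..b}" "1 \<le> q" "0 < \<delta>" "\<delta> \<le> 1" "i \<in> I"
  shows "cmod (fst (F \<delta> a b q I w v) i - (\<Sum>k<q. v k * of_real (lagrange_u a b q k (w i)))) \<le> \<delta> * (\<Sum>k<q. cmod (v k))"
  by (rule assms(1)[unfolded is_cheb_interp_def, THEN conjunct1, rule_format]) (use assms in auto)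

lemma cheb_adjoint_bound:
  assumes "is_cheb_adjoint F" "a < b" "finite I" "w ` I \<subseteq> {a..b}" "1 \<le> q" "0 < \<delta>" "\<delta> \<le> 1" "k < q"
  shows "cmod (fst (F \<delta> a b q I w v) k - (\<Sum>i\<in>I. v i * of_real (lagrange_u a b q k (w i)))) \<le> \<delta> * (\<Sum>i\<in>I. cmod (v i))"
  by (rule assms(1)[unfolded is_cheb_adjoint_def, THEN conjunct1, rule_format]) (use assms in auto)

definition admissible :: "nat \<Rightarrow> (nat \<Rightarrow> complex) \<Rightarrow> real \<Rightarrow> nat \<Rightarrow> (nat \<Rightarrow> int \<times> nat) \<Rightarrow> real \<Rightarrow> bool" where
  "admissible L x lam m md \<epsilon> \<longleftrightarrow> disk_setup L x lam m md \<and> 0 < \<epsilon> \<and> \<epsilon> \<le> 1 \<and>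
     lam \<le> sqrt (pi * real (L^2)) \<and> \<bar>ln \<epsilon>\<bar> \<le> sqrt (real (L^2))"

lemma sqrt_pi_le: "sqrt pi \<le> 1.7725"
proof (rule real_le_lsqrt)
  have "pi \<le> 3.1416" using pi_approx by simp
  also have "\<dots> \<le> 1.7725\<^sup>2" by (simp add: power2_eq_square)
  finally show "pi \<le> 1.7725\<^sup>2" .
qed auto

lemma admissible_lam: 
  assumes "admissible L x lam m md \<epsilon>"
  shows "lam \<le> sqrt pi * real L" "lam \<le> 1.7725 * real L"
proof -
  show "lam \<le> sqrt pi * real L" using assms by (simp add: admissible_def real_sqrt_mult)
  also have "\<dots> \<le> 1.7725 * real L" using sqrt_pi_le by (intro mult_right_mono) auto
  finally show "lam \<le> 1.7725 * real L" .
qed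

lemma admissible_eps:
  assumes "admissible L x lam m md \<epsilon>"
  shows "exp (- real L) \<le> \<epsilon>" "\<bar>ln \<epsilon>\<bar> \<le> real L" "0 < \<epsilon>" "\<epsilon> \<le> 1"
proof -
  show e: "\<bar>ln \<epsilon>\<bar> \<le> real L" "0 < \<epsilon>" "\<epsilon> \<le> 1" using assms by (auto simp: admissible_def)
  then have "- real L \<le> ln \<epsilon>" by linarith
  then have "exp (- real L) \<le> exp (ln \<epsilon>)" by (simp only: exp_le_cancel_iff)
  then show "exp (- real L) \<le> \<epsilon>" using e by simp
qed

text \<open>
  The bandlimit is at least the first root, hence at least 2, which excludes \<open>L = 1\<close>. For the factor \<open>c\<^sub>i h\<close>,
  combine \<open>c\<^sub>i \<le> \<lambda>\<^sub>i / \<surd>\<pi> \<le> L\<close> with \<open>h \<le> 2 / L\<close>.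
\<close>
lemma admissible_facts:
  assumes "admissible L x lam m md \<epsilon>"
  defines "t0 \<equiv> mode_root md 0" and "t1 \<equiv> mode_root md (m - 1)"
  shows "2 \<le> L" "2 \<le> t0" "t0 < t1" "t1 \<le> 1.7725 * real L" "m > 0"
    and admissible_mode_mem: "\<And>i. i < m \<Longrightarrow> mode_root md i \<in> {t0..t1}"
    and admissible_order: "\<And>i. i < m \<Longrightarrow> real_of_int \<bar>fst (md i)\<bar> \<le> 1.7725 * real L"
    and admissible_const: "\<And>i. i < m \<Longrightarrow> 0 \<le> mode_const md i * pixel_size L" "\<And>i. i < m \<Longrightarrow> mode_const md i * pixel_size L \<le> 2"
proof -
  have su: "disk_setup L x lam m md" using assms(1) by (simp add: admissible_def)
  note lam = admissible_lam[OF assms(1)]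
  show m: "m > 0" by (rule disk_setup_pos(2)[OF su])
  show "t0 < t1" unfolding t0_def t1_def by (rule disk_setup_interval[OF su])
  show mem: "mode_root md i \<in> {t0..t1}" if "i < m" for i
    unfolding t0_def t1_def by (rule disk_setup_root_mem[OF su that])
  note b = bessel_root_bounds[OF disk_setup_root[OF su]]
  show t0: "2 \<le> t0" unfolding t0_def by (rule b(1)[OF m])
  have le: "mode_root md i \<le> lam" if "i < m" for i by (rule disk_setup_root_le[OF su that])
  show "t1 \<le> 1.7725 * real L" using le[of "m - 1"] lam(2) m unfolding t1_def by linarith
  have "2 \<le> 1.7725 * real L" using t0 le[OF m] lam(2) unfolding t0_def by linarith
  then have "1 < real L" by simp
  then show L: "2 \<le> L" by simp
  show "real_of_int \<bar>fst (md i)\<bar> \<le> 1.7725 * real L" if "i < m" for i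
    using b(2)[OF that] le[OF that] lam(2) by linarith
  have h: "0 \<le> pixel_size L" "pixel_size L \<le> 2 / real L"
  proof -
    have "real L \<le> 2 * real ((L + 1) div 2)" by linarith
    then show "0 \<le> pixel_size L" "pixel_size L \<le> 2 / real L"
      using L unfolding pixel_size_def by (simp_all add: field_simps)
  qed
  fix i assume i: "i < m"
  note c = mode_const_bounds[OF disk_setup_root[OF su i]]
  show "0 \<le> mode_const md i * pixel_size L" using c h by simp
  have "mode_const md i \<le> lam / sqrt pi" 
    using order_trans[OF c(2) divide_right_mono[OF le[OF i], of "sqrt pi"]] by simp
  also have "\<dots> \<le> real L" using lam(1) by (simp add: divide_le_eq mult.commute)
  finally have "mode_const md i * pixel_size L \<le> real L * (2 / real L)"
    using c h by (intro mult_mono) auto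
  then show "mode_const md i * pixel_size L \<le> 2" using L by simp
qed

lemma num_angles_ge: "7.09 * real L \<le> real (num_angles (L\<^sup>2) \<epsilon>)"
  unfolding num_angles_def by (rule order_trans[OF _ real_nat_ceiling_ge]) simp

lemma num_radii_ge: "2.4 * real L \<le> real (num_radii (L\<^sup>2) \<epsilon>)"
  unfolding num_radii_def by (rule order_trans[OF _ real_nat_ceiling_ge]) simp

lemma num_angles_pos: "L > 0 \<Longrightarrow> num_angles (L\<^sup>2) \<epsilon> > 0"
proof -
  assume "L > 0"
  then have "0 < 7.09 * real L" by simp
  then have "0 < real (num_angles (L\<^sup>2) \<epsilon>)" using num_angles_ge by (rule less_le_trans)
  then show ?thesis by simp
qed

lemma num_radii_pos: "L > 0 \<Longrightarrow> num_radii (L\<^sup>2) \<epsilon> > 0"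
proof -
  assume "L > 0"
  then have "0 < 2.4 * real L" by simp
  then have "0 < real (num_radii (L\<^sup>2) \<epsilon>)" using num_radii_ge by (rule less_le_trans)
  then show ?thesis by simp
qed

lemma mode_kernel_error:
  assumes adm: "admissible L x lam m md \<epsilon>" and i: "i < m" and z: "cmod z < 1"
  defines "K \<equiv> disk_kernel (mode_root md 0) (mode_root md (m - 1)) (num_radii (L\<^sup>2) \<epsilon>) (num_angles (L\<^sup>2) \<epsilon>) (fst (md i)) (mode_root md i) z"
  obtains g where "cnj (psi_at md i z) = of_real (mode_const md i) * g"
    and "cmod (K - g) \<le> 3 / 40 * \<epsilon>"
proof
  let ?n = "fst (md i)" and ?\<mu> = "mode_root md i"
  let ?g = "of_real (bessel_J ?n (?\<mu> * cmod z)) * wave (of_int ?n * Arg z)"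
  show "cnj (psi_at md i z) = of_real (mode_const md i) * ?g"
    using z by (simp add: psi_at_def psi_def exp_cnj mult.assoc)
  have "2 \<le> real L" using admissible_facts(1)[OF adm] by simp
  then show "cmod (K - ?g) \<le> 3 / 40 * \<epsilon>" unfolding K_def
    by (rule disk_kernel_error)
      (use admissible_facts[OF adm] admissible_eps[OF adm] num_angles_ge num_radii_ge i z in auto)
qed

text \<open>
  \<open>\<delta>\<close> is the relative error of the NUFFT, with \<open>c = 2\<close> for Algorithm I and \<open>c = 3\<close> for Algorithm II. The last inequality
  says that the NUFFT error, after multiplication by the Lebesgue constant and by \<open>c\<^sub>i h \<le> 2\<close>, is at most \<open>3 \<epsilon> / (2 c)\<close>.
\<close>
lemma budget:
  fixes \<epsilon> :: real and q :: nat
  assumes "0 < \<epsilon>" "\<epsilon> \<le> 1" "q \<ge> 1" and c: "2 \<le> c" "c \<le> 3"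
  defines "\<delta> \<equiv> inverse (2 * sqrt 2 * (c + pi / 2 * ln (real q))) * (\<epsilon> / 4)"
  shows "0 < \<delta>" "\<delta> \<le> 1 / 20" "2 * (2 * pi + 2 * (1 + ln (real q))) * \<delta> * c \<le> 3 / 2 * \<epsilon>"
proof -
  let ?W = "c + pi / 2 * ln (real q)"
  have ln: "0 \<le> ln (real q)" using assms by simp
  have r2: "1.414 \<le> sqrt 2" by (rule real_le_rsqrt) (simp add: power2_eq_square)
  have "0 \<le> pi / 2 * ln (real q)" using ln by simp
  then have W: "2 \<le> ?W" using c by linarith
  have \<delta>: "\<delta> * (8 * sqrt 2 * ?W) = \<epsilon>" 
  proof -
    have "inverse (2 * r * w) * (\<epsilon> / 4) * (8 * r * w) = \<epsilon>" if "r \<noteq> 0" "w \<noteq> 0" for r w :: real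
      using that by (simp add: field_simps)
    then show ?thesis unfolding \<delta>_def using W by simp
  qed
  show pos: "0 < \<delta>" using W assms by (simp add: \<delta>_def)
  have "8 * 1.414 * 2 \<le> 8 * sqrt 2 * ?W" using r2 W by (intro mult_mono) auto
  then have "\<delta> * (8 * 1.414 * 2) \<le> \<delta> * (8 * sqrt 2 * ?W)" using pos by (intro mult_left_mono) auto
  also note \<delta>
  finally show "\<delta> \<le> 1 / 20" using assms(2) by simp
  have "2 * (2 * pi + 2 * (1 + ln (real q))) * c \<le> 3 / 2 * (8 * 1.414 * ?W)"
  proof -
    have "4 * pi + 4 \<le> 16.968" using pi_approx by simp
    then have "(4 * pi + 4) * c \<le> 16.968 * c" using c by (intro mult_right_mono) auto
    moreover have "4 * ln (real q) * c \<le> 3 / 2 * (8 * 1.414 * (pi / 2 * ln (real q)))" 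
    proof -
      have "4 * ln (real q) * c \<le> 4 * ln (real q) * 3" using ln c by (intro mult_left_mono) auto
      moreover have "3 * ln (real q) \<le> pi * ln (real q)" using ln pi_gt3 by (intro mult_right_mono) auto
      ultimately have "4 * ln (real q) * c \<le> 4 * (pi * ln (real q))" by linarith
      also have "\<dots> \<le> 3 / 2 * (8 * 1.414 * (pi / 2 * ln (real q)))" using ln by simp
      finally show ?thesis .
    qed
    ultimately show ?thesis by (simp add: algebra_simps)
  qed
  also have "\<dots> \<le> 3 / 2 * (8 * sqrt 2 * ?W)" using r2 W by (intro mult_left_mono mult_right_mono) auto
  finally have "\<delta> * (2 * (2 * pi + 2 * (1 + ln (real q))) * c) \<le> \<delta> * (3 / 2 * (8 * sqrt 2 * ?W))"
    using pos by (intro mult_left_mono) auto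
  also have "\<dots> = 3 / 2 * \<epsilon>" unfolding \<delta>[symmetric] by (simp only: mult_ac)
  finally show "2 * (2 * pi + 2 * (1 + ln (real q))) * \<delta> * c \<le> 3 / 2 * \<epsilon>" by (simp only: mult_ac)
qed

text \<open>
  \<open>\<eta>\<close> is the relative error of the fast Chebyshev interpolation, with \<open>c = 4\<close> for Algorithm I and \<open>c = 2\<close> for Algorithm II.
\<close>
lemma budget_fst:
  fixes \<epsilon> c :: real and q :: nat
  assumes "0 < \<epsilon>" "\<epsilon> \<le> 1" "q \<ge> 1" "1 \<le> c"
  defines "\<eta> \<equiv> inverse (c * sqrt 2 * real q) * (\<epsilon> / 4)"
  shows "0 < \<eta>" "\<eta> * real q \<le> \<epsilon> / (5.5 * c)" "\<eta> \<le> 1 / 2"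
proof -
  have r2: "1.375 \<le> sqrt 2" by (rule real_le_rsqrt) (simp add: power2_eq_square)
  show pos: "0 < \<eta>" using assms by (simp add: \<eta>_def)
  have "inverse (c * r * w) * (\<epsilon> / 4) * w = \<epsilon> / (4 * r * c)" if "r \<noteq> 0" "w \<noteq> 0" for r w :: real
    using that assms(4) by (simp add: field_simps)
  then have "\<eta> * real q = \<epsilon> / (4 * sqrt 2 * c)" unfolding \<eta>_def using assms(3) by simp
  also have "\<dots> \<le> \<epsilon> / (5.5 * c)"
    using r2 assms by (intro divide_left_mono mult_right_mono mult_pos_pos) auto
  finally show *: "\<eta> * real q \<le> \<epsilon> / (5.5 * c)" .
  have "\<eta> * 1 \<le> \<eta> * real q" using pos assms(3) by (intro mult_left_mono) auto
  also note *
  also have "\<epsilon> / (5.5 * c) \<le> 1 / 2" using assms by (intro frac_le) auto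
  finally show "\<eta> \<le> 1 / 2" by simp
qed

text \<open>
  Before the multiplication by \<open>c\<^sub>i h \<le> 2\<close>, and relative to the \<open>\<ell>\<^sup>1\<close>-norm of the image, the error of the Chebyshev
  interpolation is at most \<open>\<epsilon>/20\<close>, the error inherited from the NUFFT at most \<open>3 \<epsilon>/8\<close>, and the kernel error at
  most \<open>3 \<epsilon>/40\<close>. These add up to \<open>\<epsilon>/2\<close>.
\<close>
lemma algorithm_I_error:
  assumes nufft: "is_nufft (- 1) nufft" and fft: "is_fft (- 1) fft" and cheb: "is_cheb_interp cheb"
    and adm: "admissible L x lam m md \<epsilon>" and img: "is_image L x f" and i: "i < m"
  shows "cmod (fst (algorithm_I nufft fft cheb L x m md \<epsilon> f) i - transform_Bstar L x md f i) \<le> \<epsilon> * l1_norm (L^2) f"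
proof -
  define p where "p = L^2"
  define s where "s = num_angles p \<epsilon>"
  define q where "q = num_radii p \<epsilon>"
  define t0 where "t0 = mode_root md 0"
  define t1 where "t1 = mode_root md (m - 1)"
  define \<delta> where "\<delta> = inverse (2 * sqrt 2 * (2 + pi / 2 * ln (real q))) * (\<epsilon> / 4)"
  define \<eta> where "\<eta> = inverse (4 * sqrt 2 * real q) * (\<epsilon> / 4)"
  define F where "F = l1_norm p f"
  define n where "n = fst (md i)"
  define \<mu> where "\<mu> = mode_root md i"
  define ch where "ch = mode_const md i * pixel_size L"
  define a where "a = fst (nufft \<delta> {..<p} x ({..<q} \<times> {..<s}) (freq_node t0 t1 q s) f)"
  define \<beta> where "\<beta> = (\<lambda>n k. \<i> powi n / of_nat s * fst (fft s (\<lambda>l. a (k, l))) (nat (n mod int s)))"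
  define V where "V = fst (cheb \<eta> t0 t1 q {i. i < m \<and> fst (md i) = n} (mode_root md) (\<beta> n)) i"
  note facts = admissible_facts[OF adm] and eps = admissible_eps[OF adm]
  have alg: "fst (algorithm_I nufft fft cheb L x m md \<epsilon> f) i = of_real ch * V"
    by (simp add: algorithm_I_def Let_def p_def s_def q_def t0_def t1_def \<delta>_def \<eta>_def a_def \<beta>_def V_def n_def ch_def)
  have "L > 0" using facts(1) by simp
  then have q: "q \<ge> 1" and s: "s > 0"
    unfolding q_def s_def p_def using num_radii_pos[of L \<epsilon>] num_angles_pos[of L \<epsilon>] by simp_all
  note bud = budget[OF eps(3,4) q, of 2, folded \<delta>_def, simplified]
  have \<eta>0: "0 < \<eta>" and \<eta>1: "\<eta> \<le> 1" and \<eta>q: "\<eta> * real q \<le> \<epsilon> / 22"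
    using budget_fst[OF eps(3,4) q, of 4, folded \<eta>_def] by simp_all
  have F0: "0 \<le> F" by (simp add: F_def l1_norm_def sum_nonneg)
  let ?E = "\<lambda>l. wave (of_int n * angle s l)"
  define a0 where "a0 = (\<lambda>k l. \<Sum>j<p. f j * wave (x j \<bullet> freq_node t0 t1 q s (k, l)))"
  define b0 where "b0 = (\<lambda>k. \<i> powi n / of_nat s * (\<Sum>l<s. a0 k l * ?E l))"
  have b: "\<beta> n k = \<i> powi n / of_nat s * (\<Sum>l<s. a (k, l) * ?E l)" for k
    unfolding \<beta>_def fft_minus_apply[OF fft s] ..
  have da: "cmod (a (k, l) - a0 k l) \<le> \<delta> * F" if "k < q" "l < s" for k l
    using nufft_bound[OF nufft, of "{..<p}" "{..<q} \<times> {..<s}" \<delta> "(k, l)" x "freq_node t0 t1 q s" f] bud that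
    by (simp add: a_def a0_def F_def l1_norm_def)
  have na0: "cmod (a0 k l) \<le> F" for k l
    unfolding a0_def F_def l1_norm_def by (rule sum_norm_le) (simp add: norm_mult)
  have avg: "cmod (\<i> powi n / of_nat s * (\<Sum>l<s. g l * ?E l)) \<le> C" if "\<And>l. l < s \<Longrightarrow> cmod (g l) \<le> C" for g C
  proof -
    have "cmod (\<Sum>l<s. g l * ?E l) \<le> (\<Sum>l<s. C)"
      by (rule sum_norm_le) (use that in \<open>simp add: norm_mult\<close>)
    then show ?thesis using s by (simp add: norm_mult norm_divide divide_le_eq mult.commute)
  qed
  have db: "cmod (\<beta> n k - b0 k) \<le> \<delta> * F" if "k < q" for k
    unfolding b b0_def right_diff_distrib[symmetric] sum_subtractf[symmetric] left_diff_distrib[symmetric]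
    by (rule avg) (rule da[OF that])
  have nb: "cmod (\<beta> n k) \<le> (1 + \<delta>) * F" if "k < q" for k
    unfolding b
  proof (rule avg)
    fix l assume "l < s"
    have "cmod (a (k, l)) \<le> cmod (a0 k l) + cmod (a (k, l) - a0 k l)" by (metis norm_triangle_sub)
    then show "cmod (a (k, l)) \<le> (1 + \<delta>) * F" using na0[of k l] da[OF that \<open>l < s\<close>] by (simp add: algebra_simps)
  qed
  define u where "u = (\<lambda>k. lagrange_u t0 t1 q k \<mu>)"
  have mem: "\<mu> \<in> {t0..t1}" unfolding \<mu>_def t0_def t1_def by (rule admissible_mode_mem[OF adm i])
  have lam: "(\<Sum>k<q. \<bar>u k\<bar>) \<le> 2 * pi + 2 * (1 + ln (real q))"
    unfolding u_def by (rule lebesgue_constant) (use facts(3) mem q in \<open>auto simp: t0_def t1_def\<close>)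
  have "cmod (V - (\<Sum>k<q. \<beta> n k * of_real (u k))) \<le> \<eta> * (\<Sum>k<q. cmod (\<beta> n k))"
    unfolding V_def u_def \<mu>_def
  proof (rule cheb_interp_bound[OF cheb])
    show "t0 < t1" using facts(3) by (simp add: t0_def t1_def)
    show "mode_root md ` {i. i < m \<and> fst (md i) = n} \<subseteq> {t0..t1}"
      using admissible_mode_mem[OF adm] unfolding t0_def t1_def by blast
  qed (use q \<eta>0 \<eta>1 i in \<open>auto simp: n_def\<close>)
  also have "\<dots> \<le> \<eta> * (\<Sum>k<q. (1 + \<delta>) * F)" using nb \<eta>0 by (intro mult_left_mono sum_mono) auto
  also have "\<dots> = (\<eta> * real q) * (1 + \<delta>) * F" by simp
  also have "\<dots> \<le> (\<epsilon> / 22) * (1 + 1 / 20) * F"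
    using \<eta>q bud eps F0 by (intro mult_right_mono mult_mono) auto
  also have "\<dots> \<le> \<epsilon> / 20 * F" using F0 eps by (intro mult_right_mono) auto
  finally have e1: "cmod (V - (\<Sum>k<q. \<beta> n k * of_real (u k))) \<le> \<epsilon> / 20 * F" .
  have "cmod ((\<Sum>k<q. \<beta> n k * of_real (u k)) - (\<Sum>k<q. b0 k * of_real (u k))) \<le> (\<Sum>k<q. (\<delta> * F) * \<bar>u k\<bar>)"
    unfolding sum_subtractf[symmetric] left_diff_distrib[symmetric]
  proof (rule sum_norm_le)
    fix k assume "k \<in> {..<q}"
    then show "cmod ((\<beta> n k - b0 k) * complex_of_real (u k)) \<le> (\<delta> * F) * \<bar>u k\<bar>"
      unfolding norm_mult norm_of_real by (intro mult_right_mono db) auto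
  qed
  also have "\<dots> = (\<delta> * F) * (\<Sum>k<q. \<bar>u k\<bar>)" by (simp add: sum_distrib_left)
  also have "\<dots> \<le> (\<delta> * F) * (2 * pi + 2 * (1 + ln (real q)))" using lam bud F0 by (intro mult_left_mono) auto
  also have "\<dots> = (\<delta> * (2 * pi + 2 * (1 + ln (real q)))) * F" by (simp only: mult_ac)
  also have "\<dots> \<le> (3 / 8 * \<epsilon>) * F" using bud F0 by (intro mult_right_mono) (auto simp: algebra_simps)
  finally have e2: "cmod ((\<Sum>k<q. \<beta> n k * of_real (u k)) - (\<Sum>k<q. b0 k * of_real (u k))) \<le> (3 / 8 * \<epsilon>) * F" .
  define K where "K = (\<lambda>z. disk_kernel t0 t1 q s n \<mu> z)"
  let ?e = "\<lambda>j k l. wave (x j \<bullet> freq_node t0 t1 q s (k, l))"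
  let ?K = "\<lambda>k j. of_real (u k) * (\<i> powi n / of_nat s * (\<Sum>l<s. ?e j k l * ?E l))"
  have S: "(\<Sum>k<q. b0 k * of_real (u k)) = (\<Sum>j<p. f j * K (x j))"
  proof -
    have "b0 k * of_real (u k) = (\<Sum>j<p. f j * ?K k j)" for k
    proof -
      have "(\<Sum>l<s. a0 k l * ?E l) = (\<Sum>l<s. \<Sum>j<p. f j * (?e j k l * ?E l))"
        unfolding a0_def sum_distrib_right by (simp only: mult.assoc)
      also have "\<dots> = (\<Sum>j<p. f j * (\<Sum>l<s. ?e j k l * ?E l))"
        unfolding sum_distrib_left by (rule sum.swap)
      finally have "b0 k * of_real (u k) = of_real (u k) * (\<i> powi n / of_nat s * (\<Sum>j<p. f j * (\<Sum>l<s. ?e j k l * ?E l)))"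
        unfolding b0_def by (simp only: mult_ac)
      then show ?thesis by (simp only: sum_distrib_left mult_ac)
    qed
    then have "(\<Sum>k<q. b0 k * of_real (u k)) = (\<Sum>k<q. \<Sum>j<p. f j * ?K k j)"
      by simp
    also have "\<dots> = (\<Sum>j<p. \<Sum>k<q. f j * ?K k j)"
      by (rule sum.swap)
    also have "\<dots> = (\<Sum>j<p. f j * K (x j))"
      unfolding K_def disk_kernel_def u_def by (simp only: sum_distrib_left)
    finally show ?thesis .
  qed
  have "\<exists>g. f j * cnj (psi_at md i (x j)) * of_real (pixel_size L) = of_real ch * (f j * g) \<and> cmod (f j) * cmod (K (x j) - g) \<le> cmod (f j) * (3 / 40 * \<epsilon>)" if "j < p" for j
  proof (cases "cmod (x j) < 1")
    case True
    obtain g where "cnj (psi_at md i (x j)) = of_real (mode_const md i) * g" "cmod (K (x j) - g) \<le> 3 / 40 * \<epsilon>"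
      using mode_kernel_error[OF adm i True] unfolding K_def t0_def t1_def q_def s_def n_def \<mu>_def p_def by blast
    then show ?thesis by (intro exI[of _ g] conjI mult_left_mono) (simp_all add: ch_def mult_ac)
  next
    case False
    then have "f j = 0" using img that by (simp add: is_image_def p_def)
    then show ?thesis by simp
  qed
  then obtain g where g: "\<And>j. j < p \<Longrightarrow> f j * cnj (psi_at md i (x j)) * of_real (pixel_size L) = of_real ch * (f j * g j)"
    "\<And>j. j < p \<Longrightarrow> cmod (f j) * cmod (K (x j) - g j) \<le> cmod (f j) * (3 / 40 * \<epsilon>)"
    by metis
  have B: "transform_Bstar L x md f i = of_real ch * (\<Sum>j<p. f j * g j)"
    unfolding transform_Bstar_def p_def[symmetric] sum_distrib_left by (intro sum.cong) (use g in auto)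
  have "cmod ((\<Sum>j<p. f j * K (x j)) - (\<Sum>j<p. f j * g j)) \<le> (\<Sum>j<p. cmod (f j) * (3 / 40 * \<epsilon>))"
    unfolding sum_subtractf[symmetric] right_diff_distrib[symmetric]
    by (rule sum_norm_le) (use g in \<open>simp add: norm_mult\<close>)
  also have "\<dots> = 3 / 40 * \<epsilon> * F" by (simp add: F_def l1_norm_def sum_distrib_left mult_ac)
  finally have e3: "cmod ((\<Sum>k<q. b0 k * of_real (u k)) - (\<Sum>j<p. f j * g j)) \<le> 3 / 40 * \<epsilon> * F" unfolding S .
  have "cmod (V - (\<Sum>j<p. f j * g j)) \<le> \<epsilon> / 20 * F + (3 / 8 * \<epsilon>) * F + 3 / 40 * \<epsilon> * F"
    by (rule norm_diff_triangle_le[OF norm_diff_triangle_le[OF e1 e2] e3])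
  also have "\<dots> = \<epsilon> / 2 * F" by (simp add: algebra_simps)
  finally have tot: "cmod (V - (\<Sum>j<p. f j * g j)) \<le> \<epsilon> / 2 * F" .
  have ch: "0 \<le> ch" "ch \<le> 2" unfolding ch_def by (rule admissible_const[OF adm i])+
  have "cmod (of_real ch * V - of_real ch * (\<Sum>j<p. f j * g j)) = ch * cmod (V - (\<Sum>j<p. f j * g j))"
    using ch(1) unfolding right_diff_distrib[symmetric] norm_mult norm_of_real by simp
  also have "\<dots> \<le> 2 * (\<epsilon> / 2 * F)"
    using ch tot by (intro mult_mono) auto
  finally show ?thesis unfolding alg B by (simp add: F_def p_def)
qed

text \<open>
  The same estimates in the reverse order. The NUFFT error is relative to the \<open>\<ell>\<^sup>1\<close>-norm of its input. There the
  Lebesgue constant enters: summed over the nodes, the adjoint interpolation of mode \<open>i\<close> has the weight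
  \<open>\<Sum>\<^sub>k |u\<^sub>k(\<lambda>\<^sub>i)|\<close>.
\<close>
lemma algorithm_II_error:
  assumes nufft: "is_nufft 1 nufft" and fft: "is_fft 1 fft" and cheb: "is_cheb_adjoint cheb"
    and adm: "admissible L x lam m md \<epsilon>" and j: "j < L^2"
  shows "cmod (fst (algorithm_II nufft fft cheb L x m md \<epsilon> \<alpha>) j - transform_B L x m md \<alpha> j) \<le> \<epsilon> * l1_norm m \<alpha>"
proof (cases "cmod (x j) < 1")
  case False
  then have "transform_B L x m md \<alpha> j = 0" by (simp add: transform_B_def psi_at_def psi_def)
  moreover have "fst (algorithm_II nufft fft cheb L x m md \<epsilon> \<alpha>) j = 0"
    using False by (simp add: algorithm_II_def Let_def)
  ultimately show ?thesis using admissible_eps(3)[OF adm] by (simp add: l1_norm_def sum_nonneg)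
next
  case True
  define p where "p = L^2"
  define s where "s = num_angles p \<epsilon>"
  define q where "q = num_radii p \<epsilon>"
  define t0 where "t0 = mode_root md 0"
  define t1 where "t1 = mode_root md (m - 1)"
  define N where "N = max_order m md"
  define \<delta> where "\<delta> = inverse (2 * sqrt 2 * (3 + pi / 2 * ln (real q))) * (\<epsilon> / 4)"
  define \<eta> where "\<eta> = inverse (2 * sqrt 2 * real q) * (\<epsilon> / 4)"
  define G where "G = l1_norm m \<alpha>"
  define ch where "ch = (\<lambda>i. mode_const md i * pixel_size L)"
  let ?T = "{..<q} \<times> {..<s}"
  define I where "I = (\<lambda>n. {i. i < m \<and> fst (md i) = n})"
  define \<beta> where "\<beta> = (\<lambda>n k. fst (cheb \<eta> t0 t1 q (I n) (mode_root md) (\<lambda>i. of_real (ch i) * \<alpha> i)) k)"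
  define X where "X = (\<lambda>n k. (- \<i>) powi n / of_nat s * \<beta> n k)"
  define A where "A = (\<lambda>(k, l). fst (fft s (\<lambda>r. \<Sum>n | n \<in> {-N..N} \<and> nat (n mod int s) = r. X n k)) l)"
  define out where "out = fst (nufft \<delta> ?T (freq_node t0 t1 q s) {..<p} x A) j"
  note facts = admissible_facts[OF adm] and eps = admissible_eps[OF adm]
  have alg: "fst (algorithm_II nufft fft cheb L x m md \<epsilon> \<alpha>) j = out"
    using True
    by (simp add: algorithm_II_def Let_def p_def s_def q_def t0_def t1_def N_def \<delta>_def \<eta>_def \<beta>_def X_def A_def out_def ch_def I_def)
  have "L > 0" using facts(1) by simp
  then have q: "q \<ge> 1" and s: "s > 0"
    unfolding q_def s_def p_def using num_radii_pos[of L \<epsilon>] num_angles_pos[of L \<epsilon>] by simp_all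
  note bud = budget[OF eps(3,4) q, of 3, folded \<delta>_def, simplified]
  have \<eta>0: "0 < \<eta>" and \<eta>1: "\<eta> \<le> 1" and \<eta>q: "\<eta> * real q \<le> \<epsilon> / 11"
    using budget_fst[OF eps(3,4) q, of 2, folded \<eta>_def] by simp_all
  have G0: "0 \<le> G" by (simp add: G_def l1_norm_def sum_nonneg)
  have ch: "0 \<le> ch i" "ch i \<le> 2" if "i < m" for i
    unfolding ch_def by (rule admissible_const[OF adm that])+
  have order: "fst (md i) \<in> {-N..N}" if "i < m" for i
    using disk_setup_order[of L x lam m md i] adm that unfolding N_def admissible_def by auto
  have finI: "finite (I n)" for n by (simp add: I_def)
  have regroup: "(\<Sum>n\<in>{-N..N}. \<Sum>i\<in>I n. h i) = (\<Sum>i<m. h i)" for h :: "nat \<Rightarrow> 'b::comm_monoid_add"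
    using sum.group[of "{..<m}" "{-N..N}" "\<lambda>i. fst (md i)" h] order by (force simp: I_def)
  define w where "w = (\<lambda>i. ch i * cmod (\<alpha> i))"
  have w0: "0 \<le> w i" if "i < m" for i using ch that by (simp add: w_def)
  have wsum: "(\<Sum>i<m. w i) \<le> 2 * G"
    unfolding G_def l1_norm_def sum_distrib_left w_def using ch by (intro sum_mono mult_right_mono) auto
  let ?u = "\<lambda>i k. lagrange_u t0 t1 q k (mode_root md i)"
  let ?E = "\<lambda>n l. exp (\<i> * of_real (of_int n * angle s l))"
  let ?e = "\<lambda>k l. exp (\<i> * of_real (x j \<bullet> freq_node t0 t1 q s (k, l)))"
  define b0 where "b0 = (\<lambda>n k. \<Sum>i\<in>I n. of_real (ch i) * \<alpha> i * of_real (?u i k))"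
  have normw: "cmod (of_real (ch i) * \<alpha> i) = w i" if "i < m" for i
    using ch(1)[OF that] by (simp add: w_def norm_mult)
  have db: "cmod (\<beta> n k - b0 n k) \<le> \<eta> * (\<Sum>i\<in>I n. w i)" if "k < q" for n k
  proof -
    have "cmod (\<beta> n k - b0 n k) \<le> \<eta> * (\<Sum>i\<in>I n. cmod (of_real (ch i) * \<alpha> i))"
      unfolding \<beta>_def b0_def
    proof (rule cheb_adjoint_bound[OF cheb _ finI _ q \<eta>0 \<eta>1 that])
      show "t0 < t1" using facts(3) by (simp add: t0_def t1_def)
      show "mode_root md ` I n \<subseteq> {t0..t1}"
        using admissible_mode_mem[OF adm] unfolding t0_def t1_def I_def by blast
    qed
    also have "(\<Sum>i\<in>I n. cmod (of_real (ch i) * \<alpha> i)) = (\<Sum>i\<in>I n. w i)"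
      by (intro sum.cong) (auto simp: I_def normw)
    finally show ?thesis .
  qed
  have A: "A (k, l) = (\<Sum>n\<in>{-N..N}. (- \<i>) powi n / of_nat s * \<beta> n k * ?E n l)" if "l < s" for k l
    unfolding A_def X_def prod.case by (rule fft_plus_apply[OF fft that]) simp
  define A0 where "A0 = (\<lambda>(k, l). \<Sum>n\<in>{-N..N}. (- \<i>) powi n / of_nat s * b0 n k * ?E n l)"
  have unit: "cmod ((- \<i>) powi n / of_nat s * b * ?E n l) = cmod b / real s" for n b l
    by (simp add: norm_mult norm_divide norm_power_int)
  have dA: "cmod (A (k, l) - A0 (k, l)) \<le> 2 * \<eta> * G / real s" if "k < q" "l < s" for k l
  proof -
    have "cmod (A (k, l) - A0 (k, l)) \<le> (\<Sum>n\<in>{-N..N}. \<eta> * (\<Sum>i\<in>I n. w i) / real s)"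
      unfolding A[OF that(2)] A0_def prod.case sum_subtractf[symmetric] left_diff_distrib[symmetric] right_diff_distrib[symmetric]
      by (rule sum_norm_le) (use db[OF that(1)] in \<open>simp only: unit divide_right_mono of_nat_0_le_iff\<close>)
    also have "\<dots> = \<eta> * (\<Sum>i<m. w i) / real s"
      unfolding sum_divide_distrib[symmetric] sum_distrib_left[symmetric] regroup ..
    also have "\<dots> \<le> \<eta> * (2 * G) / real s"
      using wsum \<eta>0 by (intro divide_right_mono mult_left_mono) auto
    finally show ?thesis by (simp add: mult_ac)
  qed
  have mem: "mode_root md i \<in> {t0..t1}" if "i < m" for i
    unfolding t0_def t1_def by (rule admissible_mode_mem[OF adm that])
  define \<Lambda> where "\<Lambda> = 2 * pi + 2 * (1 + ln (real q))"
  have lam: "(\<Sum>k<q. \<bar>?u i k\<bar>) \<le> \<Lambda>" if "i < m" for i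
    unfolding \<Lambda>_def by (rule lebesgue_constant) (use facts(3) mem[OF that] q in \<open>auto simp: t0_def t1_def\<close>)
  have sumA0: "(\<Sum>kl\<in>?T. cmod (A0 kl)) \<le> \<Lambda> * (2 * G)"
  proof -
    have "cmod (A0 (k, l)) \<le> (\<Sum>i<m. w i * \<bar>?u i k\<bar>) / real s" for k l
    proof -
      have "cmod (A0 (k, l)) \<le> (\<Sum>n\<in>{-N..N}. (\<Sum>i\<in>I n. w i * \<bar>?u i k\<bar>) / real s)"
        unfolding A0_def prod.case
      proof (rule sum_norm_le)
        fix n
        have "cmod (b0 n k) \<le> (\<Sum>i\<in>I n. w i * \<bar>?u i k\<bar>)"
          unfolding b0_def by (rule sum_norm_le) (simp add: norm_mult[of "_ * _" "of_real _"] normw I_def)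
        then show "cmod ((- \<i>) powi n / of_nat s * b0 n k * ?E n l) \<le> (\<Sum>i\<in>I n. w i * \<bar>?u i k\<bar>) / real s"
          unfolding unit by (rule divide_right_mono) simp
      qed
      then show ?thesis unfolding sum_divide_distrib[symmetric] regroup .
    qed
    then have "(\<Sum>kl\<in>?T. cmod (A0 kl)) \<le> (\<Sum>kl\<in>?T. (\<Sum>i<m. w i * \<bar>?u i (fst kl)\<bar>) / real s)"
      by (intro sum_mono) (metis prod.collapse)
    also have "\<dots> = (\<Sum>k<q. \<Sum>l<s. (\<Sum>i<m. w i * \<bar>?u i k\<bar>) / real s)"
      by (simp only: sum.cartesian_product case_prod_unfold)
    also have "\<dots> = (\<Sum>k<q. \<Sum>i<m. w i * \<bar>?u i k\<bar>)" using s by simp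
    also have "\<dots> = (\<Sum>i<m. w i * (\<Sum>k<q. \<bar>?u i k\<bar>))" unfolding sum_distrib_left by (rule sum.swap)
    also have "\<dots> \<le> (\<Sum>i<m. w i * \<Lambda>)" using lam w0 by (intro sum_mono mult_left_mono) auto
    also have "\<dots> = \<Lambda> * (\<Sum>i<m. w i)" by (simp add: sum_distrib_left mult.commute)
    also have "\<dots> \<le> \<Lambda> * (2 * G)" using wsum q pi_gt3 by (intro mult_left_mono) (auto simp: \<Lambda>_def)
    finally show ?thesis .
  qed
  have sumdA: "(\<Sum>kl\<in>?T. cmod (A kl - A0 kl)) \<le> 2 * (\<eta> * real q) * G"
  proof -
    have "(\<Sum>kl\<in>?T. cmod (A kl - A0 kl)) \<le> (\<Sum>kl\<in>?T. 2 * \<eta> * G / real s)"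
      by (rule sum_mono) (use dA in auto)
    also have "\<dots> = 2 * (\<eta> * real q) * G" using s by (simp add: card_cartesian_product)
    finally show ?thesis .
  qed
  have sumA: "(\<Sum>kl\<in>?T. cmod (A kl)) \<le> \<Lambda> * (2 * G) + 2 * (\<eta> * real q) * G"
  proof -
    have "(\<Sum>kl\<in>?T. cmod (A kl)) \<le> (\<Sum>kl\<in>?T. cmod (A0 kl) + cmod (A kl - A0 kl))"
      by (rule sum_mono) (metis norm_triangle_sub)
    then show ?thesis using sumA0 sumdA by (simp add: sum.distrib)
  qed
  let ?sA = "\<Sum>kl\<in>?T. A kl * ?e (fst kl) (snd kl)" and ?sB = "\<Sum>kl\<in>?T. A0 kl * ?e (fst kl) (snd kl)"
  have e1: "cmod (out - ?sA) \<le> \<delta> * (\<Lambda> * (2 * G) + 2 * (\<eta> * real q) * G)"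
  proof -
    have "cmod (out - (\<Sum>kl\<in>?T. A kl * exp (\<i> * complex_of_real (1 * (freq_node t0 t1 q s kl \<bullet> x j))))) \<le> \<delta> * (\<Sum>kl\<in>?T. cmod (A kl))"
      unfolding out_def by (rule nufft_bound[OF nufft]) (use bud j in \<open>auto simp: p_def\<close>)
    also have "\<dots> \<le> \<delta> * (\<Lambda> * (2 * G) + 2 * (\<eta> * real q) * G)" using sumA bud by (intro mult_left_mono) auto
    finally show ?thesis by (simp add: inner_commute)
  qed
  have e2: "cmod (?sA - ?sB) \<le> 2 * (\<eta> * real q) * G"
    unfolding sum_subtractf[symmetric] left_diff_distrib[symmetric]
    by (rule order_trans[OF norm_sum]) (use sumdA in \<open>simp add: norm_mult\<close>)
  define K where "K = (\<lambda>i. disk_kernel t0 t1 q s (fst (md i)) (mode_root md i) (x j))"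
  have cK: "cnj (K i) = (\<Sum>k<q. of_real (?u i k) * ((- \<i>) powi fst (md i) / of_nat s * (\<Sum>l<s. ?e k l * ?E (fst (md i)) l)))" for i
    by (simp add: K_def disk_kernel_def cnj_sum exp_cnj)
  let ?t = "\<lambda>i k l. of_real (ch i) * \<alpha> i * (of_real (?u i k) * ((- \<i>) powi fst (md i) / of_nat s * (?e k l * ?E (fst (md i)) l)))"
  have S: "?sB = (\<Sum>i<m. of_real (ch i) * \<alpha> i * cnj (K i))"
  proof -
    have "A0 (k, l) * ?e k l = (\<Sum>i<m. ?t i k l)" for k l
    proof -
      have "A0 (k, l) * ?e k l = (\<Sum>n\<in>{-N..N}. \<Sum>i\<in>I n. of_real (ch i) * \<alpha> i * (of_real (?u i k) * ((- \<i>) powi n / of_nat s * (?e k l * ?E n l))))"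
        unfolding A0_def b0_def prod.case sum_distrib_left sum_distrib_right by (simp only: mult_ac)
      also have "\<dots> = (\<Sum>n\<in>{-N..N}. \<Sum>i\<in>I n. ?t i k l)"
        by (intro sum.cong) (auto simp: I_def)
      finally show ?thesis unfolding regroup .
    qed
    then have "?sB = (\<Sum>kl\<in>?T. \<Sum>i<m. ?t i (fst kl) (snd kl))"
      by (metis prod.collapse)
    also have "\<dots> = (\<Sum>i<m. \<Sum>kl\<in>?T. ?t i (fst kl) (snd kl))"
      by (rule sum.swap)
    also have "\<dots> = (\<Sum>i<m. \<Sum>k<q. \<Sum>l<s. ?t i k l)"
      by (simp only: sum.cartesian_product case_prod_unfold)
    also have "\<dots> = (\<Sum>i<m. of_real (ch i) * \<alpha> i * cnj (K i))"
      unfolding cK sum_distrib_left ..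
    finally show ?thesis .
  qed
  have "\<exists>g. psi_at md i (x j) = of_real (mode_const md i) * g \<and> cmod (cnj (K i) - g) \<le> 3 / 40 * \<epsilon>" if i: "i < m" for i
  proof -
    obtain g where g: "cnj (psi_at md i (x j)) = of_real (mode_const md i) * g" "cmod (K i - g) \<le> 3 / 40 * \<epsilon>"
      using mode_kernel_error[OF adm i True] unfolding K_def t0_def t1_def q_def s_def p_def by blast
    have "psi_at md i (x j) = of_real (mode_const md i) * cnj g"
      using arg_cong[OF g(1), of cnj] by simp
    moreover have "cmod (cnj (K i) - cnj g) \<le> 3 / 40 * \<epsilon>"
      using g(2) unfolding complex_cnj_diff[symmetric] complex_mod_cnj .
    ultimately show ?thesis by blast
  qed
  then obtain g where g: "\<And>i. i < m \<Longrightarrow> psi_at md i (x j) = of_real (mode_const md i) * g i"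
    "\<And>i. i < m \<Longrightarrow> cmod (cnj (K i) - g i) \<le> 3 / 40 * \<epsilon>"
    by metis
  have B: "transform_B L x m md \<alpha> j = (\<Sum>i<m. of_real (ch i) * \<alpha> i * g i)"
    unfolding transform_B_def by (intro sum.cong) (auto simp: g ch_def)
  have "cmod ((\<Sum>i<m. of_real (ch i) * \<alpha> i * cnj (K i)) - (\<Sum>i<m. of_real (ch i) * \<alpha> i * g i)) \<le> (\<Sum>i<m. w i * (3 / 40 * \<epsilon>))"
    unfolding sum_subtractf[symmetric] right_diff_distrib[symmetric]
  proof (rule sum_norm_le)
    fix i assume "i \<in> {..<m}"
    then have i: "i < m" by simp
    have "cmod (of_real (ch i) * \<alpha> i * (cnj (K i) - g i)) = w i * cmod (cnj (K i) - g i)"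
      unfolding norm_mult[of "_ * _" "_ - _"] normw[OF i] ..
    also have "\<dots> \<le> w i * (3 / 40 * \<epsilon>)" by (rule mult_left_mono[OF g(2)[OF i] w0[OF i]])
    finally show "cmod (of_real (ch i) * \<alpha> i * (cnj (K i) - g i)) \<le> w i * (3 / 40 * \<epsilon>)" .
  qed
  also have "\<dots> = (\<Sum>i<m. w i) * (3 / 40 * \<epsilon>)" by (rule sum_distrib_right[symmetric])
  also have "\<dots> \<le> (2 * G) * (3 / 40 * \<epsilon>)" using wsum eps by (intro mult_right_mono) auto
  finally have e3: "cmod (?sB - transform_B L x m md \<alpha> j) \<le> (2 * G) * (3 / 40 * \<epsilon>)"
    unfolding S B .
  have "cmod (out - transform_B L x m md \<alpha> j) \<le> \<delta> * (\<Lambda> * (2 * G) + 2 * (\<eta> * real q) * G) + 2 * (\<eta> * real q) * G + (2 * G) * (3 / 40 * \<epsilon>)"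
    by (rule norm_diff_triangle_le[OF norm_diff_triangle_le[OF e1 e2] e3])
  also have "\<dots> = (2 * (\<delta> * \<Lambda>) + 2 * \<delta> * (\<eta> * real q) + 2 * (\<eta> * real q) + 3 / 20 * \<epsilon>) * G"
    by (simp add: algebra_simps)
  also have "\<dots> \<le> \<epsilon> * G"
  proof (rule mult_right_mono[OF _ G0])
    have "2 * (\<delta> * \<Lambda>) \<le> \<epsilon> / 2" using bud unfolding \<Lambda>_def by (simp add: algebra_simps)
    moreover have "2 * \<delta> * (\<eta> * real q) \<le> 2 * (1 / 20) * (\<epsilon> / 11)"
      using bud \<eta>q \<eta>0 by (intro mult_mono) auto
    ultimately show "2 * (\<delta> * \<Lambda>) + 2 * \<delta> * (\<eta> * real q) + 2 * (\<eta> * real q) + 3 / 20 * \<epsilon> \<le> \<epsilon>"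
      using \<eta>q eps by simp
  qed
  finally show ?thesis unfolding alg G_def .
qed

section \<open>Operation counts\<close>

text \<open>
  The square of \<open>ln (1/\<delta>)\<close> contains the term \<open>(ln ln p)\<^sup>2\<close>, up to constants; this crude estimate suffices to absorb it
  in \<open>ln p\<close>.
\<close>
lemma ln_square_le: 
  assumes "1 \<le> (v::real)"
  shows "(ln v)\<^sup>2 \<le> 4 * v"
proof -
  have "ln v = 2 * ln (sqrt v)" using assms by (simp add: ln_sqrt)
  also have "\<dots> \<le> 2 * sqrt v" using ln_le_minus_one[of "sqrt v"] assms by simp
  finally have "(ln v)\<^sup>2 \<le> (2 * sqrt v)\<^sup>2" using assms by (intro power_mono) auto
  then show ?thesis using assms by (simp add: power_mult_distrib)
qed

lemma ln_mult_le_nat_ln: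
  fixes c l :: real
  assumes "2 \<le> l" "0 < c" "c \<le> 2 ^ k"
  shows "ln (c * l) \<le> real (Suc k) * ln l"
proof -
  have "(2::real) ^ k \<le> l ^ k" using assms by (intro power_mono) auto
  then have "c * l \<le> l ^ Suc k" using assms by simp
  then have "ln (c * l) \<le> ln (l ^ Suc k)" using assms by (subst ln_le_cancel_iff) auto
  also have "\<dots> = real (Suc k) * ln l" using assms by (simp only: ln_realpow)
  finally show ?thesis .
qed

lemma admissible_ln_ge_1:
  assumes "2 \<le> L"
  shows "1 \<le> ln (real (L^2))" "ln (real (L^2)) = 2 * ln (real L)"
proof -
  show eq: "ln (real (L^2)) = 2 * ln (real L)" using assms by (simp add: ln_realpow)
  have "ln 2 \<le> ln (real L)" using assms by simp
  then show "1 \<le> ln (real (L^2))" unfolding eq using ln2_ge_two_thirds by simp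
qed

lemma inverse_mult_divide: "inverse a * (e / b) = e / (b * a)" for a b e :: real
  by (simp add: divide_inverse)

text \<open>
  As \<open>|ln \<epsilon>| \<le> L\<close>, the logarithm of the discretisation accuracy is \<open>O(L)\<close>, and therefore so are \<open>q\<close> and \<open>s\<close>.
\<close>
lemma discretization_log_le:
  assumes adm: "admissible L x lam m md \<epsilon>"
  shows "\<bar>log 2 (eps_dis (L^2) \<epsilon>)\<bar> \<le> 78 * real L"
proof -
  note eps = admissible_eps[OF adm]
  define l where "l = real L"
  have l: "2 \<le> l" using admissible_facts(1)[OF adm] by (simp add: l_def)
  define V where "V = 4 * sqrt 2 * (3 + pi / 2 * ln (2.4 * l))"
  have ln0: "0 \<le> ln (2.4 * l)" using l by simp
  have r2: "1 \<le> sqrt 2" "sqrt 2 \<le> 1.5" by simp (rule real_le_lsqrt, simp_all add: power2_eq_square)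
  have "4 * 1 * 3 \<le> V" unfolding V_def using r2 ln0 by (intro mult_mono) auto
  then have V1: "1 \<le> V" by simp
  have "ln (2.4 * l) \<le> 2.4 * l" using ln_le_minus_one[of "2.4 * l"] l by simp
  then have "pi / 2 * ln (2.4 * l) \<le> 2 * (2.4 * l)" using pi_less_4 ln0 by (intro mult_mono) auto
  then have "3 + pi / 2 * ln (2.4 * l) \<le> 6.3 * l" using l by simp
  then have "V \<le> 4 * 1.5 * (6.3 * l)" unfolding V_def using r2 ln0 by (intro mult_mono) auto
  then have V2: "V \<le> 37.8 * l" by simp
  have "eps_dis (L^2) \<epsilon> = \<epsilon> / V"
    unfolding eps_dis_def inverse_mult_divide V_def l_def by simp
  then have "ln (eps_dis (L^2) \<epsilon>) = ln \<epsilon> - ln V" using eps(3) V1 by (simp add: ln_div)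
  then have "\<bar>ln (eps_dis (L^2) \<epsilon>)\<bar> \<le> l + ln V" using eps(2) ln_ge_zero[OF V1] unfolding l_def by linarith
  also have "\<dots> \<le> 38.8 * l" using ln_le_minus_one[of V] V1 V2 by simp
  finally have "\<bar>ln (eps_dis (L^2) \<epsilon>)\<bar> / ln 2 \<le> (38.8 * l) / (1 / 2)"
    using ln2_ge_two_thirds l by (intro frac_le) auto
  also have "\<dots> \<le> 78 * l" using l by simp
  finally show ?thesis by (simp add: log_def l_def abs_divide)
qed

lemma nat_ceiling_le: "0 \<le> r \<Longrightarrow> real (nat \<lceil>r\<rceil>) \<le> r + 1"
  by linarith

text \<open>
  Crude constants: \<open>80\<close> exceeds \<open>78 + 1\<close> from \<open>discretization_log_le\<close> and rounding up, and \<open>80 \<le> 2\<^sup>7 \<le> L\<^sup>7\<close>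
  gives \<open>ln (80 L) \<le> 8 ln L = 4 ln p\<close>.
\<close>
lemma admissible_sizes:
  assumes adm: "admissible L x lam m md \<epsilon>"
  defines "s \<equiv> num_angles (L^2) \<epsilon>" and "q \<equiv> num_radii (L^2) \<epsilon>" and "N \<equiv> max_order m md"
  shows "2 \<le> q" "2 \<le> s" "real q \<le> 80 * real L" "real s \<le> 80 * real L"
    "ln (real q) \<le> 4 * ln (real (L^2))" "ln (real s) \<le> 4 * ln (real (L^2))"
    "real (card {-N..N}) \<le> 5 * real L" "real m \<le> 25 * real (L^2)"
proof -
  have L: "2 \<le> L" by (rule admissible_facts(1)[OF adm])
  note A = discretization_log_le[OF adm]
  have "4 \<le> 2.4 * real L" "4 \<le> 7.09 * real L" using L by simp_all
  then have "4 \<le> real q" "4 \<le> real s"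
    unfolding q_def s_def using num_radii_ge[of L \<epsilon>] num_angles_ge[of L \<epsilon>] by (meson order_trans)+
  then show q2: "2 \<le> q" and s2: "2 \<le> s" by simp_all
  show q: "real q \<le> 80 * real L"
    unfolding q_def num_radii_def by (rule order_trans[OF nat_ceiling_le]) (use A L in auto)
  show s: "real s \<le> 80 * real L"
    unfolding s_def num_angles_def by (rule order_trans[OF nat_ceiling_le]) (use A L in auto)
  have "ln (80 * real L) \<le> real (Suc 7) * ln (real L)" using L by (intro ln_mult_le_nat_ln) auto
  then have big: "ln (80 * real L) \<le> 4 * ln (real (L^2))" unfolding admissible_ln_ge_1(2)[OF L] by simp
  have "ln (real q) \<le> ln (80 * real L)" using q q2 L by (subst ln_le_cancel_iff) auto
  with big show "ln (real q) \<le> 4 * ln (real (L^2))" by linarith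
  have "ln (real s) \<le> ln (80 * real L)" using s s2 L by (subst ln_le_cancel_iff) auto
  with big show "ln (real s) \<le> 4 * ln (real (L^2))" by linarith
  have su: "disk_setup L x lam m md" using adm by (simp add: admissible_def)
  note lam = admissible_lam(2)[OF adm]
  note N = disk_setup_max_order[OF su, folded N_def]
  have "real (card {-N..N}) = 2 * real_of_int N + 1" using N(1) by simp
  also have "\<dots> \<le> 2 * (1.7725 * real L) + 1" using N(2) lam by linarith
  also have "\<dots> \<le> 5 * real L" using L by simp
  finally show "real (card {-N..N}) \<le> 5 * real L" .
  have "real m \<le> (2 * lam + 1)\<^sup>2" by (rule disk_setup_num_modes[OF su])
  also have "\<dots> \<le> (5 * real L)\<^sup>2"
  proof (rule power_mono)
    have "2 * lam + 1 \<le> 2 * (1.7725 * real L) + 1" using lam by linarith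
    also have "\<dots> \<le> 5 * real L" using L by simp
    finally show "2 * lam + 1 \<le> 5 * real L" .
  qed (use disk_setup_pos(3)[OF su] in simp)
  finally show "real m \<le> 25 * real (L^2)" by (simp add: power_mult_distrib)
qed

lemma nufft_tolerance:
  assumes adm: "admissible L x lam m md \<epsilon>" and c: "2 \<le> c" "c \<le> (3::real)"
  defines "q \<equiv> num_radii (L^2) \<epsilon>"
  defines "\<delta> \<equiv> inverse (2 * sqrt 2 * (c + pi / 2 * ln (real q))) * (\<epsilon> / 4)"
  shows "0 < \<delta>" "\<delta> \<le> 1 / 2" "(ln (1 / \<delta>))\<^sup>2 \<le> 2 * \<bar>ln \<epsilon>\<bar>\<^sup>2 + 1056 * ln (real (L^2))"
proof -
  note eps = admissible_eps[OF adm] and sz = admissible_sizes[OF adm, folded q_def]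
  have "1 \<le> q" using sz(1) by simp
  from budget(1,2)[OF eps(3,4) this c] show "0 < \<delta>" "\<delta> \<le> 1 / 2" by (simp_all add: \<delta>_def)
  define lp where "lp = ln (real (L^2))"
  have lp: "1 \<le> lp" using admissible_ln_ge_1(1)[OF admissible_facts(1)[OF adm]] by (simp add: lp_def)
  have lnq: "0 \<le> ln (real q)" "ln (real q) \<le> 4 * lp" using sz(1,5) by (auto simp: lp_def)
  define V where "V = 8 * sqrt 2 * (c + pi / 2 * ln (real q))"
  have r2: "1 \<le> sqrt 2" "sqrt 2 \<le> 1.5" by simp (rule real_le_lsqrt, simp_all add: power2_eq_square)
  have "0 \<le> pi / 2 * ln (real q)" using lnq by simp
  then have W: "2 \<le> c + pi / 2 * ln (real q)" using c by linarith
  have "8 * 1 * 2 \<le> V" unfolding V_def using r2 W by (intro mult_mono) auto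
  then have V1: "1 \<le> V" by simp
  have "pi / 2 * ln (real q) \<le> 2 * (4 * lp)" using pi_less_4 lnq by (intro mult_mono) auto
  then have "c + pi / 2 * ln (real q) \<le> 11 * lp" using c lp by linarith
  then have "V \<le> 8 * 1.5 * (11 * lp)" unfolding V_def using r2 W by (intro mult_mono) auto
  then have V2: "V \<le> 132 * lp" by simp
  have "\<delta> = \<epsilon> / V" unfolding \<delta>_def inverse_mult_divide V_def by simp
  then have "1 / \<delta> = V / \<epsilon>" by simp
  then have "ln (1 / \<delta>) = ln V - ln \<epsilon>" using eps(3) V1 by (simp add: ln_div)
  then have "(ln (1 / \<delta>))\<^sup>2 = (ln V - ln \<epsilon>)\<^sup>2" by simp
  also have "\<dots> \<le> 2 * (ln \<epsilon>)\<^sup>2 + 2 * (ln V)\<^sup>2"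
    using zero_le_power2[of "ln V + ln \<epsilon>"] by (simp add: power2_eq_square algebra_simps)
  also have "\<dots> \<le> 2 * \<bar>ln \<epsilon>\<bar>\<^sup>2 + 2 * (4 * (132 * lp))" using ln_square_le[OF V1] V2 by simp
  finally show "(ln (1 / \<delta>))\<^sup>2 \<le> 2 * \<bar>ln \<epsilon>\<bar>\<^sup>2 + 1056 * ln (real (L^2))" by (simp add: lp_def)
qed

lemma interp_tolerance:
  assumes adm: "admissible L x lam m md \<epsilon>" and c: "1 \<le> c" "c \<le> (4::real)"
  defines "q \<equiv> num_radii (L^2) \<epsilon>"
  defines "\<eta> \<equiv> inverse (c * sqrt 2 * real q) * (\<epsilon> / 4)"
  shows "0 < \<eta>" "\<eta> \<le> 1 / 2" "\<bar>ln \<eta>\<bar> \<le> \<bar>ln \<epsilon>\<bar> + 6 * ln (real (L^2))"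
proof -
  note eps = admissible_eps[OF adm] and sz = admissible_sizes[OF adm, folded q_def]
  have "1 \<le> q" using sz(1) by simp
  from budget_fst(1,3)[OF eps(3,4) this c(1)] show "0 < \<eta>" "\<eta> \<le> 1 / 2" by (simp_all add: \<eta>_def)
  have L: "2 \<le> L" by (rule admissible_facts(1)[OF adm])
  define V where "V = 4 * c * sqrt 2 * real q"
  have r2: "1 \<le> sqrt 2" "sqrt 2 \<le> 1.5" by simp (rule real_le_lsqrt, simp_all add: power2_eq_square)
  have "4 * 1 * 1 * 1 \<le> V" unfolding V_def using r2 c sz(1) by (intro mult_mono) auto
  then have V1: "1 \<le> V" by simp
  have "V \<le> 4 * 4 * 1.5 * (80 * real L)" unfolding V_def using r2 c sz(3) by (intro mult_mono) auto
  then have "ln V \<le> ln (1920 * real L)" using V1 L by (subst ln_le_cancel_iff) auto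
  also have "\<dots> \<le> real (Suc 11) * ln (real L)" using L by (intro ln_mult_le_nat_ln) auto
  also have "\<dots> = 6 * ln (real (L^2))" unfolding admissible_ln_ge_1(2)[OF L] by simp
  finally have V2: "ln V \<le> 6 * ln (real (L^2))" .
  have "\<eta> = \<epsilon> / V" unfolding \<eta>_def inverse_mult_divide V_def by (simp only: mult.assoc)
  then have "ln \<eta> = ln \<epsilon> - ln V" using eps(3) V1 by (simp add: ln_div)
  then show "\<bar>ln \<eta>\<bar> \<le> \<bar>ln \<epsilon>\<bar> + 6 * ln (real (L^2))" using ln_ge_zero[OF V1] V2 by linarith
qed

text \<open>
  The constants hidden in the \<open>O\<close>-bounds, taken nonnegative so that upper bounds for the sizes can be inserted.
\<close>
definition nufft_cost_const :: "('a, 'b, 'v::euclidean_space) nufft \<Rightarrow> real \<Rightarrow> bool" where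
  "nufft_cost_const F C \<longleftrightarrow> 0 \<le> C \<and> (\<forall>\<delta> A y B \<eta> v. finite A \<and> finite B \<and> 2 \<le> card A \<and> 0 < \<delta> \<and> \<delta> \<le> 1/2 \<longrightarrow>
     real (snd (F \<delta> A y B \<eta> v)) \<le> C * (real (card A) * ln (real (card A)) + real (card B) * ln (1 / \<delta>) ^ DIM('v)))"

definition fft_cost_const :: "fft \<Rightarrow> real \<Rightarrow> bool" where
  "fft_cost_const F C \<longleftrightarrow> 0 \<le> C \<and> (\<forall>N v. 2 \<le> N \<longrightarrow> real (snd (F N v)) \<le> C * (real N * ln (real N)))"

definition cheb_cost_const :: "cheb_map \<Rightarrow> real \<Rightarrow> bool" where
  "cheb_cost_const F C \<longleftrightarrow> 0 \<le> C \<and> (\<forall>\<delta> a b q I w v. a < b \<and> finite I \<and> w ` I \<subseteq> {a..b} \<and> 2 \<le> q \<and> 0 < \<delta> \<and> \<delta> \<le> 1/2 \<longrightarrow>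
     real (snd (F \<delta> a b q I w v)) \<le> C * (real q * ln (real q) + real (card I) * \<bar>ln \<delta>\<bar>))"

lemma le_max_mult: "x \<le> C * y \<Longrightarrow> 0 \<le> y \<Longrightarrow> x \<le> max C 0 * (y::real)"
  by (erule order_trans) (intro mult_right_mono, auto)

lemma nufft_cost: "is_nufft \<sigma> F \<Longrightarrow> \<exists>C. nufft_cost_const F C"
  unfolding nufft_cost_const_def
  apply (drule is_nufft_def[THEN iffD1, THEN conjunct2])
  apply (erule exE)
  subgoal for C
    apply (intro exI[of _ "max C 0"] conjI allI impI le_max_mult)
      apply simp
     apply (elim allE, erule (1) mp)
    apply (intro add_nonneg_nonneg mult_nonneg_nonneg; simp)
    done
  done

lemma fft_cost: "is_fft \<sigma> F \<Longrightarrow> \<exists>C. fft_cost_const F C"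
  unfolding fft_cost_const_def
  apply (drule is_fft_def[THEN iffD1, THEN conjunct2])
  apply (erule exE)
  subgoal for C
    apply (intro exI[of _ "max C 0"] conjI allI impI le_max_mult)
      apply simp
     apply (elim allE, erule (1) mp)
    apply (intro add_nonneg_nonneg mult_nonneg_nonneg; simp)
    done
  done

lemma cheb_cost: "cheb_cost_bound F \<Longrightarrow> \<exists>C. cheb_cost_const F C"
  unfolding cheb_cost_const_def
  apply (drule cheb_cost_bound_def[THEN iffD1])
  apply (erule exE)
  subgoal for C
    apply (intro exI[of _ "max C 0"] conjI allI impI le_max_mult)
      apply simp
     apply (elim allE, erule (1) mp)
    apply (intro add_nonneg_nonneg mult_nonneg_nonneg; simp)
    done
  done

definition cost_scale :: "nat \<Rightarrow> real \<Rightarrow> real" where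
  "cost_scale L \<epsilon> = real (L^2) * ln (real (L^2)) + real (L^2) * \<bar>ln \<epsilon>\<bar>^2"

lemma cost_scale_ge:
  assumes "2 \<le> L"
  shows "real (L^2) * ln (real (L^2)) \<le> cost_scale L \<epsilon>" "real (L^2) * \<bar>ln \<epsilon>\<bar>^2 \<le> cost_scale L \<epsilon>"
    "real (L^2) \<le> cost_scale L \<epsilon>" "real (L^2) * \<bar>ln \<epsilon>\<bar> \<le> cost_scale L \<epsilon>"
proof -
  note lp = admissible_ln_ge_1(1)[OF assms]
  show 1: "real (L^2) * ln (real (L^2)) \<le> cost_scale L \<epsilon>" by (simp add: cost_scale_def)
  have "0 \<le> real (L^2) * ln (real (L^2))" using lp by (intro mult_nonneg_nonneg) auto
  then show "real (L^2) * \<bar>ln \<epsilon>\<bar>^2 \<le> cost_scale L \<epsilon>" unfolding cost_scale_def by linarith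
  have "real (L^2) * 1 \<le> real (L^2) * ln (real (L^2))" using lp by (intro mult_left_mono) auto
  with 1 show "real (L^2) \<le> cost_scale L \<epsilon>" by linarith
  have "\<bar>ln \<epsilon>\<bar> \<le> 1 + \<bar>ln \<epsilon>\<bar>^2" using zero_le_power2[of "\<bar>ln \<epsilon>\<bar> - 1"] 
    by (simp add: power2_eq_square algebra_simps)
  then have "\<bar>ln \<epsilon>\<bar> \<le> ln (real (L^2)) + \<bar>ln \<epsilon>\<bar>^2" using lp by linarith
  then have "real (L^2) * \<bar>ln \<epsilon>\<bar> \<le> real (L^2) * (ln (real (L^2)) + \<bar>ln \<epsilon>\<bar>^2)" by (intro mult_left_mono) auto
  then show "real (L^2) * \<bar>ln \<epsilon>\<bar> \<le> cost_scale L \<epsilon>" by (simp add: cost_scale_def distrib_left)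
qed

lemma cost_pieces:
  assumes adm: "admissible L x lam m md \<epsilon>"
  defines "s \<equiv> num_angles (L^2) \<epsilon>" and "q \<equiv> num_radii (L^2) \<epsilon>" and "N \<equiv> max_order m md" and "P \<equiv> cost_scale L \<epsilon>"
    and "p \<equiv> real (L^2)"
  shows "real q * real s \<le> 6400 * p"
    "\<And>D. D \<le> 2 * (ln \<epsilon>)\<^sup>2 + 1056 * ln p \<Longrightarrow> p * D \<le> 1058 * P"
    "real q * real s * ln (real q * real s) \<le> 51200 * P"
    "real q * (real s * ln (real s)) \<le> 25600 * P"
    "real q * real (card {-N..N}) \<le> 400 * P"
    "real (card {-N..N}) * (real q * ln (real q)) \<le> 1600 * P"
    "\<And>h. h \<le> \<bar>ln \<epsilon>\<bar> + 6 * ln p \<Longrightarrow> real m * h \<le> 175 * P"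
    "real m \<le> 25 * P" "0 \<le> P" "p * ln p \<le> P"
proof -
  have L: "2 \<le> L" by (rule admissible_facts(1)[OF adm])
  note sz = admissible_sizes[OF adm, folded s_def q_def N_def p_def]
  note ge = cost_scale_ge[OF L, of \<epsilon>, folded P_def p_def]
  have pl: "p = real L * real L" by (simp add: p_def power2_eq_square)
  have p0: "0 \<le> p" by (simp add: p_def)
  have lp: "1 \<le> ln p" unfolding p_def by (rule admissible_ln_ge_1(1)[OF L])
  show P0: "0 \<le> P" using ge(3) p0 by linarith
  show "p * ln p \<le> P" by (rule ge(1))
  have "real q * real s \<le> (80 * real L) * (80 * real L)" using sz by (intro mult_mono) auto
  then show qs: "real q * real s \<le> 6400 * p" by (simp add: pl)
  show "p * D \<le> 1058 * P" if "D \<le> 2 * (ln \<epsilon>)\<^sup>2 + 1056 * ln p" for D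
  proof -
    have "p * D \<le> p * (2 * (ln \<epsilon>)\<^sup>2 + 1056 * ln p)" using that p0 by (rule mult_left_mono)
    also have "\<dots> = 2 * (p * \<bar>ln \<epsilon>\<bar>^2) + 1056 * (p * ln p)" by (simp add: algebra_simps)
    finally show ?thesis using ge by linarith
  qed
  have lnqs: "ln (real q * real s) = ln (real q) + ln (real s)" using sz(1,2) by (intro ln_mult_pos) auto
  then have "ln (real q * real s) \<le> 8 * ln p" using sz by linarith
  moreover have "0 \<le> ln (real q * real s)" unfolding lnqs using sz(1,2) by (intro add_nonneg_nonneg ln_ge_zero) auto
  ultimately have "real q * real s * ln (real q * real s) \<le> (6400 * p) * (8 * ln p)"
    using p0 by (intro mult_mono[OF qs]) simp_all
  also have "\<dots> = 51200 * (p * ln p)" by simp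
  finally show "real q * real s * ln (real q * real s) \<le> 51200 * P" using ge by linarith
  have "real q * real s * ln (real s) \<le> (6400 * p) * (4 * ln p)"
    using p0 sz by (intro mult_mono[OF qs]) simp_all
  also have "\<dots> = 25600 * (p * ln p)" by simp
  finally show "real q * (real s * ln (real s)) \<le> 25600 * P" using ge(1) unfolding mult.assoc by linarith
  have "real q * real (card {-N..N}) \<le> (80 * real L) * (5 * real L)" using sz by (intro mult_mono) auto
  then have qN: "real q * real (card {-N..N}) \<le> 400 * p" by (simp add: pl)
  then show "real q * real (card {-N..N}) \<le> 400 * P" using ge by linarith
  have "real q * real (card {-N..N}) * ln (real q) \<le> (400 * p) * (4 * ln p)"
    using p0 sz by (intro mult_mono[OF qN]) simp_all
  also have "\<dots> = 1600 * (p * ln p)" by simp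
  finally have "real q * real (card {-N..N}) * ln (real q) \<le> 1600 * P" using ge(1) by linarith
  then show "real (card {-N..N}) * (real q * ln (real q)) \<le> 1600 * P" by (simp only: mult_ac)
  show "real m * h \<le> 175 * P" if "h \<le> \<bar>ln \<epsilon>\<bar> + 6 * ln p" for h
  proof -
    have "real m * h \<le> real m * (\<bar>ln \<epsilon>\<bar> + 6 * ln p)" using that by (intro mult_left_mono) auto
    also have "\<dots> \<le> (25 * p) * (\<bar>ln \<epsilon>\<bar> + 6 * ln p)" using sz lp by (intro mult_right_mono) auto
    also have "\<dots> = 25 * (p * \<bar>ln \<epsilon>\<bar>) + 150 * (p * ln p)" by (simp add: algebra_simps)
    finally show ?thesis using ge by linarith
  qed
  show "real m \<le> 25 * P" using sz(8) ge by linarith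
qed

text \<open>
  The orders split the modes into disjoint classes, so the target counts of the separate interpolations add up
  to \<open>m\<close>, while the setup cost \<open>q ln q\<close> is paid for \<open>O(\<surd>p)\<close> orders.
\<close>
lemma sum_cheb_cost:
  assumes adm: "admissible L x lam m md \<epsilon>" and F: "cheb_cost_const F C" and c: "1 \<le> c" "c \<le> (4::real)"
  defines "q \<equiv> num_radii (L^2) \<epsilon>"
  defines "\<eta> \<equiv> inverse (c * sqrt 2 * real q) * (\<epsilon> / 4)"
  shows "real (\<Sum>n\<in>{-max_order m md..max_order m md}. snd (F \<eta> (mode_root md 0) (mode_root md (m - 1)) q
      {i. i < m \<and> fst (md i) = n} (mode_root md) (v n))) \<le> C * 1775 * cost_scale L \<epsilon>"
proof -
  note tol = interp_tolerance[OF adm c, folded q_def, folded \<eta>_def]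
  let ?T = "{-max_order m md..max_order m md}" and ?q = "real q"
    and ?I = "\<lambda>n. {i. i < m \<and> fst (md i) = n}"
  let ?g = "\<lambda>n. snd (F \<eta> (mode_root md 0) (mode_root md (m - 1)) q (?I n) (mode_root md) (v n))"
  note pc = cost_pieces[OF adm, folded q_def]
  have g: "real (?g n) \<le> C * (?q * ln ?q + real (card (?I n)) * \<bar>ln \<eta>\<bar>)" for n
    by (rule F[unfolded cheb_cost_const_def, THEN conjunct2, rule_format])
      (use admissible_facts(3)[OF adm] admissible_mode_mem[OF adm] admissible_sizes(1)[OF adm] tol in \<open>auto simp: q_def\<close>)
  have sub: "(\<lambda>i. fst (md i)) ` {..<m} \<subseteq> ?T"
    using disk_setup_order[of L x lam m md] adm unfolding admissible_def by force
  have "(\<Sum>n\<in>?T. card (?I n)) = m"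
    using sum.group[OF finite_lessThan finite_atLeastAtMost_int sub, of "\<lambda>_. 1::nat"] by simp
  then have cards: "(\<Sum>n\<in>?T. real (card (?I n))) = real m"
    by (simp flip: of_nat_sum)
  have "real (\<Sum>n\<in>?T. ?g n) \<le> (\<Sum>n\<in>?T. C * (?q * ln ?q + real (card (?I n)) * \<bar>ln \<eta>\<bar>))"
    unfolding of_nat_sum by (intro sum_mono g)
  also have "\<dots> = C * (real (card ?T) * (?q * ln ?q) + real m * \<bar>ln \<eta>\<bar>)"
    unfolding sum_distrib_left[symmetric] sum.distrib sum_distrib_right[symmetric] cards by simp
  also have "\<dots> \<le> C * (1600 * cost_scale L \<epsilon> + 175 * cost_scale L \<epsilon>)"
    using F[unfolded cheb_cost_const_def] pc(6) pc(7)[OF tol(3)] by (intro mult_left_mono add_mono) auto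
  finally show ?thesis by (simp add: algebra_simps)
qed

lemma sum_fft_cost:
  assumes adm: "admissible L x lam m md \<epsilon>" and F: "fft_cost_const F C"
  defines "s \<equiv> num_angles (L^2) \<epsilon>" and "q \<equiv> num_radii (L^2) \<epsilon>"
  shows "real (\<Sum>k<q. snd (F s (v k))) \<le> C * 25600 * cost_scale L \<epsilon>"
proof -
  have "real (\<Sum>k<q. snd (F s (v k))) \<le> (\<Sum>k<q. C * (real s * ln (real s)))"
    unfolding of_nat_sum using F[unfolded fft_cost_const_def] admissible_sizes(2)[OF adm, folded s_def] by (intro sum_mono) blast
  also have "\<dots> = C * (real q * (real s * ln (real s)))" by simp
  also have "\<dots> \<le> C * (25600 * cost_scale L \<epsilon>)"
    using F[unfolded fft_cost_const_def] cost_pieces(4)[OF adm, folded s_def q_def] by (intro mult_left_mono) auto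
  finally show ?thesis by simp
qed

lemma algorithm_I_cost:
  assumes nufft: "is_nufft (- 1) nufft" and fft: "is_fft (- 1) fft" and cheb: "is_cheb_interp cheb"
  shows "\<exists>K. \<forall>L x lam m md \<epsilon> f. admissible L x lam m md \<epsilon> \<longrightarrow>
    real (snd (algorithm_I nufft fft cheb L x m md \<epsilon> f)) \<le> K * cost_scale L \<epsilon>"
proof -
  obtain C1 C2 C3 where C: "nufft_cost_const nufft C1" "fft_cost_const fft C2" "cheb_cost_const cheb C3"
    using nufft_cost[OF nufft] fft_cost[OF fft] cheb_cost[OF cheb[unfolded is_cheb_interp_def, THEN conjunct2]] by blast
  note C1 = C(1)[unfolded nufft_cost_const_def]
  show ?thesis
  \<comment> \<open>the coefficients are those of \<open>cost_pieces\<close>, with \<open>6771201 = 6400 \<cdot> 1058 + 1\<close> for the NUFFT\<close>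
  proof (intro exI[of _ "C1 * 6771201 + C2 * 25600 + 400 + C3 * 1775 + 25"] allI impI)
    fix L x lam m md \<epsilon> f
    assume adm: "admissible L x lam m md \<epsilon>"
    define p where "p = L^2"
    define s where "s = num_angles p \<epsilon>"
    define q where "q = num_radii p \<epsilon>"
    define N where "N = max_order m md"
    define t0 where "t0 = mode_root md 0"
    define t1 where "t1 = mode_root md (m - 1)"
    define \<delta> where "\<delta> = inverse (2 * sqrt 2 * (2 + pi / 2 * ln (real q))) * (\<epsilon> / 4)"
    define \<eta> where "\<eta> = inverse (4 * sqrt 2 * real q) * (\<epsilon> / 4)"
    define P where "P = cost_scale L \<epsilon>"
    define st1 where "st1 = nufft \<delta> {..<p} x ({..<q} \<times> {..<s}) (freq_node t0 t1 q s) f"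
    define st2 where "st2 = (\<lambda>k. fft s (\<lambda>l. fst st1 (k, l)))"
    define \<beta> where "\<beta> = (\<lambda>n k. \<i> powi n / of_nat s * fst (st2 k) (nat (n mod int s)))"
    define st3 where "st3 = (\<lambda>n. cheb \<eta> t0 t1 q {i. i < m \<and> fst (md i) = n} (mode_root md) (\<beta> n))"
    let ?ops = "snd (algorithm_I nufft fft cheb L x m md \<epsilon> f)"
    have alg: "?ops =
       snd st1 + (\<Sum>k<q. snd (st2 k)) + q * card {-N..N} + (\<Sum>n\<in>{-N..N}. snd (st3 n)) + m"
      by (simp add: algorithm_I_def Let_def p_def s_def q_def t0_def t1_def N_def \<delta>_def \<eta>_def st1_def st2_def \<beta>_def st3_def)
    note sz = admissible_sizes[OF adm, folded p_def, folded s_def q_def N_def]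
    note pc = cost_pieces[OF adm, folded p_def, folded s_def q_def N_def P_def]
    note tol = nufft_tolerance[OF adm, of 2, folded p_def, folded q_def, folded \<delta>_def, simplified]
    have p2: "2 \<le> p"
    proof -
      have "2 * 1 \<le> L * L" using admissible_facts(1)[OF adm] by (intro mult_mono) auto
      then show ?thesis by (simp add: p_def power2_eq_square)
    qed
    have "real (snd st1) \<le> C1 * (real (card {..<p}) * ln (real (card {..<p})) + real (card ({..<q} \<times> {..<s})) * (ln (1 / \<delta>))\<^sup>2)"
      unfolding st1_def by (rule order_trans[OF C1[THEN conjunct2, rule_format]]) (use p2 tol in auto)
    also have "\<dots> = C1 * (real p * ln (real p) + real q * real s * (ln (1 / \<delta>))\<^sup>2)"
      by (simp add: card_cartesian_product)
    also have "\<dots> \<le> C1 * (P + 6771200 * P)"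
    proof (intro mult_left_mono add_mono C1[THEN conjunct1] pc(10))
      have "real q * real s * (ln (1 / \<delta>))\<^sup>2 \<le> (6400 * real p) * (ln (1 / \<delta>))\<^sup>2"
        by (rule mult_right_mono[OF pc(1)]) simp
      also have "\<dots> \<le> 6400 * (1058 * P)" using pc(2)[OF tol(3)] by simp
      finally show "real q * real s * (ln (1 / \<delta>))\<^sup>2 \<le> 6771200 * P" by simp
    qed
    finally have c1: "real (snd st1) \<le> C1 * 6771201 * P" by (simp add: algebra_simps)
    have c2: "real (\<Sum>k<q. snd (st2 k)) \<le> C2 * 25600 * P"
      unfolding q_def p_def P_def st2_def s_def by (rule sum_fft_cost[OF adm C(2)])
    have c3: "real (\<Sum>n\<in>{-N..N}. snd (st3 n)) \<le> C3 * 1775 * P"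
      unfolding N_def P_def st3_def \<eta>_def q_def p_def t0_def t1_def by (rule sum_cheb_cost[OF adm C(3)]) simp_all
    have "real ?ops =
       real (snd st1) + real (\<Sum>k<q. snd (st2 k)) + real q * real (card {-N..N}) + real (\<Sum>n\<in>{-N..N}. snd (st3 n)) + real m"
      unfolding alg by (simp only: of_nat_add of_nat_mult)
    also have "\<dots> \<le> C1 * 6771201 * P + C2 * 25600 * P + 400 * P + C3 * 1775 * P + 25 * P"
      by (intro add_mono c1 c2 c3 pc(5) pc(8))
    finally show "real ?ops \<le> (C1 * 6771201 + C2 * 25600 + 400 + C3 * 1775 + 25) * cost_scale L \<epsilon>"
      by (simp only: P_def distrib_right)
  qed
qed

lemma algorithm_II_cost:
  assumes nufft: "is_nufft 1 nufft" and fft: "is_fft 1 fft" and cheb: "is_cheb_adjoint cheb"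
  shows "\<exists>K. \<forall>L x lam m md \<epsilon> \<alpha>. admissible L x lam m md \<epsilon> \<longrightarrow>
    real (snd (algorithm_II nufft fft cheb L x m md \<epsilon> \<alpha>)) \<le> K * cost_scale L \<epsilon>"
proof -
  obtain C1 C2 C3 where C: "nufft_cost_const nufft C1" "fft_cost_const fft C2" "cheb_cost_const cheb C3"
    using nufft_cost[OF nufft] fft_cost[OF fft] cheb_cost[OF cheb[unfolded is_cheb_adjoint_def, THEN conjunct2]] by blast
  note C1 = C(1)[unfolded nufft_cost_const_def]
  show ?thesis
  \<comment> \<open>here the NUFFT contributes \<open>52258 = 51200 + 1058\<close>\<close>
  proof (intro exI[of _ "25 + C3 * 1775 + 400 + C2 * 25600 + C1 * 52258"] allI impI)
    fix L x lam m md \<epsilon> \<alpha>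
    assume adm: "admissible L x lam m md \<epsilon>"
    define p where "p = L^2"
    define s where "s = num_angles p \<epsilon>"
    define q where "q = num_radii p \<epsilon>"
    define N where "N = max_order m md"
    define t0 where "t0 = mode_root md 0"
    define t1 where "t1 = mode_root md (m - 1)"
    define \<delta> where "\<delta> = inverse (2 * sqrt 2 * (3 + pi / 2 * ln (real q))) * (\<epsilon> / 4)"
    define \<eta> where "\<eta> = inverse (2 * sqrt 2 * real q) * (\<epsilon> / 4)"
    define P where "P = cost_scale L \<epsilon>"
    define st1 where "st1 = (\<lambda>n. cheb \<eta> t0 t1 q {i. i < m \<and> fst (md i) = n} (mode_root md) (\<lambda>i. of_real (mode_const md i * pixel_size L) * \<alpha> i))"
    define st2 where "st2 = (\<lambda>k. fft s (\<lambda>r. \<Sum>n | n \<in> {-N..N} \<and> nat (n mod int s) = r. (- \<i>) powi n / of_nat s * fst (st1 n) k))"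
    define st3 where "st3 = nufft \<delta> ({..<q} \<times> {..<s}) (freq_node t0 t1 q s) {..<p} x (\<lambda>(k, l). fst (st2 k) l)"
    let ?ops = "snd (algorithm_II nufft fft cheb L x m md \<epsilon> \<alpha>)"
    have alg: "?ops =
       m + (\<Sum>n\<in>{-N..N}. snd (st1 n)) + q * card {-N..N} + (\<Sum>k<q. snd (st2 k)) + snd st3"
      by (simp add: algorithm_II_def Let_def p_def s_def q_def t0_def t1_def N_def \<delta>_def \<eta>_def st1_def st2_def st3_def)
    note sz = admissible_sizes[OF adm, folded p_def, folded s_def q_def N_def]
    note pc = cost_pieces[OF adm, folded p_def, folded s_def q_def N_def P_def]
    note tol = nufft_tolerance[OF adm, of 3, folded p_def, folded q_def, folded \<delta>_def, simplified]
    have qs2: "2 \<le> q * s"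
    proof -
      have "2 * 1 \<le> q * s" using sz(1,2) by (intro mult_mono) auto
      then show ?thesis by simp
    qed
    have "real (snd st3) \<le> C1 * (real (card ({..<q} \<times> {..<s})) * ln (real (card ({..<q} \<times> {..<s}))) + real (card {..<p}) * (ln (1 / \<delta>))\<^sup>2)"
      unfolding st3_def by (rule order_trans[OF C1[THEN conjunct2, rule_format]]) (use qs2 tol in \<open>auto simp: card_cartesian_product\<close>)
    also have "\<dots> = C1 * (real q * real s * ln (real q * real s) + real p * (ln (1 / \<delta>))\<^sup>2)"
      by (simp add: card_cartesian_product)
    also have "\<dots> \<le> C1 * (51200 * P + 1058 * P)"
      by (intro mult_left_mono add_mono C1[THEN conjunct1] pc(3) pc(2)[OF tol(3)])
    finally have c1: "real (snd st3) \<le> C1 * 52258 * P" by (simp add: algebra_simps)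
    have c2: "real (\<Sum>k<q. snd (st2 k)) \<le> C2 * 25600 * P"
      unfolding q_def p_def P_def st2_def s_def by (rule sum_fft_cost[OF adm C(2)])
    have c3: "real (\<Sum>n\<in>{-N..N}. snd (st1 n)) \<le> C3 * 1775 * P"
      unfolding N_def P_def st1_def \<eta>_def q_def p_def t0_def t1_def by (rule sum_cheb_cost[OF adm C(3)]) simp_all
    have "real ?ops =
       real m + real (\<Sum>n\<in>{-N..N}. snd (st1 n)) + real q * real (card {-N..N}) + real (\<Sum>k<q. snd (st2 k)) + real (snd st3)"
      unfolding alg by (simp only: of_nat_add of_nat_mult)
    also have "\<dots> \<le> 25 * P + C3 * 1775 * P + 400 * P + C2 * 25600 * P + C1 * 52258 * P"
      by (intro add_mono c1 c2 c3 pc(5) pc(8))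
    finally show "real ?ops \<le> (25 + C3 * 1775 + 400 + C2 * 25600 + C1 * 52258) * cost_scale L \<epsilon>"
      by (simp only: P_def distrib_right)
  qed
qed

theorem theorem4p1:
  fixes nufft_I :: "(nat, nat \<times> nat, complex) nufft"
    and nufft_II :: "(nat \<times> nat, nat, complex) nufft"
    and fft_I fft_II :: fft
    and cheb cheb_adj :: cheb_map
  assumes "is_nufft (- 1) nufft_I" and "is_nufft 1 nufft_II"
    and "is_fft (- 1) fft_I" and "is_fft 1 fft_II"
    and "is_cheb_interp cheb" and "is_cheb_adjoint cheb_adj"
  shows "(\<forall>L x lam m md \<epsilon>.
            disk_setup L x lam m md \<and> 0 < \<epsilon> \<and> \<epsilon> \<le> 1 \<and>
            lam \<le> sqrt (pi * real (L^2)) \<and> \<bar>ln \<epsilon>\<bar> \<le> sqrt (real (L^2)) \<longrightarrow>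
            (\<forall>f. is_image L x f \<longrightarrow>
               linf_norm m (\<lambda>i. fst (algorithm_I nufft_I fft_I cheb L x m md \<epsilon> f) i
                                - transform_Bstar L x md f i)
               \<le> \<epsilon> * l1_norm (L^2) f) \<and>
            (\<forall>\<alpha>.
               linf_norm (L^2) (\<lambda>j. fst (algorithm_II nufft_II fft_II cheb_adj L x m md \<epsilon> \<alpha>) j
                                    - transform_B L x m md \<alpha> j)
               \<le> \<epsilon> * l1_norm m \<alpha>)) \<and>
         (\<exists>K. \<forall>L x lam m md \<epsilon>.
            disk_setup L x lam m md \<and> 0 < \<epsilon> \<and> \<epsilon> \<le> 1 \<and>
            lam \<le> sqrt (pi * real (L^2)) \<and> \<bar>ln \<epsilon>\<bar> \<le> sqrt (real (L^2)) \<longrightarrow>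
            (\<forall>f. is_image L x f \<longrightarrow>
               real (snd (algorithm_I nufft_I fft_I cheb L x m md \<epsilon> f))
               \<le> K * (real (L^2) * ln (real (L^2)) + real (L^2) * \<bar>ln \<epsilon>\<bar>^2)) \<and>
            (\<forall>\<alpha>.
               real (snd (algorithm_II nufft_II fft_II cheb_adj L x m md \<epsilon> \<alpha>))
               \<le> K * (real (L^2) * ln (real (L^2)) + real (L^2) * \<bar>ln \<epsilon>\<bar>^2)))"
proof -
  from algorithm_I_cost[OF assms(1,3,5)] obtain K1 where K1: "\<And>L x lam m md \<epsilon> f. admissible L x lam m md \<epsilon> \<Longrightarrow>
    real (snd (algorithm_I nufft_I fft_I cheb L x m md \<epsilon> f)) \<le> K1 * cost_scale L \<epsilon>" by blast
  from algorithm_II_cost[OF assms(2,4,6)] obtain K2 where K2: "\<And>L x lam m md \<epsilon> \<alpha>. admissible L x lam m md \<epsilon> \<Longrightarrow>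
    real (snd (algorithm_II nufft_II fft_II cheb_adj L x m md \<epsilon> \<alpha>)) \<le> K2 * cost_scale L \<epsilon>" by blast
  have scale: "0 \<le> cost_scale L \<epsilon>" if "admissible L x lam m md \<epsilon>" for L x lam m md \<epsilon>
    by (rule cost_pieces(9)[OF that])
  have E1: "linf_norm m (\<lambda>i. fst (algorithm_I nufft_I fft_I cheb L x m md \<epsilon> f) i - transform_Bstar L x md f i) \<le> \<epsilon> * l1_norm (L^2) f"
    if "admissible L x lam m md \<epsilon>" "is_image L x f" for L x lam m md \<epsilon> f
    by (intro linf_norm_le admissible_facts(5)[OF that(1)] algorithm_I_error[OF assms(1,3,5) that])
  have E2: "linf_norm (L^2) (\<lambda>j. fst (algorithm_II nufft_II fft_II cheb_adj L x m md \<epsilon> \<alpha>) j - transform_B L x m md \<alpha> j) \<le> \<epsilon> * l1_norm m \<alpha>"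
    if adm: "admissible L x lam m md \<epsilon>" for L x lam m md \<epsilon> \<alpha>
  proof (rule linf_norm_le)
    show "L^2 > 0" using admissible_facts(1)[OF adm] by simp
  qed (rule algorithm_II_error[OF assms(2,4,6) adm])
  have C1: "real (snd (algorithm_I nufft_I fft_I cheb L x m md \<epsilon> f)) \<le> max K1 K2 * cost_scale L \<epsilon>"
    if "admissible L x lam m md \<epsilon>" for L x lam m md \<epsilon> f
    by (rule order_trans[OF K1[OF that] mult_right_mono[OF max.cobounded1 scale[OF that]]])
  have C2: "real (snd (algorithm_II nufft_II fft_II cheb_adj L x m md \<epsilon> \<alpha>)) \<le> max K1 K2 * cost_scale L \<epsilon>"
    if "admissible L x lam m md \<epsilon>" for L x lam m md \<epsilon> \<alpha>
    by (rule order_trans[OF K2[OF that] mult_right_mono[OF max.cobounded2 scale[OF that]]])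
  show ?thesis
    unfolding admissible_def[symmetric] cost_scale_def[symmetric]
    by (intro conjI allI impI exI[of _ "max K1 K2"] E1 E2 C1 C2)
qed

end
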